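(* The set $$\mathfrak{B}_{W_{0,\mathsf q}}=\big\{x(z)_{l_m}\cdots x(z)_{l_1}1\;:\;m\in\mathbb{Z}_{\ge0},\ l_1,\dots,l_m\in\mathbb{Z},\ l_1\le-1,\ l_r\le-3\text{ for }r=2,3,\dots,m\big\}$$ forms a basis for $W_{0,\mathsf q}$.
   Context: Let $q$ be an indeterminate, $F=\mathbb{C}(q^{1/2})$, $[m]=\frac{q^m-q^{-m}}{q-q^{-1}}$. Let $K(1)=F[a(-1),a(-2),\dots]$ be the polynomial algebra on which $a(-r)$ ($r\ge1$) acts by multiplication and $a(r)$ ($r\ge1$) acts as the derivation with $a(r)\cdot a(-s)=\delta_{rs}\frac{[2r][r]}{r}$. Let $Q=\mathbb{Z}\alpha$, $(\alpha,\alpha)=2$; $F\{Q\}$ is the group algebra with basis $e^\beta$; $L_0=K(1)\otimes F\{Q\}$; $z^{\partial_\alpha}e^\beta=z^{(\alpha,\beta)}e^\beta$. The Frenkel–Jing operator is $$x(z)=\exp\Big(\sum_{r\ge1}\tfrac{q^{-r/2}}{[r]}a(-r)z^r\Big)\exp\Big(-\sum_{r\ge1}\tfrac{q^{-r/2}}{[r]}a(r)z^{-r}\Big)\otimes e^\alpha z^{\partial_\alpha}\in\mathrm{Hom}(L_0,L_0((z))).$$ Set $\mathsf q=q^2$, $[m]_{\mathsf q}=\frac{\mathsf q^m-1}{\mathsf q-1}$, $[l]_{\mathsf q}!=[l]_{\mathsf q}\cdots[1]_{\mathsf q}$; the $\mathsf q$-derivation is $a^{[1]}(z)=\frac{a(z\mathsf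 q)-a(z)}{z(\mathsf q-1)}$ and $a^{[n]}$ is its $n$-th iterate. For $l\le-1$ put $x(z)_l\,b(z)=\frac{1}{[-l-1]_{\mathsf q}!}x^{[-l-1]}(z)\,b(z\mathsf q^{-l-1})$; iterated expressions are nested to the right, and $1$ is the identity of $L_0$. $W_{0,\mathsf q}\subset\mathrm{Hom}(L_0,L_0((z)))$ is the $F$-span of all $x(z)_{l_m}\cdots x(z)_{l_1}1$ with $m\in\mathbb{Z}_{\ge0}$ and $l_j\le-1$ for $j=1,\dots,m$. *)

theory Defs
  imports
    Complex_Main
    "HOL-Library.Poly_Mapping"
    "HOL-Library.Function_Algebras"
    "HOL-Computational_Algebra.Fraction_Field"
    "HOL-Computational_Algebra.Formal_Laurent_Series"
begin

section \<open>The field \<open>F = \<complex>(q\<^bsup>1/2\<^esup>)\<close> and \<open>q\<close>-numbers\<close>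

text \<open>The indeterminate of the polynomial ring is \<open>q\<^bsup>1/2\<^esup>\<close>.\<close>

type_synonym F = "complex poly fract"

definition q_half :: F where
  "q_half = Fraction_Field.Fract [:0, 1:] 1"

definition q :: F where
  "q = q_half ^ 2"

definition qnum :: "nat \<Rightarrow> F" where
  "qnum m = (q ^ m - inverse q ^ m) / (q - inverse q)"

definition qq :: F where
  "qq = q ^ 2"

definition qqnum :: "nat \<Rightarrow> F" where
  "qqnum m = (qq ^ m - 1) / (qq - 1)"

definition qqfact :: "nat \<Rightarrow> F" where
  "qqfact l = (\<Prod>i = 1..l. qqnum i)"


section \<open>The space \<open>L\<^sub>0 = K(1) \<otimes> F{Q}\<close>\<close>

text \<open>
  \<open>K1\<close> is the polynomial ring over \<open>F\<close> in countably many variables, a monomial being a finitely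
  supported exponent vector. The variable with index \<open>i\<close> is \<open>a(-(i + 1))\<close>, so that there is no
  superfluous variable \<open>a(0)\<close>.
  An element of \<open>L0\<close> is a finite sum of terms \<open>u \<otimes> e\<^bsup>j\<alpha>\<^esup>\<close>, stored as \<open>Poly_Mapping.single j u\<close>;
  the product of \<open>L0\<close> is that of the group algebra of \<open>Q = \<int>\<alpha>\<close> over \<open>K1\<close>.
\<close>

type_synonym K1 = "(nat \<Rightarrow>\<^sub>0 nat) \<Rightarrow>\<^sub>0 F"
type_synonym L0 = "int \<Rightarrow>\<^sub>0 K1"

definition const_K :: "F \<Rightarrow> K1" where
  "const_K c = Poly_Mapping.single 0 c"

definition var_K :: "nat \<Rightarrow> K1" where
  "var_K i = Poly_Mapping.single (Poly_Mapping.single i 1) 1"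

definition partial_K :: "nat \<Rightarrow> K1 \<Rightarrow> K1" where
  "partial_K i p =
     (\<Sum>m \<in> Poly_Mapping.keys p.
        Poly_Mapping.single (m - Poly_Mapping.single i 1)
          (of_nat (Poly_Mapping.lookup m i) * Poly_Mapping.lookup p m))"

definition const_L :: "F \<Rightarrow> L0" where
  "const_L c = Poly_Mapping.single 0 (const_K c)"

definition scale_L :: "F \<Rightarrow> L0 \<Rightarrow> L0" where
  "scale_L c v = const_L c * v"

text \<open>The actions of \<open>a(-r)\<close> and \<open>a(r)\<close>, meant for \<open>r \<ge> 1\<close> only.\<close>

definition a_neg_K :: "nat \<Rightarrow> K1 \<Rightarrow> K1" where
  "a_neg_K r p = var_K (r - 1) * p"

definition a_pos_K :: "nat \<Rightarrow> K1 \<Rightarrow> K1" where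
  "a_pos_K r p = const_K (qnum (2 * r) * qnum r / of_nat r) * partial_K (r - 1) p"

definition a_neg :: "nat \<Rightarrow> L0 \<Rightarrow> L0" where
  "a_neg r = Poly_Mapping.map (a_neg_K r)"

definition a_pos :: "nat \<Rightarrow> L0 \<Rightarrow> L0" where
  "a_pos r = Poly_Mapping.map (a_pos_K r)"

definition e_alpha :: "L0 \<Rightarrow> L0" where
  "e_alpha v = Poly_Mapping.single 1 1 * v"

text \<open>
  That \<open>a_pos_K r\<close> really is the \<open>F\<close>-linear derivation of \<open>K1\<close> with the prescribed values on the
  generators:
\<close>

lemma partial_K_superset:
  assumes "finite S" "Poly_Mapping.keys p \<subseteq> S"
  shows "partial_K i p =
     (\<Sum>m \<in> S. Poly_Mapping.single (m - Poly_Mapping.single i 1)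
          (of_nat (Poly_Mapping.lookup m i) * Poly_Mapping.lookup p m))"
  unfolding partial_K_def
  by (rule sum.mono_neutral_left) (use assms in \<open>auto simp: in_keys_iff\<close>)

lemma partial_K_add: "partial_K i (p + r) = partial_K i p + partial_K i r"
proof -
  define S where "S = Poly_Mapping.keys p \<union> Poly_Mapping.keys r"
  have "finite S" "Poly_Mapping.keys (p + r) \<subseteq> S" "Poly_Mapping.keys p \<subseteq> S" "Poly_Mapping.keys r \<subseteq> S"
    using keys_add[of p r] by (auto simp: S_def)
  then show ?thesis
    by (simp add: partial_K_superset[of S] lookup_add distrib_left single_add sum.distrib)
qed

lemma partial_K_single:
  "partial_K i (Poly_Mapping.single m c) =
     Poly_Mapping.single (m - Poly_Mapping.single i 1) (of_nat (Poly_Mapping.lookup m i) * c)"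
  by (subst partial_K_superset[of "{m}"]) auto

lemma K1_induct [case_names zero single add]:
  fixes p :: "'a \<Rightarrow>\<^sub>0 'b :: comm_monoid_add"
  assumes "P 0" "\<And>m c. P (Poly_Mapping.single m c)" "\<And>p r. P p \<Longrightarrow> P r \<Longrightarrow> P (p + r)"
  shows "P p"
proof -
  have "P (\<Sum>m\<in>S. Poly_Mapping.single m (Poly_Mapping.lookup p m))" if "finite S" for S
    using that by induction (use assms in auto)
  moreover have "(\<Sum>m\<in>Poly_Mapping.keys p. Poly_Mapping.single m (Poly_Mapping.lookup p m)) = p"
    by (rule poly_mapping_eqI)
      (auto simp: lookup_sum lookup_single when_def in_keys_iff)
  ultimately show ?thesis
    by (metis finite_keys)
qed

lemma partial_K_zero: "partial_K i 0 = 0"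
  by (simp add: partial_K_def)

lemma exponent_diff_add:
  fixes m n :: "nat \<Rightarrow>\<^sub>0 nat"
  assumes "Poly_Mapping.lookup m i \<noteq> 0"
  shows "m + n - Poly_Mapping.single i 1 = m - Poly_Mapping.single i 1 + n"
  by (rule poly_mapping_eqI)
    (use assms in \<open>auto simp: lookup_minus lookup_add lookup_single when_def\<close>)

lemma partial_K_mult_single:
  "partial_K i (Poly_Mapping.single m c * Poly_Mapping.single n d) =
     partial_K i (Poly_Mapping.single m c) * Poly_Mapping.single n d +
     Poly_Mapping.single m c * partial_K i (Poly_Mapping.single n d)"
proof -
  let ?e = "Poly_Mapping.single i (1::nat)"
  have 1: "Poly_Mapping.single (m - ?e + n) (of_nat (Poly_Mapping.lookup m i) * c * d) =
     Poly_Mapping.single (m + n - ?e) (of_nat (Poly_Mapping.lookup m i) * c * d)"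
    by (cases "Poly_Mapping.lookup m i = 0") (simp_all add: exponent_diff_add del: One_nat_def)
  have 2: "Poly_Mapping.single (m + (n - ?e)) (of_nat (Poly_Mapping.lookup n i) * c * d) =
     Poly_Mapping.single (m + n - ?e) (of_nat (Poly_Mapping.lookup n i) * c * d)"
  proof (cases "Poly_Mapping.lookup n i = 0")
    case False
    then have "m + n - ?e = m + (n - ?e)"
      using exponent_diff_add[of n i m] by (simp add: add.commute del: One_nat_def)
    then show ?thesis by (simp del: One_nat_def)
  qed auto
  show ?thesis
    using 1 2
    by (simp add: mult_single partial_K_single lookup_add algebra_simps
        del: One_nat_def flip: single_add)
qed

lemma partial_K_mult: "partial_K i (p * r) = partial_K i p * r + p * partial_K i r"
proof (induction p rule: K1_induct)
  case (single m c)
  show ?case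
  proof (induction r rule: K1_induct)
    case (single n d)
    show ?case by (rule partial_K_mult_single)
  next
    case (add r s)
    then show ?case by (simp add: partial_K_add distrib_left algebra_simps)
  qed (simp add: partial_K_zero)
next
  case (add p s)
  then show ?case by (simp add: partial_K_add algebra_simps)
qed (simp add: partial_K_zero)

lemma a_pos_K_add: "a_pos_K r (p + s) = a_pos_K r p + a_pos_K r s"
  by (simp add: a_pos_K_def partial_K_add distrib_left)

lemma a_pos_K_mult: "a_pos_K r (p * s) = a_pos_K r p * s + p * a_pos_K r s"
  by (simp add: a_pos_K_def partial_K_mult algebra_simps)

lemma a_pos_K_const: "a_pos_K r (const_K c) = 0"
  by (simp add: a_pos_K_def const_K_def partial_K_single)

lemma a_pos_K_var:
  assumes "r \<ge> 1" "s \<ge> 1"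
  shows "a_pos_K r (a_neg_K s 1) = (if r = s then const_K (qnum (2 * r) * qnum r / of_nat r) else 0)"
  using assms
  by (auto simp: a_pos_K_def a_neg_K_def var_K_def partial_K_single lookup_single when_def)


section \<open>Formal exponentials\<close>

text \<open>
  For operators \<open>A\<^sub>1, A\<^sub>2, \<dots>\<close>, \<open>op_pow A n k\<close> is the coefficient of \<open>w\<^bsup>k\<^esup>\<close> in the \<open>n\<close>-th power
  of \<open>\<Sum>r\<ge>1. A\<^sub>r w\<^bsup>r\<^esup>\<close>. It vanishes for \<open>n > k\<close>, whence the finite sum in \<open>op_exp\<close>, the coefficient
  of \<open>w\<^bsup>k\<^esup>\<close> in the exponential.
\<close>

primrec op_pow :: "(nat \<Rightarrow> L0 \<Rightarrow> L0) \<Rightarrow> nat \<Rightarrow> nat \<Rightarrow> L0 \<Rightarrow> L0" where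
  "op_pow A 0 = (\<lambda>k v. if k = 0 then v else 0)"
| "op_pow A (Suc n) = (\<lambda>k v. \<Sum>r = 1..k. A r (op_pow A n (k - r) v))"

definition op_exp :: "(nat \<Rightarrow> L0 \<Rightarrow> L0) \<Rightarrow> nat \<Rightarrow> L0 \<Rightarrow> L0" where
  "op_exp A k v = (\<Sum>n\<le>k. scale_L (1 / of_nat (fact n)) (op_pow A n k v))"


section \<open>Fields, i.e. elements of \<open>Hom(L\<^sub>0, L\<^sub>0((z)))\<close>\<close>

type_synonym fld = "L0 \<Rightarrow> L0 fls"

definition scale_fld :: "F \<Rightarrow> fld \<Rightarrow> fld" where
  "scale_fld c A = (\<lambda>v. fls_const (const_L c) * A v)"

text \<open>
  The product \<open>A(z) B(z)\<close>: with \<open>A(z) = \<Sum>\<^sub>i A\<^sub>i z\<^bsup>i\<^esup>\<close> and \<open>B(z) = \<Sum>\<^sub>j B\<^sub>j z\<^bsup>j\<^esup>\<close>, the coefficient of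
  \<open>z\<^bsup>n\<^esup>\<close> in \<open>A(z) B(z) v\<close> is \<open>\<Sum>\<^sub>j A\<^sub>n\<^sub>-\<^sub>j B\<^sub>j v\<close>. It is meaningful only if these sums are finite and
  vanish for \<open>n \<lless> 0\<close>. This holds wherever it is used below: the exponential of annihilation operators
  applied to a vector is a Laurent polynomial, and for the Frenkel--Jing operator the identity
  \<open>x(z)x(w) = (z - w)(z - q\<^bsup>-2\<^esup>w) :x(z)x(w):\<close> shows that products of \<open>m\<close> factors map \<open>L\<^sub>0\<close> to
  \<open>L\<^sub>0((z\<^sub>1,\<dots>,z\<^sub>m))\<close>.
\<close>

definition mult_fld :: "fld \<Rightarrow> fld \<Rightarrow> fld" where
  "mult_fld A B = (\<lambda>v. Abs_fls (\<lambda>n. Sum_any (\<lambda>j. fls_nth (A (fls_nth (B v) j)) (n - j))))"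

text \<open>\<open>dilate_fld c A\<close> is \<open>A(zc)\<close>.\<close>

definition dilate_fld :: "F \<Rightarrow> fld \<Rightarrow> fld" where
  "dilate_fld c A = (\<lambda>v. Abs_fls (\<lambda>n. scale_L (c powi n) (fls_nth (A v) n)))"

definition one_fld :: fld where
  "one_fld = (\<lambda>v. fls_const v)"

text \<open>Division by \<open>z\<close> is \<open>fls_shift 1\<close>.\<close>

definition q_deriv :: "fld \<Rightarrow> fld" where
  "q_deriv A =
     scale_fld (1 / (qq - 1)) (\<lambda>v. fls_shift 1 (dilate_fld qq A v - A v))"

definition exp_creation :: fld where
  "exp_creation v = Abs_fls (\<lambda>n. if n \<ge> 0
     then op_exp (\<lambda>r w. scale_L (inverse q_half ^ r / qnum r) (a_neg r w)) (nat n) v else 0)"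

definition exp_annihilation :: fld where
  "exp_annihilation v = Abs_fls (\<lambda>n. if n \<le> 0
     then op_exp (\<lambda>r w. scale_L (- (inverse q_half ^ r / qnum r)) (a_pos r w)) (nat (- n)) v else 0)"

text \<open>\<open>z\<^bsup>\<partial>\<^sub>\<alpha>\<^esup>\<close>, using \<open>(\<alpha>, j\<alpha>) = 2j\<close>; \<open>fls_shift (- k)\<close> is multiplication by \<open>z\<^bsup>k\<^esup>\<close>.\<close>

definition z_partial_alpha :: fld where
  "z_partial_alpha v =
     (\<Sum>j \<in> Poly_Mapping.keys v.
        fls_shift (- (2 * j)) (fls_const (Poly_Mapping.single j (Poly_Mapping.lookup v j))))"

definition frenkel_jing :: fld where
  "frenkel_jing =
     mult_fld exp_creation
      (mult_fld exp_annihilation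
       (mult_fld (\<lambda>v. fls_const (e_alpha v)) z_partial_alpha))"


section \<open>The space \<open>W\<^sub>0\<^sub>,\<^sub>q\<close>\<close>

text \<open>\<open>x_prod l b\<close> is \<open>x(z)\<^sub>l b(z)\<close>, meant for \<open>l \<le> -1\<close> only.\<close>

definition x_prod :: "int \<Rightarrow> fld \<Rightarrow> fld" where
  "x_prod l b =
     scale_fld (1 / qqfact (nat (- l - 1)))
      (mult_fld ((q_deriv ^^ nat (- l - 1)) frenkel_jing)
                (dilate_fld (qq powi (- l - 1)) b))"

text \<open>\<open>x_monomial l m\<close> is \<open>x(z)\<^bsub>l\<^sub>m\<^esub> \<dots> x(z)\<^bsub>l\<^sub>1\<^esub> 1\<close>; only \<open>l 1, \<dots>, l m\<close> matter.\<close>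

primrec x_monomial :: "(nat \<Rightarrow> int) \<Rightarrow> nat \<Rightarrow> fld" where
  "x_monomial l 0 = one_fld"
| "x_monomial l (Suc m) = x_prod (l (Suc m)) (x_monomial l m)"

global_interpretation fld: vector_space scale_fld
proof
  fix a b :: F and A B :: fld
  have L: "const_L (a + b) = const_L a + const_L b" "const_L a * const_L b = const_L (a * b)"
      "const_L 1 = 1"
    by (simp_all add: const_L_def const_K_def single_add mult_single)
  show "scale_fld a (A + B) = scale_fld a A + scale_fld a B"
    by (simp add: scale_fld_def fun_eq_iff algebra_simps)
  show "scale_fld (a + b) A = scale_fld a A + scale_fld b A"
    by (simp add: scale_fld_def fun_eq_iff L algebra_simps fls_plus_const[symmetric])
  show "scale_fld a (scale_fld b A) = scale_fld (a * b) A"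
    by (simp add: scale_fld_def fun_eq_iff L fls_const_mult_const flip: mult.assoc)
  show "scale_fld 1 A = A"
    by (simp add: scale_fld_def fun_eq_iff L)
qed

definition W0q :: "fld set" where
  "W0q = fld.span {x_monomial l m | l m. \<forall>j\<in>{1..m}. l j \<le> -1}"

definition B_W0q :: "fld set" where
  "B_W0q = {x_monomial l m | l m. (1 \<le> m \<longrightarrow> l 1 \<le> -1) \<and> (\<forall>r\<in>{2..m}. l r \<le> -3)}"

end

theory Submission
  imports Defs
begin

text \<open>
  Write \<open>p\<close> for \<open>qq\<close>. Since \<open>x(z)x(w) = (z - w)(z - w/p) :x(z)x(w):\<close>, every monomial
  \<open>x(z)\<^bsub>l\<^sub>m\<^esub>\<dots>x(z)\<^bsub>l\<^sub>1\<^esub>1\<close> is a combination of the fields \<open>z\<^bsup>k\<^esup> :x(p\<^bsup>i\<^sub>1\<^esup>z)\<dots>x(p\<^bsup>i\<^sub>m\<^esup>z):\<close>, and these are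
  linearly independent for distinct \<open>k\<close> and multisets \<open>{i\<^sub>1,\<dots>,i\<^sub>m}\<close>: applied to \<open>1\<close>, with all
  \<open>a(-r)\<close> for \<open>r \<ge> 2\<close> set to \<open>0\<close>, they give \<open>z\<^bsup>k\<^esup> exp(c P a(-1) z)\<close> with \<open>P = p\<^bsup>i\<^sub>1\<^esup> + \<dots> + p\<^bsup>i\<^sub>m\<^esup>\<close>,
  and a Vandermonde argument applies.

  Spanning: the \<open>q\<close>-Leibniz rule applied to \<open>x(z)x(z) = 0\<close> and \<open>x(z)x(pz) = 0\<close> expresses
  \<open>x(z)\<^sub>-\<^sub>1x(z)\<^sub>l\<close> and \<open>x(z)\<^sub>-\<^sub>2x(z)\<^sub>l\<close> through products whose left factor has a smaller index.

  Independence: with \<open>n\<^sub>j = -l\<^sub>j - 1\<close>, the term of an admissible monomial with the smallest exponents is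
  \<open>x(z)x(p\<^bsup>n\<^sub>m\<^esup>z)x(p\<^bsup>n\<^sub>m + n\<^sub>m\<^sub>-\<^sub>1\<^esup>z)\<dots>\<close>. It does not vanish because consecutive exponents differ by at
  least \<open>2\<close>, and together with the power of \<open>z\<close> it determines the monomial.
\<close>

text \<open>The obstacle is that a product of fields is a coefficientwise sum that may be infinite,
  so not even bilinearity can be taken for granted. It is controlled through ring morphisms: each
  factor of the Frenkel-Jing operator is a ring morphism from L0 to L0((z)) followed by
  multiplication with a creation series. A product of two such fields is a series in z and w
  restricted to w = z, and restriction is multiplicative on series whose exponents are bounded below
  in both variables.

  The q-derivatives become difference operators in the exponents: up to a scalar, the n-th one of
  x(z) is z^(-n) (S - 1)(S - p)...(S - p^(n-1)) x(z), where S replaces x(p^i z) by x(p^(i+1) z). The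
  scalar (p^i - p^j)(p^i - p^(j-1)) in front of :x(p^i z)x(p^j z): vanishes for j = i and j = i + 1.
  These two zeros are the origin of the bound l <= -3: the first removes order 0 from the left
  factor of a pair, the second removes order 1. For j - i >= 2 the scalar is nonzero, which keeps
  the leading terms alive.\<close>

unbundle fps_syntax

text \<open>Characteristic zero of F is what allows the coefficients 1/n! of the exponentials and
  the cancellation of n in differential equations for power series.\<close>

instance fract :: ("{idom, ring_char_0}") field_char_0
proof
  show "inj (of_nat :: nat \<Rightarrow> 'a fract)"
    by (auto simp: inj_on_def Fraction_Field.of_nat_fract eq_fract)
qed

locale ring_morphism =
  fixes \<phi> :: "'a::comm_ring_1 \<Rightarrow> 'b::comm_ring_1"
  assumes one [simp]: "\<phi> 1 = 1"
    and add: "\<phi> (x + y) = \<phi> x + \<phi> y"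
    and mult: "\<phi> (x * y) = \<phi> x * \<phi> y"
begin

lemma zero [simp]: "\<phi> 0 = 0"
  using add[of 0 0] by simp

lemma uminus: "\<phi> (- x) = - \<phi> x"
  using add[of x "- x"] by (simp add: eq_neg_iff_add_eq_0 add.commute)

lemma diff: "\<phi> (x - y) = \<phi> x - \<phi> y"
  using add[of x "- y"] by (simp add: uminus)

lemma sum: "\<phi> (\<Sum>i\<in>A. f i) = (\<Sum>i\<in>A. \<phi> (f i))"
  by (induction A rule: infinite_finite_induct) (auto simp: add)

lemma power: "\<phi> (x ^ n) = \<phi> x ^ n"
  by (induction n) (auto simp: mult)

lemma of_nat: "\<phi> (of_nat n) = of_nat n"
  by (induction n) (auto simp: add)

end

lemma ring_morphism_comp:
  assumes "ring_morphism \<phi>" "ring_morphism \<psi>"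
  shows "ring_morphism (\<lambda>x. \<phi> (\<psi> x))"
  using assms by (simp add: ring_morphism_def)

section \<open>Evaluation morphisms on \<open>L\<^sub>0\<close>\<close>

text \<open>The universal property of a monoid algebra: \<open>\<phi>\<close> acts on coefficients,
  \<open>\<chi>\<close> is a character of the exponents. It is used on two levels, for K(1) over F
  and for the group algebra of Q over K(1).\<close>

definition pm_eval :: "('b::zero \<Rightarrow> 'c::comm_ring_1) \<Rightarrow> ('a \<Rightarrow> 'c) \<Rightarrow> ('a \<Rightarrow>\<^sub>0 'b) \<Rightarrow> 'c" where
  "pm_eval \<phi> \<chi> p = (\<Sum>k\<in>Poly_Mapping.keys p. \<phi> (Poly_Mapping.lookup p k) * \<chi> k)"

lemma pm_eval_superset:
  assumes "finite S" "Poly_Mapping.keys p \<subseteq> S" "\<phi> 0 = 0"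
  shows "pm_eval \<phi> \<chi> p = (\<Sum>k\<in>S. \<phi> (Poly_Mapping.lookup p k) * \<chi> k)"
  unfolding pm_eval_def
  by (rule sum.mono_neutral_left) (use assms in \<open>auto simp: in_keys_iff\<close>)

lemma pm_eval_single:
  assumes "\<phi> 0 = 0"
  shows "pm_eval \<phi> \<chi> (Poly_Mapping.single k b) = \<phi> b * \<chi> k"
  by (subst pm_eval_superset[of "{k}"]) (use assms in auto)

lemma pm_eval_zero [simp]: "pm_eval \<phi> \<chi> 0 = 0"
  by (simp add: pm_eval_def)

lemma pm_eval_add:
  assumes "ring_morphism \<phi>"
  shows "pm_eval \<phi> \<chi> (p + r) = pm_eval \<phi> \<chi> p + pm_eval \<phi> \<chi> r"
proof -
  interpret ring_morphism \<phi> by fact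
  define S where "S = Poly_Mapping.keys p \<union> Poly_Mapping.keys r"
  have "finite S" "Poly_Mapping.keys (p + r) \<subseteq> S" "Poly_Mapping.keys p \<subseteq> S" "Poly_Mapping.keys r \<subseteq> S"
    using keys_add[of p r] by (auto simp: S_def)
  then show ?thesis
    by (simp add: pm_eval_superset[of S] lookup_add add distrib_right sum.distrib)
qed

lemma ring_morphism_pm_eval:
  fixes \<phi> :: "'b::comm_ring_1 \<Rightarrow> 'c::comm_ring_1" and \<chi> :: "'a::comm_monoid_add \<Rightarrow> 'c"
  assumes "ring_morphism \<phi>" "\<chi> 0 = 1" "\<And>a b. \<chi> (a + b) = \<chi> a * \<chi> b"
  shows "ring_morphism (pm_eval \<phi> \<chi>)"
proof
  interpret ring_morphism \<phi> by fact
  show "pm_eval \<phi> \<chi> 1 = 1"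
    using pm_eval_single[of \<phi> \<chi> 0 1] assms by simp
  show "pm_eval \<phi> \<chi> (x + y) = pm_eval \<phi> \<chi> x + pm_eval \<phi> \<chi> y" for x y
    by (rule pm_eval_add) fact
  show "pm_eval \<phi> \<chi> (x * y) = pm_eval \<phi> \<chi> x * pm_eval \<phi> \<chi> y" for x y
  proof (induction x rule: K1_induct)
    case (single m c)
    show ?case
    proof (induction y rule: K1_induct)
      case (single n d)
      show ?case by (simp add: mult_single pm_eval_single mult assms mult_ac)
    qed (simp_all add: pm_eval_add[OF assms(1)] distrib_left)
  qed (simp_all add: pm_eval_add[OF assms(1)] distrib_right)
qed

definition monom_eval :: "(nat \<Rightarrow> 'c::comm_ring_1) \<Rightarrow> (nat \<Rightarrow>\<^sub>0 nat) \<Rightarrow> 'c" where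
  "monom_eval y m = (\<Prod>i\<in>Poly_Mapping.keys m. y i ^ Poly_Mapping.lookup m i)"

lemma monom_eval_superset:
  assumes "finite S" "Poly_Mapping.keys m \<subseteq> S"
  shows "monom_eval y m = (\<Prod>i\<in>S. y i ^ Poly_Mapping.lookup m i)"
  unfolding monom_eval_def
  by (rule prod.mono_neutral_left) (use assms in \<open>auto simp: in_keys_iff\<close>)

lemma monom_eval_add: "monom_eval y (m + n) = monom_eval y m * monom_eval y n"
proof -
  define S where "S = Poly_Mapping.keys m \<union> Poly_Mapping.keys n"
  have "finite S" "Poly_Mapping.keys (m + n) \<subseteq> S" "Poly_Mapping.keys m \<subseteq> S" "Poly_Mapping.keys n \<subseteq> S"
    using keys_add[of m n] by (auto simp: S_def)
  then show ?thesis
    by (simp add: monom_eval_superset[of S] lookup_add power_add prod.distrib)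
qed

lemma monom_eval_0 [simp]: "monom_eval y 0 = 1"
  by (simp add: monom_eval_def)

lemma monom_eval_single [simp]: "monom_eval y (Poly_Mapping.single i n) = y i ^ n"
  by (subst monom_eval_superset[of "{i}"]) auto

definition var_L :: "nat \<Rightarrow> L0" where
  "var_L i = Poly_Mapping.single 0 (var_K i)"

definition e_L :: "int \<Rightarrow> L0" where
  "e_L j = Poly_Mapping.single j 1"

definition L0_eval :: "(F \<Rightarrow> 'c::comm_ring_1) \<Rightarrow> (nat \<Rightarrow> 'c) \<Rightarrow> (int \<Rightarrow> 'c) \<Rightarrow> L0 \<Rightarrow> 'c" where
  "L0_eval \<iota> y g = pm_eval (pm_eval \<iota> (monom_eval y)) g"

lemma e_L_0: "e_L 0 = 1"
  by (simp add: e_L_def)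

lemma e_L_add: "e_L (i + j) = e_L i * e_L j"
  by (simp add: e_L_def mult_single)

lemma ring_morphism_const_L: "ring_morphism const_L"
  by unfold_locales (simp_all add: const_L_def const_K_def single_add mult_single)

interpretation const_L: ring_morphism const_L
  by (rule ring_morphism_const_L)

lemma ring_morphism_fls_const: "ring_morphism (fls_const :: 'a::comm_ring_1 \<Rightarrow> _)"
  by unfold_locales (simp_all add: fls_plus_const)

context
  fixes \<iota> :: "F \<Rightarrow> 'c::comm_ring_1" and y :: "nat \<Rightarrow> 'c" and g :: "int \<Rightarrow> 'c"
  assumes \<iota>: "ring_morphism \<iota>" and g0: "g 0 = 1" and g_add: "\<And>a b. g (a + b) = g a * g b"
begin

lemma ring_morphism_L0_eval: "ring_morphism (L0_eval \<iota> y g)"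
  unfolding L0_eval_def
  by (intro ring_morphism_pm_eval \<iota> g0 g_add monom_eval_add monom_eval_0)

private lemma K: "ring_morphism (pm_eval \<iota> (monom_eval y))"
  by (intro ring_morphism_pm_eval \<iota> monom_eval_add monom_eval_0)

lemma L0_eval_const: "L0_eval \<iota> y g (const_L c) = \<iota> c"
  using ring_morphism.zero[OF K] ring_morphism.zero[OF \<iota>]
  by (simp add: L0_eval_def const_L_def const_K_def pm_eval_single g0)

lemma L0_eval_var: "L0_eval \<iota> y g (var_L i) = y i"
  using ring_morphism.zero[OF K] ring_morphism.zero[OF \<iota>] ring_morphism.one[OF \<iota>]
  by (simp add: L0_eval_def var_L_def var_K_def pm_eval_single g0)

lemma L0_eval_e: "L0_eval \<iota> y g (e_L j) = g j"
  using ring_morphism.zero[OF K] ring_morphism.one[OF K]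
  by (simp add: L0_eval_def e_L_def pm_eval_single)

end

text \<open>L0 is generated as a ring by constants, the a(-r) and the e^\<beta>. Identities between
  ring morphisms on L0 are therefore checked on these three kinds of elements only.\<close>

lemma L0_induct [case_names const var e add mult]:
  assumes const: "\<And>c. P (const_L c)" and var: "\<And>i. P (var_L i)" and e: "\<And>j. P (e_L j)"
    and add: "\<And>u v. P u \<Longrightarrow> P v \<Longrightarrow> P (u + v)" and mult: "\<And>u v. P u \<Longrightarrow> P v \<Longrightarrow> P (u * v)"
  shows "P v"
proof -
  have P0: "P 0" "P 1"
    using const[of 0] const[of 1] by (simp_all add: const_L.zero)
  have pow: "P (Poly_Mapping.single 0 (Poly_Mapping.single (Poly_Mapping.single i n) 1))" for i n
  proof (induction n)
    case 0
    then show ?case using P0 by simp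
  next
    case (Suc n)
    have "P (var_L i * Poly_Mapping.single 0 (Poly_Mapping.single (Poly_Mapping.single i n) 1))"
      by (intro mult var Suc)
    also have "var_L i * Poly_Mapping.single 0 (Poly_Mapping.single (Poly_Mapping.single i n) 1)
       = Poly_Mapping.single 0 (Poly_Mapping.single (Poly_Mapping.single i (Suc n)) 1)"
      by (simp add: var_L_def var_K_def mult_single flip: single_add)
    finally show ?case .
  qed
  have mon: "P (Poly_Mapping.single 0 (Poly_Mapping.single m 1))" for m
  proof (induction m rule: K1_induct)
    case zero
    then show ?case using P0 by simp
  next
    case (single i n)
    then show ?case by (rule pow)
  next
    case (add m n)
    then show ?case using mult[OF add] by (simp add: mult_single)
  qed
  have K: "P (Poly_Mapping.single 0 u)" for u
  proof (induction u rule: K1_induct)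
    case (single m c)
    show ?case
      using mult[OF const[of c] mon[of m]] by (simp add: const_L_def const_K_def mult_single)
  next
    case (add p r)
    then show ?case using assms(4)[OF add] by (simp add: single_add)
  qed (use P0 in simp)
  show ?thesis
  proof (induction v rule: K1_induct)
    case (single j u)
    show ?case
      using mult[OF e[of j] K[of u]] by (simp add: e_L_def mult_single)
  qed (use P0 add in simp_all)
qed

section \<open>Laurent series in two variables and their diagonal\<close>

definition fls_map :: "('a::zero \<Rightarrow> 'b::zero) \<Rightarrow> 'a fls \<Rightarrow> 'b fls" where
  "fls_map \<phi> f = Abs_fls (\<lambda>n. \<phi> (f $$ n))"

lemma fls_map_nth [simp]:
  assumes "\<phi> 0 = 0"
  shows "fls_map \<phi> f $$ n = \<phi> (f $$ n)"
proof -
  obtain N where "\<forall>n<N. f $$ n = 0" by (rule fls_nth_vanishes_belowE)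
  then show ?thesis
    unfolding fls_map_def by (intro nth_Abs_fls_lower_bound[of N]) (use assms in auto)
qed

lemma fls_times_nth_bounded:
  fixes f g :: "'a::comm_ring_1 fls"
  assumes "\<And>i. i < M \<Longrightarrow> f $$ i = 0" "\<And>i. i < N \<Longrightarrow> g $$ i = 0"
  shows "(f * g) $$ n = (\<Sum>i = M..n - N. f $$ i * g $$ (n - i))"
proof (cases "f = 0 \<or> g = 0")
  case False
  then have "M \<le> fls_subdegree f" "N \<le> fls_subdegree g"
    using assms by (metis not_le nth_fls_subdegree_nonzero)+
  then show ?thesis
    unfolding fls_times_nth(2)
    by (intro sum.mono_neutral_left) (auto simp: not_le)
qed auto

lemma ring_morphism_fls_map:
  assumes "ring_morphism \<phi>"
  shows "ring_morphism (fls_map \<phi>)"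
proof
  interpret ring_morphism \<phi> by fact
  show "fls_map \<phi> 1 = 1"
    by (rule fls_eqI) simp
  show "fls_map \<phi> (x + y) = fls_map \<phi> x + fls_map \<phi> y" for x y
    by (rule fls_eqI) (simp add: add)
  show "fls_map \<phi> (f * g) = fls_map \<phi> f * fls_map \<phi> g" for f g
  proof (rule fls_eqI)
    fix n
    obtain M where M: "\<forall>n<M. f $$ n = 0" by (rule fls_nth_vanishes_belowE)
    obtain N where N: "\<forall>n<N. g $$ n = 0" by (rule fls_nth_vanishes_belowE)
    show "fls_map \<phi> (f * g) $$ n = (fls_map \<phi> f * fls_map \<phi> g) $$ n"
      using M N
      by (simp add: fls_times_nth_bounded[of M f N g]
          fls_times_nth_bounded[of M "fls_map \<phi> f" N "fls_map \<phi> g"] sum mult)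
  qed
qed

text \<open>In an iterated Laurent series the inner exponents may tend to minus infinity as the
  outer one grows. A common lower bound makes every antidiagonal finite, so that the two variables
  can be set equal.\<close>

definition bounded2 :: "int \<Rightarrow> 'a::zero fls fls \<Rightarrow> bool" where
  "bounded2 N g \<longleftrightarrow> (\<forall>j i. j < N \<or> i < N \<longrightarrow> g $$ j $$ i = 0)"

definition good :: "'a::zero fls fls \<Rightarrow> bool" where
  "good g \<longleftrightarrow> (\<exists>N. bounded2 N g)"

definition diag :: "'a::comm_monoid_add fls fls \<Rightarrow> 'a fls" where
  "diag g = Abs_fls (\<lambda>n. Sum_any (\<lambda>j. g $$ j $$ (n - j)))"

lemma bounded2_mono: "bounded2 N g \<Longrightarrow> M \<le> N \<Longrightarrow> bounded2 M g"
  by (auto simp: bounded2_def)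

lemma diag_nth:
  assumes "bounded2 N g"
  shows "diag g $$ n = (\<Sum>j = N..n - N. g $$ j $$ (n - j))"
proof -
  have *: "Sum_any (\<lambda>j. g $$ j $$ (n - j)) = (\<Sum>j = N..n - N. g $$ j $$ (n - j))" for n
    using assms by (intro Sum_any.expand_superset) (auto simp: bounded2_def not_less[symmetric])
  show ?thesis
    unfolding diag_def * by (rule nth_Abs_fls_lower_bound[of "2 * N"]) auto
qed

lemma goodE2:
  assumes "good g" "good h"
  obtains N where "bounded2 N g" "bounded2 N h"
proof -
  from assms obtain M K where "bounded2 M g" "bounded2 K h"
    by (auto simp: good_def)
  then show ?thesis
    using that[of "min M K"] bounded2_mono[of M g "min M K"] bounded2_mono[of K h "min M K"] by simp
qed

lemma good_add:
  fixes g h :: "'a::comm_ring_1 fls fls"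
  assumes "good g" "good h"
  shows "good (g + h)" and diag_add: "diag (g + h) = diag g + diag h"
proof -
  obtain N where N: "bounded2 N g" "bounded2 N h"
    using goodE2[OF assms] .
  then have S: "bounded2 N (g + h)"
    by (simp add: bounded2_def)
  then show "good (g + h)"
    by (auto simp: good_def)
  show "diag (g + h) = diag g + diag h"
    by (rule fls_eqI) (simp add: diag_nth[OF S] diag_nth[OF N(1)] diag_nth[OF N(2)] sum.distrib)
qed

lemma fls_sum_nth: "(\<Sum>i\<in>A. f i :: 'a::comm_monoid_add fls) $$ n = (\<Sum>i\<in>A. f i $$ n)"
  by (induction A rule: infinite_finite_induct) auto

lemma good_mult:
  fixes g h :: "'a::comm_ring_1 fls fls"
  assumes "good g" "good h"
  shows "good (g * h)" and diag_mult: "diag (g * h) = diag g * diag h"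
proof -
  obtain N where N: "bounded2 N g" "bounded2 N h"
    using goodE2[OF assms] .
  have coeff: "(g * h) $$ j $$ i = (\<Sum>a = N..j - N. \<Sum>c = N..i - N. g $$ a $$ c * h $$ (j - a) $$ (i - c))" for i j
  proof -
    have "(g * h) $$ j = (\<Sum>a = N..j - N. g $$ a * h $$ (j - a))"
      using N by (intro fls_times_nth_bounded) (auto simp: bounded2_def fls_eq_iff)
    also have "\<dots> $$ i = (\<Sum>a = N..j - N. (g $$ a * h $$ (j - a)) $$ i)"
      by (simp add: fls_sum_nth)
    also have "\<dots> = (\<Sum>a = N..j - N. \<Sum>c = N..i - N. g $$ a $$ c * h $$ (j - a) $$ (i - c))"
      using N by (intro sum.cong refl fls_times_nth_bounded) (auto simp: bounded2_def)
    finally show ?thesis .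
  qed
  have B: "bounded2 (N + N) (g * h)"
    by (auto simp: bounded2_def coeff)
  then show "good (g * h)"
    by (auto simp: good_def)
  show "diag (g * h) = diag g * diag h"
  proof (rule fls_eqI)
    fix n
    have "diag (g * h) $$ n = (\<Sum>j = N+N..n - (N+N). \<Sum>a = N..j - N. \<Sum>c = N..n - j - N.
        g $$ a $$ c * h $$ (j - a) $$ (n - j - c))"
      by (simp add: diag_nth[OF B] coeff)
    also have "\<dots> = (\<Sum>(j,a,c)\<in>(SIGMA j:{N+N..n - (N+N)}. {N..j - N} \<times> {N..n - j - N}).
        g $$ a $$ c * h $$ (j - a) $$ (n - j - c))"
      by (simp add: sum.Sigma sum.cartesian_product)
    \<comment> \<open>\<open>s = a + c\<close> is the total degree of the term of \<open>g\<close>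
      and \<open>b = j - a\<close> the outer exponent of the term of \<open>h\<close>; in these
      indices the sum separates into the two diagonals.\<close>
    also have "\<dots> = (\<Sum>(s,a,b)\<in>(SIGMA s:{N+N..n - (N+N)}. {N..s - N} \<times> {N..n - s - N}).
        g $$ a $$ (s - a) * h $$ b $$ (n - s - b))"
      by (rule sum.reindex_bij_witness[of _ "\<lambda>(s,a,b). (a + b, a, s - a)" "\<lambda>(j,a,c). (a + c, a, j - a)"])
         (auto simp: algebra_simps)
    also have "\<dots> = (\<Sum>s = N+N..n - (N+N). (\<Sum>a = N..s - N. g $$ a $$ (s - a)) *
        (\<Sum>b = N..n - s - N. h $$ b $$ (n - s - b)))"
      by (simp add: sum.Sigma sum.cartesian_product sum_product)
    also have "\<dots> = (\<Sum>s = N+N..n - (N+N). diag g $$ s * diag h $$ (n - s))"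
      by (simp add: diag_nth[OF N(1)] diag_nth[OF N(2)])
    also have "\<dots> = (diag g * diag h) $$ n"
      by (rule fls_times_nth_bounded[symmetric]) (auto simp: diag_nth[OF N(1)] diag_nth[OF N(2)])
    finally show "diag (g * h) $$ n = (diag g * diag h) $$ n" .
  qed
qed

lemma good_fls_const: "good (fls_const f)"
  and diag_fls_const: "diag (fls_const f) = f"
proof -
  obtain N where N: "\<forall>n<N. f $$ n = 0" by (rule fls_nth_vanishes_belowE)
  have B: "bounded2 (min N 0) (fls_const f)"
    using N by (auto simp: bounded2_def)
  then show "good (fls_const f)"
    by (auto simp: good_def)
  show "diag (fls_const f) = f"
  proof (rule fls_eqI)
    fix n
    have "diag (fls_const f) $$ n = (\<Sum>j = min N 0..n - min N 0. if j = 0 then f $$ n else 0)"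
      unfolding diag_nth[OF B] by (intro sum.cong) auto
    also have "\<dots> = f $$ n"
      using N by (simp add: min_def)
    finally show "diag (fls_const f) $$ n = f $$ n" .
  qed
qed

lemma good_fls_map_const: "good (fls_map fls_const f)"
  and diag_fls_map_const: "diag (fls_map fls_const f) = f"
proof -
  obtain N where N: "\<forall>n<N. f $$ n = 0" by (rule fls_nth_vanishes_belowE)
  have B: "bounded2 (min N 0) (fls_map fls_const f)"
    using N by (auto simp: bounded2_def)
  then show "good (fls_map fls_const f)"
    by (auto simp: good_def)
  show "diag (fls_map fls_const f) = f"
  proof (rule fls_eqI)
    fix n
    have "diag (fls_map fls_const f) $$ n = (\<Sum>j = min N 0..n - min N 0. if j = n then f $$ n else 0)"
      unfolding diag_nth[OF B] by (intro sum.cong) auto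
    also have "\<dots> = f $$ n"
      using N by (simp add: min_def)
    finally show "diag (fls_map fls_const f) $$ n = f $$ n" .
  qed
qed

lemma fls_map_fls_const [simp]: "\<phi> 0 = 0 \<Longrightarrow> fls_map \<phi> (fls_const c) = fls_const (\<phi> c)"
  by (rule fls_eqI) simp

definition zpow :: "int \<Rightarrow> 'a::comm_ring_1 fls" where
  "zpow k = fls_shift (- k) 1"

lemma zpow_nth: "zpow k $$ n = (if n = k then 1 else 0)"
  by (simp add: zpow_def)

lemma zpow_0 [simp]: "zpow 0 = 1"
  by (simp add: zpow_def)

lemma zpow_add: "zpow (k + l) = zpow k * zpow l"
  by (simp only: zpow_def fls_X_intpow_times_fls_X_intpow)

lemma zpow_mult: "zpow k * f = fls_shift (- k) f"
  by (simp only: zpow_def fls_X_intpow_times_conv_shift)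

lemma zpow_power: "zpow k ^ n = zpow (int n * k)"
  by (induction n) (simp_all add: algebra_simps flip: zpow_add)

lemma fls_map_zpow [simp]:
  assumes "ring_morphism \<phi>"
  shows "fls_map \<phi> (zpow k) = zpow k"
proof -
  interpret ring_morphism \<phi> by fact
  show ?thesis by (rule fls_eqI) (simp add: zpow_nth)
qed

lemma good_zpow: "good (zpow k :: 'a::comm_ring_1 fls fls)"
  and diag_zpow: "diag (zpow k :: 'a::comm_ring_1 fls fls) = zpow k"
  using good_fls_map_const[of "zpow k :: 'a fls"] diag_fls_map_const[of "zpow k :: 'a fls"]
  by (simp_all add: ring_morphism_fls_const)

section \<open>Translation morphisms from L0 to L0((z)) and fields in normal order\<close>

definition cst :: "F \<Rightarrow> L0 fls" where
  "cst c = fls_const (const_L c)"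

lemma ring_morphism_cst: "ring_morphism cst"
  unfolding cst_def by (rule ring_morphism_comp[OF ring_morphism_fls_const ring_morphism_const_L])

interpretation cst: ring_morphism cst
  by (rule ring_morphism_cst)

text \<open>
  The exponential of annihilation operators is the translation
  \<open>a(-s-1) \<mapsto> a(-s-1) + b\<^sub>s z\<^bsup>-s-1\<^esup>\<close>; like \<open>z\<^bsup>\<partial>\<^sub>\<alpha>\<^esup>\<close> and its dilations it is a ring morphism.
\<close>

definition vhom :: "(nat \<Rightarrow> F) \<Rightarrow> int \<Rightarrow> F \<Rightarrow> L0 \<Rightarrow> L0 fls" where
  "vhom b m c = L0_eval cst (\<lambda>s. fls_const (var_L s) + cst (b s) * zpow (- int (Suc s)))
     (\<lambda>j. cst (c powi j) * zpow (2 * m * j) * fls_const (e_L j))"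

context
  fixes c :: F
  assumes c: "c \<noteq> 0"
begin

private lemma g: "cst (c powi 0) * zpow (2 * m * 0) * fls_const (e_L 0) = 1"
   "cst (c powi (i + j)) * zpow (2 * m * (i + j)) * fls_const (e_L (i + j)) =
    (cst (c powi i) * zpow (2 * m * i) * fls_const (e_L i)) *
    (cst (c powi j) * zpow (2 * m * j) * fls_const (e_L j))"
  using c by (simp_all add: e_L_0 power_int_add cst.mult zpow_add distrib_left e_L_add mult_ac
      flip: fls_const_mult_const)

lemma ring_morphism_vhom: "ring_morphism (vhom b m c)"
  unfolding vhom_def by (intro ring_morphism_L0_eval ring_morphism_cst g)

lemma vhom_const: "vhom b m c (const_L d) = cst d"
  unfolding vhom_def by (intro L0_eval_const ring_morphism_cst g)

lemma vhom_var: "vhom b m c (var_L s) = fls_const (var_L s) + cst (b s) * zpow (- int (Suc s))"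
  unfolding vhom_def by (intro L0_eval_var ring_morphism_cst g)

lemma vhom_e: "vhom b m c (e_L j) = cst (c powi j) * zpow (2 * m * j) * fls_const (e_L j)"
  unfolding vhom_def by (intro L0_eval_e ring_morphism_cst g)

lemma vhom_0 [simp]: "vhom b m c 0 = 0"
  by (rule ring_morphism.zero[OF ring_morphism_vhom])

lemma vhom_1 [simp]: "vhom b m c 1 = 1"
  by (rule ring_morphism.one[OF ring_morphism_vhom])

end

lemma vhom_trivial: "vhom (\<lambda>_. 0) 0 1 v = fls_const v"
proof (induction v rule: L0_induct)
  case (add u v)
  then show ?case
    by (simp add: ring_morphism.add[OF ring_morphism_vhom] fls_plus_const)
next
  case (mult u v)
  then show ?case
    by (simp add: ring_morphism.mult[OF ring_morphism_vhom])
qed (simp_all add: vhom_const vhom_var vhom_e, simp_all add: cst_def)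

text \<open>Both sides are additive and multiplicative in \<open>v\<close>, because
  \<open>diag\<close> is so on good series, and on generators the shifts add while the characters of
  Q multiply. This makes the fields \<open>vo\<close> closed under products.\<close>

lemma vhom_vhom:
  assumes c: "c \<noteq> 0" "c' \<noteq> 0"
  shows good_vhom_vhom: "good (fls_map (vhom b m c) (vhom b' m' c' v))"
    and diag_vhom_vhom: "diag (fls_map (vhom b m c) (vhom b' m' c' v)) =
          vhom (\<lambda>s. b s + b' s) (m + m') (c * c') v"
proof -
  interpret A: ring_morphism "vhom b m c" by (rule ring_morphism_vhom) fact
  interpret B: ring_morphism "vhom b' m' c'" by (rule ring_morphism_vhom) fact
  interpret M: ring_morphism "fls_map (vhom b m c)"
    by (rule ring_morphism_fls_map) (rule A.ring_morphism_axioms)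
  have cc: "c * c' \<noteq> 0" using c by simp
  interpret AB: ring_morphism "vhom (\<lambda>s. b s + b' s) (m + m') (c * c')"
    by (rule ring_morphism_vhom) fact
  have z: "fls_map (vhom b m c) (zpow k) = zpow k" for k
    by (rule fls_map_zpow) (rule A.ring_morphism_axioms)
  have "good (fls_map (vhom b m c) (vhom b' m' c' v)) \<and>
     diag (fls_map (vhom b m c) (vhom b' m' c' v)) = vhom (\<lambda>s. b s + b' s) (m + m') (c * c') v"
  proof (induction v rule: L0_induct)
    case (const d)
    have "fls_map (vhom b m c) (vhom b' m' c' (const_L d)) = fls_const (cst d)"
      using c by (simp add: vhom_const cst_def[of d])
    then show ?case
      using cc by (simp add: good_fls_const diag_fls_const vhom_const)
  next
    case (var s)
    have "fls_map (vhom b m c) (vhom b' m' c' (var_L s)) =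
      fls_const (vhom b m c (var_L s)) + fls_const (cst (b' s)) * zpow (- int (Suc s))"
      using c by (simp add: vhom_var M.add M.mult z)
       (simp add: cst_def vhom_const)
    then show ?case
      using c cc
      by (simp add: good_fls_const good_add good_mult good_zpow diag_add diag_mult diag_fls_const
          diag_zpow vhom_var cst.add distrib_right)
  next
    case (e j)
    have "fls_map (vhom b m c) (vhom b' m' c' (e_L j)) =
      fls_const (cst (c' powi j)) * zpow (2 * m' * j) * fls_const (vhom b m c (e_L j))"
      using c by (simp add: vhom_e[OF c(2)] M.mult z)
       (simp add: cst_def vhom_const)
    then show ?case
      using c cc
      by (simp add: good_fls_const good_mult good_zpow diag_mult diag_fls_const
          diag_zpow vhom_e cst.mult power_int_mult_distrib zpow_add distrib_right distrib_left mult_ac)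
  next
    case (add u v)
    then show ?case
      by (simp add: B.add M.add AB.add good_add diag_add)
  next
    case (mult u v)
    then show ?case
      by (simp add: B.mult M.mult AB.mult good_mult diag_mult)
  qed
  then show "good (fls_map (vhom b m c) (vhom b' m' c' v))"
    "diag (fls_map (vhom b m c) (vhom b' m' c' v)) = vhom (\<lambda>s. b s + b' s) (m + m') (c * c') v"
    by blast+
qed

text \<open>The normally ordered shape: a translation followed by multiplication with a creation
  part \<open>S\<close>. All four factors of the Frenkel-Jing operator have it.\<close>

definition vo :: "L0 fls \<Rightarrow> (nat \<Rightarrow> F) \<Rightarrow> int \<Rightarrow> F \<Rightarrow> fld" where
  "vo S b m c v = S * vhom b m c v"

lemma mult_fld_eq_diag: "A 0 = 0 \<Longrightarrow> mult_fld A B v = diag (fls_map A (B v))"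
  by (simp add: mult_fld_def diag_def)

lemma fls_map_vo:
  assumes "c \<noteq> 0"
  shows "fls_map (vo S b m c) f = fls_const S * fls_map (vhom b m c) f"
  by (rule fls_eqI) (use assms in \<open>simp add: vo_def\<close>)

text \<open>Reordering is needed only where the translation of the left factor meets the creation
  part \<open>T\<close> of the right one. The restriction of the translated \<open>T\<close> to the
  diagonal contains the contraction, and its goodness is the only convergence condition.\<close>

lemma mult_vo:
  assumes c: "c \<noteq> 0" "c' \<noteq> 0" and T: "good (fls_map (vhom b m c) T)"
  shows good_mult_vo: "good (fls_map (vo S b m c) (vo T b' m' c' v))"
    and "mult_fld (vo S b m c) (vo T b' m' c') =
      vo (S * diag (fls_map (vhom b m c) T)) (\<lambda>s. b s + b' s) (m + m') (c * c')"
proof -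
  interpret M: ring_morphism "fls_map (vhom b m c)"
    by (intro ring_morphism_fls_map ring_morphism_vhom c)
  have eq: "fls_map (vo S b m c) (vo T b' m' c' v) =
      fls_const S * (fls_map (vhom b m c) T * fls_map (vhom b m c) (vhom b' m' c' v))" for v
    using c by (simp add: fls_map_vo vo_def[of T] M.mult)
  note gd = good_vhom_vhom[OF c] diag_vhom_vhom[OF c]
  show "good (fls_map (vo S b m c) (vo T b' m' c' v))" for v
    unfolding eq by (intro good_mult good_fls_const T gd)
  show "mult_fld (vo S b m c) (vo T b' m' c') =
      vo (S * diag (fls_map (vhom b m c) T)) (\<lambda>s. b s + b' s) (m + m') (c * c')"
    using c T
    by (intro ext, subst mult_fld_eq_diag)
       (simp_all add: vo_def[of S b] vo_def[of _ "\<lambda>s. b s + b' s"] eq diag_mult good_mult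
          good_fls_const gd diag_fls_const mult_ac)
qed

section \<open>The exponential of the creation operators\<close>

definition cre_coeff :: "nat \<Rightarrow> F" where
  "cre_coeff r = inverse q_half ^ r / qnum r"

definition cre_log :: "F \<Rightarrow> L0 fps" where
  "cre_log x = Abs_fps (\<lambda>r. if r = 0 then 0 else const_L (cre_coeff r * x ^ r) * var_L (r - 1))"

text \<open>The creation exponential at xz, encoded by scaling the coefficient of z^k by x^k. The
  sum may stop at \<open>k\<close> since \<open>cre_log 1\<close> has no constant term.\<close>

definition cre_exp :: "F \<Rightarrow> L0 fps" where
  "cre_exp x = Abs_fps (\<lambda>k. const_L (x ^ k) *
     (\<Sum>n\<le>k. const_L (1 / fact n) * (cre_log 1 ^ n) $ k))"

lemma a_neg_eq: "a_neg r w = var_L (r - 1) * w"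
proof -
  have "a_neg r w = Poly_Mapping.map ((*) (var_K (r - 1))) w"
    by (simp add: a_neg_def a_neg_K_def[abs_def])
  then show ?thesis
    by (simp add: mult_map_scale_conv_mult var_L_def)
qed

lemma fps_power_nth_eq_0:
  fixes f :: "'a::comm_ring_1 fps"
  assumes "f $ 0 = 0" "k < n"
  shows "(f ^ n) $ k = 0"
  using startsby_zero_power_prefix[OF assms(1)] assms(2) by blast

lemma op_pow_mult:
  assumes "f $ 0 = 0"
  shows "op_pow (\<lambda>r w. f $ r * w) n k v = (f ^ n) $ k * v"
proof (induction n arbitrary: k)
  case (Suc n)
  have "op_pow (\<lambda>r w. f $ r * w) (Suc n) k v = (\<Sum>r = 1..k. f $ r * (f ^ n) $ (k - r)) * v"
    by (simp add: Suc sum_distrib_right mult.assoc)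
  also have "(\<Sum>r = 1..k. f $ r * (f ^ n) $ (k - r)) = (\<Sum>r = 0..k. f $ r * (f ^ n) $ (k - r))"
    using assms by (simp add: sum.atLeast_Suc_atMost[of 0])
  finally show ?case
    by (simp add: fps_mult_nth)
qed simp

lemma op_exp_creation:
  "op_exp (\<lambda>r w. scale_L (inverse q_half ^ r / qnum r) (a_neg r w)) k v = cre_exp 1 $ k * v"
proof -
  let ?A = "\<lambda>r w. scale_L (inverse q_half ^ r / qnum r) (a_neg r w)"
  have *: "op_pow ?A n k v = op_pow (\<lambda>r w. cre_log 1 $ r * w) n k v" for n k
    by (induction n arbitrary: k)
       (auto intro!: sum.cong simp: cre_log_def scale_L_def a_neg_eq cre_coeff_def mult.assoc)
  have [simp]: "cre_log 1 $ 0 = 0" by (simp add: cre_log_def)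
  show ?thesis
    unfolding op_exp_def * by (simp add: op_pow_mult cre_exp_def scale_L_def sum_distrib_right mult.assoc)
qed

lemma cre_exp_0: "cre_exp x $ 0 = 1"
  by (simp add: cre_exp_def)

text \<open>Both later computations with this exponential, the contraction and the evaluation that
  keeps only a(-1), rest on this equation and the constant term 1; products then reduce to sums of
  logarithmic derivatives.\<close>

lemma cre_exp_deriv: "fps_deriv (cre_exp x) = fps_deriv (cre_log x) * cre_exp x"
proof -
  let ?f = "cre_log 1"
  let ?S = "\<lambda>k. \<Sum>n\<le>k. const_L (1 / fact n) * (?f ^ n) $ k"
  have f0: "?f $ 0 = 0" by (simp add: cre_log_def)
  have *: "of_nat (Suc k) * ?S (Suc k) = (\<Sum>i = 0..k. fps_deriv ?f $ i * ?S (k - i))" for k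
  proof -
    have "of_nat (Suc k) * ?S (Suc k) = (\<Sum>n\<le>Suc k. const_L (1 / fact n) * fps_deriv (?f ^ n) $ k)"
      by (simp add: sum_distrib_left mult_ac del: sum.atMost_Suc of_nat_Suc)
    also have "\<dots> = (\<Sum>n\<le>k. const_L (1 / fact (Suc n)) * fps_deriv (?f ^ Suc n) $ k)"
      by (subst sum.atMost_Suc_shift) simp
    also have "\<dots> = (\<Sum>n\<le>k. const_L (1 / fact n) * (fps_deriv ?f * ?f ^ n) $ k)"
    proof (intro sum.cong refl)
      fix n
      have "fps_deriv (?f ^ Suc n) = of_nat (Suc n) * (fps_deriv ?f * ?f ^ n)"
        by (subst fps_deriv_power) (simp add: mult_ac flip: fps_of_nat)
      then have "fps_deriv (?f ^ Suc n) $ k = const_L (of_nat (Suc n)) * (fps_deriv ?f * ?f ^ n) $ k"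
        by (simp add: const_L.of_nat flip: fps_of_nat del: of_nat_Suc)
      then have "const_L (1 / fact (Suc n)) * fps_deriv (?f ^ Suc n) $ k =
          const_L (1 / fact (Suc n) * of_nat (Suc n)) * (fps_deriv ?f * ?f ^ n) $ k"
        by (simp only: const_L.mult mult.assoc)
      also have "1 / fact (Suc n) * of_nat (Suc n) = (1 / fact n :: F)"
        by (simp add: field_simps del: of_nat_Suc)
      finally show "const_L (1 / fact (Suc n)) * fps_deriv (?f ^ Suc n) $ k =
          const_L (1 / fact n) * (fps_deriv ?f * ?f ^ n) $ k" .
    qed
    also have "\<dots> = (\<Sum>n\<le>k. \<Sum>i = 0..k. fps_deriv ?f $ i * (const_L (1 / fact n) * (?f ^ n) $ (k - i)))"
      by (simp only: fps_mult_nth sum_distrib_left mult_ac)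
    also have "\<dots> = (\<Sum>i = 0..k. \<Sum>n\<le>k. fps_deriv ?f $ i * (const_L (1 / fact n) * (?f ^ n) $ (k - i)))"
      by (rule sum.swap)
    also have "\<dots> = (\<Sum>i = 0..k. fps_deriv ?f $ i * ?S (k - i))"
      unfolding sum_distrib_left
      by (intro sum.cong[OF refl] sum.mono_neutral_right) (auto simp: fps_power_nth_eq_0[OF f0])
    finally show ?thesis .
  qed
  show ?thesis
  proof (rule fps_ext)
    fix k
    have "fps_deriv (cre_exp x) $ k = const_L (x ^ Suc k) * (of_nat (Suc k) * ?S (Suc k))"
      by (simp add: cre_exp_def mult_ac del: sum.atMost_Suc of_nat_Suc power_Suc)
    also have "\<dots> = (\<Sum>i = 0..k. const_L (x ^ Suc k) * (fps_deriv ?f $ i * ?S (k - i)))"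
      unfolding * by (rule sum_distrib_left)
    also have "\<dots> = (\<Sum>i = 0..k. fps_deriv (cre_log x) $ i * cre_exp x $ (k - i))"
    proof (intro sum.cong refl)
      fix i assume "i \<in> {0..k}"
      then have "x ^ Suc k = x ^ Suc i * x ^ (k - i)"
        by (simp flip: power_add)
      then show "const_L (x ^ Suc k) * (fps_deriv ?f $ i * ?S (k - i)) =
          fps_deriv (cre_log x) $ i * cre_exp x $ (k - i)"
        by (simp add: cre_exp_def cre_log_def const_L.mult mult_ac del: of_nat_Suc power_Suc)
    qed
    also have "\<dots> = (fps_deriv (cre_log x) * cre_exp x) $ k"
      by (simp add: fps_mult_nth)
    finally show "fps_deriv (cre_exp x) $ k = (fps_deriv (cre_log x) * cre_exp x) $ k" .
  qed
qed

text \<open>The equation expresses (k + 1) times the coefficient at k + 1 through the coefficients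
  up to k, and k + 1 can be cancelled.\<close>

lemma fps_linear_ode_unique:
  fixes f g h :: "'a::{idom, semiring_char_0} fps"
  assumes "fps_deriv f = h * f" "fps_deriv g = h * g" "f $ 0 = g $ 0"
  shows "f = g"
proof (rule fps_ext)
  fix n
  show "f $ n = g $ n"
  proof (induction n rule: less_induct)
    case (less n)
    show ?case
    proof (cases n)
      case 0
      then show ?thesis using assms by simp
    next
      case (Suc k)
      have "fps_deriv f $ k = fps_deriv g $ k"
        unfolding assms(1,2) fps_mult_nth by (intro sum.cong refl) (use less Suc in auto)
      then show ?thesis using Suc by (simp del: of_nat_Suc)
    qed
  qed
qed

section \<open>Powers of \<open>q\<close>\<close>

lemma q_half_power: "q_half ^ n = Fraction_Field.Fract (monom 1 n) 1"
proof (induction n)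
  case 0
  then show ?case by (simp add: One_fract_def)
next
  case (Suc n)
  then show ?case
    by (simp add: q_half_def monom_Suc)
qed

lemma q_half_power_eq_iff: "q_half ^ m = q_half ^ n \<longleftrightarrow> m = n"
  by (simp add: q_half_power eq_fract monom_eq_iff')

lemma q_half_nonzero [simp]: "q_half \<noteq> 0"
  by (simp add: q_half_def Zero_fract_def eq_fract)

lemma q_nonzero [simp]: "q \<noteq> 0"
  by (simp add: q_def)

lemma qq_nonzero [simp]: "qq \<noteq> 0"
  by (simp add: qq_def)

lemma qq_eq: "qq = q_half ^ 4"
  by (simp add: qq_def q_def flip: power_mult)

lemma q_power_eq_1_iff: "q ^ n = 1 \<longleftrightarrow> n = 0"
  using q_half_power_eq_iff[of "2 * n" 0] by (simp add: q_def flip: power_mult)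

lemma qq_power_eq_iff: "qq ^ m = qq ^ n \<longleftrightarrow> m = n"
  by (simp add: qq_eq q_half_power_eq_iff flip: power_mult)

lemma qq_power_eq_1_iff: "qq ^ n = 1 \<longleftrightarrow> n = 0"
  using qq_power_eq_iff[of n 0] by simp

lemma qnum_nonzero: "0 < r \<Longrightarrow> qnum r \<noteq> 0"
proof
  assume r: "0 < r" and 0: "qnum r = 0"
  have "q ^ 1 * q ^ 1 \<noteq> 1" "q ^ r * q ^ r \<noteq> 1"
    using r q_power_eq_1_iff[of 2] q_power_eq_1_iff[of "r + r"]
    by (simp_all add: power2_eq_square flip: power_add)
  moreover have "q - inverse q = (q * q - 1) / q" "q ^ r - inverse q ^ r = (q ^ r * q ^ r - 1) / q ^ r"
    by (simp_all add: field_simps)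
  ultimately show False
    using 0 by (simp add: qnum_def)
qed

text \<open>With r = s + 1, this is the amount by which the annihilation exponential shifts a(-r):
  minus q^(-r/2)/[r] times the commutator [2r][r]/r.\<close>

definition ann_coeff :: "nat \<Rightarrow> F" where
  "ann_coeff s = - cre_coeff (Suc s) * (qnum (2 * Suc s) * qnum (Suc s) / of_nat (Suc s))"

text \<open>Since [2r]/[r] = q^r + q^(-r), the contraction exponent splits into 1 and q^(-2r). The
  two resulting logarithmic series belong to the linear factors 1 - w/z and 1 - w/(qq z).\<close>

lemma contraction_coeff:
  "of_nat (Suc s) * cre_coeff (Suc s) * ann_coeff s = - (1 + inverse qq ^ Suc s)"
proof -
  define r where "r = Suc s"
  define Q where "Q = q ^ r"
  have r: "r > 0" by (simp add: r_def)
  have Q: "Q \<noteq> 0" "Q * Q \<noteq> 1"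
    using r q_power_eq_1_iff[of "r + r"] by (simp_all add: Q_def power_add)
  have qq: "q * q \<noteq> 1"
    using q_power_eq_1_iff[of 2] by (simp add: power2_eq_square)
  have c: "cre_coeff r * cre_coeff r = inverse Q / (qnum r * qnum r)"
    by (simp add: cre_coeff_def Q_def q_def power_mult_distrib power2_eq_square power_inverse)
  have "of_nat r * cre_coeff r * ann_coeff s =
      - (of_nat r * (cre_coeff r * cre_coeff r) * (qnum (2 * r) * qnum r / of_nat r))"
    by (simp add: ann_coeff_def r_def mult_ac del: of_nat_Suc)
  also have "\<dots> = - (inverse Q * (qnum (2 * r) / qnum r))"
    using r qnum_nonzero[OF r] by (simp add: c field_simps)
  also have "qnum (2 * r) / qnum r = (Q * Q - inverse Q * inverse Q) / (Q - inverse Q)"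
  proof -
    have "q - inverse q \<noteq> 0"
      using qq by (simp add: field_simps)
    then show ?thesis
      by (simp add: qnum_def Q_def mult_2 power_add power_inverse)
  qed
  also have "\<dots> = Q + inverse Q"
    using Q by (simp add: field_simps)
  finally have "of_nat r * cre_coeff r * ann_coeff s = - (inverse Q * (Q + inverse Q))"
    by (simp add: field_simps)
  also have "\<dots> = - (1 + inverse qq ^ r)"
    using Q by (simp add: Q_def qq_def distrib_left power2_eq_square power_mult_distrib power_inverse)
  finally show ?thesis by (simp add: r_def)
qed

section \<open>Exponentials of derivations\<close>

text \<open>\<open>D\<close> is the derivation of L0[[w]] given by the sum of the A_r w^r, and
  \<open>op_pow\<close> is its iterate. The exponential of a derivation is multiplicative, so the
  annihilation exponential can be compared with \<open>vhom\<close> on generators.\<close>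

locale derivation_family =
  fixes A :: "nat \<Rightarrow> L0 \<Rightarrow> L0"
  assumes add: "A r (u + v) = A r u + A r v"
    and leibniz: "A r (u * v) = A r u * v + u * A r v"
begin

lemma zero [simp]: "A r 0 = 0"
  using add[of r 0 0] by simp

lemma sum: "A r (\<Sum>i\<in>S. f i) = (\<Sum>i\<in>S. A r (f i))"
  by (induction S rule: infinite_finite_induct) (auto simp: add)

definition D :: "L0 fps \<Rightarrow> L0 fps" where
  "D f = Abs_fps (\<lambda>k. \<Sum>r = 1..k. A r (f $ (k - r)))"

lemma D_nth: "D f $ k = (\<Sum>r = 1..k. A r (f $ (k - r)))"
  by (simp add: D_def)

lemma D_add: "D (f + g) = D f + D g"
  by (rule fps_ext) (simp add: D_nth add sum.distrib)

lemma D_zero [simp]: "D 0 = 0"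
  by (rule fps_ext) (simp add: D_nth)

lemma D_sum: "D (\<Sum>i\<in>S. f i) = (\<Sum>i\<in>S. D (f i))"
  by (induction S rule: infinite_finite_induct) (auto simp: D_add)

lemma D_mult: "D (f * g) = D f * g + f * D g"
proof (rule fps_ext)
  fix k
  have "D (f * g) $ k = (\<Sum>r = 1..k. \<Sum>i = 0..k - r. A r (f $ i) * g $ (k - r - i)) +
      (\<Sum>r = 1..k. \<Sum>i = 0..k - r. f $ i * A r (g $ (k - r - i)))"
    by (simp add: D_nth fps_mult_nth sum leibniz sum.distrib)
  also have "(\<Sum>r = 1..k. \<Sum>i = 0..k - r. A r (f $ i) * g $ (k - r - i)) =
      (\<Sum>(r,i)\<in>(SIGMA r:{1..k}. {0..k - r}). A r (f $ i) * g $ (k - r - i))"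
    by (simp add: sum.Sigma)
  also have "\<dots> = (\<Sum>(j,r)\<in>(SIGMA j:{0..k}. {1..j}). A r (f $ (j - r)) * g $ (k - j))"
    by (rule sum.reindex_bij_witness[of _ "\<lambda>(j,r). (r, j - r)" "\<lambda>(r,i). (r + i, r)"]) auto
  also have "\<dots> = (D f * g) $ k"
    by (simp add: fps_mult_nth D_nth sum_distrib_right sum.Sigma)
  also have "(\<Sum>r = 1..k. \<Sum>i = 0..k - r. f $ i * A r (g $ (k - r - i))) =
      (\<Sum>(r,i)\<in>(SIGMA r:{1..k}. {0..k - r}). f $ i * A r (g $ (k - r - i)))"
    by (simp add: sum.Sigma)
  also have "\<dots> = (\<Sum>(i,r)\<in>(SIGMA i:{0..k}. {1..k - i}). f $ i * A r (g $ (k - i - r)))"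
    by (rule sum.reindex_bij_witness[of _ "\<lambda>(i,r). (r, i)" "\<lambda>(r,i). (i, r)"]) (auto simp: add.commute)
  also have "\<dots> = (f * D g) $ k"
    by (simp add: fps_mult_nth D_nth sum_distrib_left sum.Sigma)
  finally show "D (f * g) $ k = (D f * g + f * D g) $ k" by simp
qed

lemma D_of_nat: "D (of_nat n) = 0"
proof -
  have "D 1 = 0" using D_mult[of 1 1] by simp
  then show ?thesis by (induction n) (auto simp: D_add)
qed

lemma D_funpow_mult:
  "(D ^^ n) (f * g) = (\<Sum>m\<le>n. of_nat (n choose m) * ((D ^^ m) f * (D ^^ (n - m)) g))"
proof (induction n)
  case (Suc n)
  let ?F = "\<lambda>m. (D ^^ m) f" and ?G = "\<lambda>m. (D ^^ m) g"
  have "(D ^^ Suc n) (f * g) =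
     (\<Sum>m\<le>n. of_nat (n choose m) * (?F (Suc m) * ?G (n - m))) +
     (\<Sum>m\<le>n. of_nat (n choose m) * (?F m * ?G (Suc (n - m))))"
    by (simp add: Suc D_sum D_of_nat D_mult distrib_left sum.distrib)
  also have "(\<Sum>m\<le>n. of_nat (n choose m) * (?F m * ?G (Suc (n - m)))) =
     (\<Sum>m\<le>n. of_nat (n choose m) * (?F m * ?G (Suc n - m)))"
    by (intro sum.cong) (auto simp: Suc_diff_le)
  also have "\<dots> = (\<Sum>m\<le>Suc n. of_nat (n choose m) * (?F m * ?G (Suc n - m)))"
    by simp
  also have "\<dots> = ?F 0 * ?G (Suc n) + (\<Sum>m\<le>n. of_nat (n choose Suc m) * (?F (Suc m) * ?G (n - m)))"
    by (subst sum.atMost_Suc_shift) simp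
  also have "(\<Sum>m\<le>n. of_nat (n choose m) * (?F (Suc m) * ?G (n - m))) + \<dots> =
     ?F 0 * ?G (Suc n) + (\<Sum>m\<le>n. of_nat (Suc n choose Suc m) * (?F (Suc m) * ?G (n - m)))"
    by (simp add: distrib_right sum.distrib)
  also have "\<dots> = (\<Sum>m\<le>Suc n. of_nat (Suc n choose m) * (?F m * ?G (Suc n - m)))"
    by (simp only: sum.atMost_Suc_shift[of _ n]) simp
  finally show ?case .
qed simp

lemma D_funpow_nth_eq_0: "k < n \<Longrightarrow> (D ^^ n) f $ k = 0"
proof (induction n arbitrary: k)
  case (Suc n)
  then show ?case
    unfolding funpow.simps o_apply D_nth by (intro sum.neutral ballI) (simp add: Suc.IH less_diff_conv2)
qed simp

lemma op_pow_eq: "op_pow A n k v = (D ^^ n) (fps_const v) $ k"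
  by (induction n arbitrary: k) (simp_all add: D_nth)

text \<open>Divided powers of \<open>D\<close>: in this normalisation the Leibniz rule carries no
  binomial coefficients, and their sum is the exponential.\<close>

definition dp :: "nat \<Rightarrow> L0 \<Rightarrow> L0 fps" where
  "dp n v = fps_const (const_L (1 / fact n)) * (D ^^ n) (fps_const v)"

lemma op_exp_eq: "op_exp A k v = (\<Sum>n\<le>k. dp n v $ k)"
  by (simp add: op_exp_def dp_def op_pow_eq scale_L_def)

lemma dp_nth_eq_0: "k < n \<Longrightarrow> dp n v $ k = 0"
  by (simp add: dp_def D_funpow_nth_eq_0)

lemma dp_mult: "dp n (u * v) = (\<Sum>m\<le>n. dp m u * dp (n - m) v)"
proof -
  have "fps_const (const_L (1 / fact n)) * (of_nat (n choose m) * f) =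
      fps_const (const_L (1 / fact m)) * fps_const (const_L (1 / fact (n - m))) * f" if "m \<le> n" for m f
  proof -
    have "1 / fact n * of_nat (n choose m) = (1 / fact m * (1 / fact (n - m)) :: F)"
      using binomial_fact[OF that, where ?'a = F] by simp
    then have "const_L (1 / fact n) * const_L (of_nat (n choose m)) =
        const_L (1 / fact m) * const_L (1 / fact (n - m))"
      by (simp flip: const_L.mult)
    then have "fps_const (const_L (1 / fact n)) * fps_const (of_nat (n choose m)) =
        fps_const (const_L (1 / fact m)) * fps_const (const_L (1 / fact (n - m)))"
      by (simp add: const_L.of_nat)
    then show ?thesis
      by (simp add: fps_of_nat flip: mult.assoc)
  qed
  then show ?thesis
    unfolding dp_def fps_const_mult[symmetric] D_funpow_mult sum_distrib_left
    by (intro sum.cong refl) (simp add: mult_ac)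
qed

lemma op_exp_mult: "op_exp A k (u * v) = (\<Sum>i = 0..k. op_exp A i u * op_exp A (k - i) v)"
proof -
  have "op_exp A k (u * v) = (\<Sum>n\<le>k. \<Sum>m\<le>n. \<Sum>i = 0..k. dp m u $ i * dp (n - m) v $ (k - i))"
    by (simp add: op_exp_eq dp_mult fps_sum_nth fps_mult_nth)
  also have "\<dots> = (\<Sum>(m,m')\<in>{(m,m'). m + m' \<le> k}. \<Sum>i = 0..k. dp m u $ i * dp m' v $ (k - i))"
    by (rule sum.triangle_reindex_eq[symmetric])
  also have "\<dots> = (\<Sum>i = 0..k. \<Sum>(m,m')\<in>{(m,m'). m + m' \<le> k}. dp m u $ i * dp m' v $ (k - i))"
    unfolding case_prod_beta by (rule sum.swap)
  \<comment> \<open>\<open>dp m u\<close> starts in degree \<open>m\<close>, so only the rectangle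
    \<open>m \<le> i\<close>, \<open>m' \<le> k - i\<close> of the triangle contributes; over a
    rectangle the sum factors.\<close>
  also have "\<dots> = (\<Sum>i = 0..k. \<Sum>(m,m')\<in>{..i} \<times> {..k - i}. dp m u $ i * dp m' v $ (k - i))"
  proof (intro sum.cong[OF refl] sum.mono_neutral_right)
    show "finite {(m, m'). m + m' \<le> k}"
      by (rule finite_subset[of _ "{..k} \<times> {..k}"]) auto
  qed (auto, (metis dp_nth_eq_0 not_le)+)
  also have "\<dots> = (\<Sum>i = 0..k. op_exp A i u * op_exp A (k - i) v)"
    by (simp add: op_exp_eq sum_product sum.cartesian_product)
  finally show ?thesis .
qed

lemma op_exp_add: "op_exp A k (u + v) = op_exp A k u + op_exp A k v"
proof -
  have "(D ^^ n) (fps_const (u + v)) = (D ^^ n) (fps_const u) + (D ^^ n) (fps_const v)" for n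
    by (induction n) (simp_all add: D_add)
  then show ?thesis
    by (simp add: op_exp_eq dp_def distrib_left sum.distrib)
qed

text \<open>Meant for generators of L0: annihilation operators send them to constants, which are
  killed by the next application, so the exponential stops after its linear term.\<close>

lemma op_exp_square_zero:
  assumes "\<And>r s. 0 < r \<Longrightarrow> 0 < s \<Longrightarrow> A r (A s v) = 0"
  shows "op_exp A k v = (if k = 0 then v else A k v)"
proof -
  have 1: "op_pow A 1 k v = (if k = 0 then 0 else A k v)" for k
  proof -
    have "op_pow A 1 k v = (\<Sum>r = 1..k. if r = k then A k v else 0)"
      unfolding One_nat_def op_pow.simps by (intro sum.cong refl) auto
    then show ?thesis by (cases k) auto
  qed
  have 2: "op_pow A (Suc (Suc n)) k v = 0" for n k
  proof (induction n arbitrary: k)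
    case 0
    have "op_pow A (Suc (Suc 0)) k v = (\<Sum>r = 1..k. A r (op_pow A 1 (k - r) v))"
      by simp
    also have "\<dots> = 0"
      unfolding 1 using assms by (intro sum.neutral) auto
    finally show ?case .
  qed (simp only: op_pow.simps zero sum.neutral_const)
  show ?thesis
  proof (cases k)
    case 0
    then show ?thesis by (simp add: op_exp_def scale_L_def)
  next
    case (Suc l)
    have "op_exp A k v = (\<Sum>n\<in>{1}. scale_L (1 / of_nat (fact n)) (op_pow A n k v))"
      unfolding op_exp_def
    proof (rule sum.mono_neutral_right)
      show "\<forall>n\<in>{..k} - {1}. scale_L (1 / of_nat (fact n)) (op_pow A n k v) = 0"
      proof
        fix n assume "n \<in> {..k} - {1}"
        then consider "n = 0" | m where "n = Suc (Suc m)"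
          by (metis Diff_iff One_nat_def insertCI not0_implies_Suc)
        then show "scale_L (1 / of_nat (fact n)) (op_pow A n k v) = 0"
          by cases (use Suc 2 in \<open>auto simp: scale_L_def simp del: op_pow.simps(2)\<close>)
      qed
    qed (use Suc in auto)
    then show ?thesis
      using Suc 1[of k] by (simp add: scale_L_def del: op_pow.simps(2))
  qed
qed

end

section \<open>Annihilation operators as derivations, and the Frenkel-Jing operator as a field
  \<open>vo\<close>\<close>

lemma a_pos_K_zero: "a_pos_K r 0 = 0"
  by (simp add: a_pos_K_def partial_K_zero)

lemma a_pos_lookup: "Poly_Mapping.lookup (a_pos r v) j = a_pos_K r (Poly_Mapping.lookup v j)"
  by (simp add: a_pos_def Poly_Mapping.map.rep_eq when_def a_pos_K_zero)

lemma a_pos_add: "a_pos r (u + v) = a_pos r u + a_pos r v"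
  by (rule poly_mapping_eqI) (simp add: a_pos_lookup lookup_add a_pos_K_add)

lemma a_pos_single: "a_pos r (Poly_Mapping.single j u) = Poly_Mapping.single j (a_pos_K r u)"
  by (rule poly_mapping_eqI) (simp add: a_pos_lookup lookup_single when_def a_pos_K_zero)

lemma a_pos_zero: "a_pos r 0 = 0"
  by (rule poly_mapping_eqI) (simp add: a_pos_lookup a_pos_K_zero)

lemma a_pos_mult: "a_pos r (u * v) = a_pos r u * v + u * a_pos r v"
proof (induction u rule: K1_induct)
  case (single m c)
  show ?case
  proof (induction v rule: K1_induct)
    case (single n d)
    show ?case by (simp add: mult_single a_pos_single a_pos_K_mult single_add)
  qed (simp_all add: a_pos_zero a_pos_add algebra_simps)
qed (simp_all add: a_pos_zero a_pos_add algebra_simps)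

abbreviation ann :: "nat \<Rightarrow> L0 \<Rightarrow> L0" where
  "ann \<equiv> \<lambda>r w. scale_L (- (inverse q_half ^ r / qnum r)) (a_pos r w)"

interpretation ann: derivation_family ann
  by unfold_locales (simp_all add: scale_L_def a_pos_add a_pos_mult algebra_simps)

lemma ann_const [simp]: "ann r (const_L c) = 0"
  by (simp add: const_L_def a_pos_single a_pos_K_const scale_L_def)

lemma ann_e [simp]: "ann r (e_L j) = 0"
  using a_pos_K_const[of r 1] by (simp add: e_L_def a_pos_single scale_L_def const_K_def)

lemma ann_var:
  assumes "0 < r"
  shows "ann r (var_L s) = const_L (if r = Suc s then ann_coeff s else 0)"
proof -
  have "a_neg_K (Suc s) 1 = var_K s" by (simp add: a_neg_K_def)
  then have "a_pos_K r (var_K s) = (if r = Suc s then const_K (qnum (2 * r) * qnum r / of_nat r) else 0)"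
    using a_pos_K_var[of r "Suc s"] assms by simp
  then have "a_pos r (var_L s) = const_L (if r = Suc s then qnum (2 * r) * qnum r / of_nat r else 0)"
    by (simp add: var_L_def a_pos_single const_L_def) (simp add: const_K_def)
  then have "ann r (var_L s) = const_L (- (inverse q_half ^ r / qnum r) *
      (if r = Suc s then qnum (2 * r) * qnum r / of_nat r else 0))"
    by (simp only: scale_L_def const_L.mult)
  then show ?thesis
    by (auto simp: ann_coeff_def cre_coeff_def simp del: of_nat_Suc)
qed

text \<open>A formal Taylor theorem: exponentiated derivations act as a translation. The induction
  over generators of L0 uses multiplicativity on both sides.\<close>

lemma vhom_ann_nth:
  "vhom ann_coeff 0 1 v $$ n = (if n \<le> 0 then op_exp ann (nat (- n)) v else 0)"
proof (induction v arbitrary: n rule: L0_induct)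
  case (const c)
  have "op_exp ann k (const_L c) = (if k = 0 then const_L c else 0)" for k
    by (subst ann.op_exp_square_zero) (simp_all add: ann.zero)
  then show ?case
    by (auto simp: vhom_const cst_def)
next
  case (e j)
  have "op_exp ann k (e_L j) = (if k = 0 then e_L j else 0)" for k
    by (subst ann.op_exp_square_zero) (simp_all add: ann.zero)
  then show ?case
    by (auto simp: vhom_e cst_def)
next
  case (var s)
  have "op_exp ann k (var_L s) = (if k = 0 then var_L s else const_L (if k = Suc s then ann_coeff s else 0))" for k
  proof -
    have "op_exp ann k (var_L s) = (if k = 0 then var_L s else ann k (var_L s))"
      by (rule ann.op_exp_square_zero) (simp only: ann_var ann_const)
    then show ?thesis using ann_var[of k s] by (auto simp only: neq0_conv split: if_split)
  qed
  moreover have "(cst x * zpow k) $$ n = (if n = k then const_L x else 0)" for x k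
    by (subst mult.commute) (simp add: zpow_mult cst_def)
  ultimately show ?case
    by (auto simp: vhom_var)
next
  case (add u v)
  then show ?case
    by (simp add: ring_morphism.add[OF ring_morphism_vhom] ann.op_exp_add)
next
  case (mult u v)
  let ?h = "vhom ann_coeff 0 1"
  obtain M where M: "\<forall>n<M. ?h u $$ n = 0" by (rule fls_nth_vanishes_belowE)
  obtain N where N: "\<forall>n<N. ?h v $$ n = 0" by (rule fls_nth_vanishes_belowE)
  have "?h (u * v) $$ n = (\<Sum>i = M..n - N. ?h u $$ i * ?h v $$ (n - i))"
    unfolding ring_morphism.mult[OF ring_morphism_vhom, OF one_neq_zero]
    using M N by (intro fls_times_nth_bounded) auto
  \<comment> \<open>By induction hypothesis both factors have only nonpositive exponents, so the
    auxiliary bounds \<open>M\<close> and \<open>N\<close> can be traded for \<open>n\<close> and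
    \<open>0\<close>.\<close>
  also have "\<dots> = (\<Sum>i = n..0. ?h u $$ i * ?h v $$ (n - i))"
  proof (rule sum.mono_neutral_cong)
    fix i assume "i \<in> {M..n - N} - {n..0}"
    then have "i > 0 \<or> n - i > 0" by auto
    then show "?h u $$ i * ?h v $$ (n - i) = 0" by (auto simp: mult)
  next
    fix i assume "i \<in> {n..0} - {M..n - N}"
    then have "i < M \<or> n - i < N" by auto
    then show "?h u $$ i * ?h v $$ (n - i) = 0" using M N by auto
  qed auto
  also have "\<dots> = (if n \<le> 0 then op_exp ann (nat (- n)) (u * v) else 0)"
  proof (cases "n \<le> 0")
    case True
    have [simp]: "nat (- n) - nat (- a) = nat (a - n)" if "n \<le> a" "a \<le> 0" for a
      using that by linarith
    have "(\<Sum>i = n..0. ?h u $$ i * ?h v $$ (n - i)) =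
       (\<Sum>i = 0..nat (- n). op_exp ann i u * op_exp ann (nat (- n) - i) v)"
      by (rule sum.reindex_bij_witness[of _ "\<lambda>i. - int i" "\<lambda>i. nat (- i)"])
         (use True in \<open>auto simp: mult\<close>)
    then show ?thesis using True by (simp add: ann.op_exp_mult)
  qed simp
  finally show ?case .
qed

lemma exp_annihilation_eq: "exp_annihilation = vo 1 ann_coeff 0 1"
proof
  fix v
  have "exp_annihilation v = Abs_fls (fls_nth (vhom ann_coeff 0 1 v))"
    unfolding exp_annihilation_def by (intro arg_cong[where f = Abs_fls] ext) (simp add: vhom_ann_nth)
  then show "exp_annihilation v = vo 1 ann_coeff 0 1 v"
    by (simp add: fls_nth_inverse vo_def)
qed

lemma exp_creation_eq: "exp_creation = vo (fps_to_fls (cre_exp 1)) (\<lambda>_. 0) 0 1"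
proof
  fix v
  have *: "(f * fls_const u) $$ n = f $$ n * u" for f :: "L0 fls" and u n
    by (simp add: mult.commute[of f] mult.commute[of "f $$ n"])
  have "exp_creation v = Abs_fls (fls_nth (fps_to_fls (cre_exp 1) * fls_const v))"
    unfolding exp_creation_def
    by (intro arg_cong[where f = Abs_fls] ext) (simp add: * op_exp_creation)
  then show "exp_creation v = vo (fps_to_fls (cre_exp 1)) (\<lambda>_. 0) 0 1 v"
    by (simp add: fls_nth_inverse vo_def vhom_trivial)
qed

lemma e_alpha_eq: "(\<lambda>v. fls_const (e_alpha v)) = vo (fls_const (e_L 1)) (\<lambda>_. 0) 0 1"
  by (rule ext) (simp add: vo_def vhom_trivial e_alpha_def e_L_def)

lemma z_partial_alpha_eq: "z_partial_alpha = vo 1 (\<lambda>_. 0) 1 1"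
proof
  fix v :: L0
  interpret ring_morphism "vhom (\<lambda>_. 0) 1 1" by (rule ring_morphism_vhom) simp
  have 0: "vhom (\<lambda>_. 0) 1 1 (Poly_Mapping.single 0 u) = vhom (\<lambda>_. 0) 0 1 (Poly_Mapping.single 0 u)" for u
    unfolding vhom_def L0_eval_def by (simp add: pm_eval_single[of "pm_eval _ _", OF pm_eval_zero])
  have s: "vhom (\<lambda>_. 0) 1 1 (Poly_Mapping.single j u) =
     fls_shift (- (2 * j)) (fls_const (Poly_Mapping.single j u))" for j u
  proof -
    have "Poly_Mapping.single j u = e_L j * Poly_Mapping.single 0 u"
      by (simp add: e_L_def mult_single)
    then have "vhom (\<lambda>_. 0) 1 1 (Poly_Mapping.single j u) =
        zpow (2 * j) * (fls_const (e_L j) * fls_const (Poly_Mapping.single 0 u))"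
      by (simp add: mult vhom_e 0 vhom_trivial mult.assoc del: fls_const_mult_const)
    also have "fls_const (e_L j) * fls_const (Poly_Mapping.single 0 u) = fls_const (Poly_Mapping.single j u)"
      by (simp add: e_L_def mult_single)
    finally show ?thesis by (simp add: zpow_mult)
  qed
  have "v = (\<Sum>j\<in>Poly_Mapping.keys v. Poly_Mapping.single j (Poly_Mapping.lookup v j))"
    by (rule poly_mapping_eqI) (auto simp: lookup_sum lookup_single when_def in_keys_iff)
  then have "vhom (\<lambda>_. 0) 1 1 v =
     vhom (\<lambda>_. 0) 1 1 (\<Sum>j\<in>Poly_Mapping.keys v. Poly_Mapping.single j (Poly_Mapping.lookup v j))"
    by simp
  then show "z_partial_alpha v = vo 1 (\<lambda>_. 0) 1 1 v"
    by (simp add: z_partial_alpha_def vo_def sum s)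
qed

lemma frenkel_jing_eq:
  "frenkel_jing = vo (fps_to_fls (cre_exp 1) * fls_const (e_L 1)) ann_coeff 1 1"
proof -
  have 1: "mult_fld (\<lambda>v. fls_const (e_alpha v)) z_partial_alpha = vo (fls_const (e_L 1)) (\<lambda>_. 0) 1 1"
    unfolding e_alpha_eq z_partial_alpha_eq
    using good_fls_const[of "1 :: L0 fls"] diag_fls_const[of "1 :: L0 fls"]
      ring_morphism.one[OF ring_morphism_fls_map, OF ring_morphism_vhom, of 1 "\<lambda>_. 0" 0]
    by (subst mult_vo) simp_all
  have 2: "mult_fld exp_annihilation \<dots> = vo (fls_const (e_L 1)) ann_coeff 1 1"
    unfolding exp_annihilation_eq
    by (subst mult_vo) (simp_all add: good_fls_const diag_fls_const vhom_e)
  have "fls_map (vhom (\<lambda>_. 0) 0 1) (fls_const (e_L 1)) = fls_const (fls_const (e_L 1))"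
    by (simp add: vhom_trivial)
  then show ?thesis
    unfolding frenkel_jing_def 1 2 exp_creation_eq
    by (subst mult_vo) (simp_all add: good_fls_const diag_fls_const)
qed

section \<open>Normally ordered products\<close>

definition fps_map :: "('a \<Rightarrow> 'b) \<Rightarrow> 'a fps \<Rightarrow> 'b fps" where
  "fps_map \<phi> f = Abs_fps (\<lambda>n. \<phi> (f $ n))"

lemma fps_map_nth [simp]: "fps_map \<phi> f $ n = \<phi> (f $ n)"
  by (simp add: fps_map_def)

lemma fls_map_fps_to_fls: "\<phi> 0 = 0 \<Longrightarrow> fls_map \<phi> (fps_to_fls f) = fps_to_fls (fps_map \<phi> f)"
  by (rule fls_eqI) simp

context ring_morphism
begin

lemma fps_map_mult: "fps_map \<phi> (f * g) = fps_map \<phi> f * fps_map \<phi> g"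
  by (rule fps_ext) (simp add: fps_mult_nth sum mult)

lemma fps_map_deriv: "fps_map \<phi> (fps_deriv f) = fps_deriv (fps_map \<phi> f)"
  by (rule fps_ext) (simp add: mult of_nat del: of_nat_Suc)

end

text \<open>The annihilation part of x(xz): replacing z by xz divides the shift of a(-s-1) by
  x^(s+1) and turns z^(2j) into (x^2)^j z^(2j).\<close>

abbreviation (input) vhom1 :: "F \<Rightarrow> L0 \<Rightarrow> L0 fls" where
  "vhom1 x \<equiv> vhom (\<lambda>s. ann_coeff s / x ^ Suc s) 1 (x\<^sup>2)"

lemma geometric_fps: "Abs_fps (\<lambda>n. a ^ Suc n) * (1 - fps_const a * fps_X) = fps_const (a :: 'a::comm_ring_1)"
proof -
  let ?U = "Abs_fps (\<lambda>n. a ^ Suc n)"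
  have "?U * (1 - fps_const a * fps_X) = ?U - fps_const a * (fps_X * ?U)"
    by (simp add: right_diff_distrib mult_ac del: power_Suc)
  also have "\<dots> = fps_const a"
  proof (rule fps_ext)
    fix n
    show "(?U - fps_const a * (fps_X * ?U)) $ n = fps_const a $ n"
      by (cases n) simp_all
  qed
  finally show ?thesis .
qed

text \<open>
  Both sides solve the same linear differential equation in the variable of the creation operators,
  since \<open>a(-r)\<close> is shifted by a multiple of \<open>z\<^bsup>-r\<^esup>\<close>, which adds two geometric series to the
  logarithmic derivative.
\<close>

lemma contraction_fps:
  assumes x: "x \<noteq> 0"
  shows "fps_map (vhom1 x) (cre_exp y) = fps_map fls_const (cre_exp y) *
     ((1 - fps_const (cst (y / x) * zpow (-1)) * fps_X) *
      (1 - fps_const (cst (y / (qq * x)) * zpow (-1)) * fps_X))"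
proof -
  have x2: "x\<^sup>2 \<noteq> 0" using x by simp
  interpret H: ring_morphism "vhom1 x" by (rule ring_morphism_vhom) fact
  interpret C: ring_morphism "fls_const :: L0 \<Rightarrow> L0 fls" by (rule ring_morphism_fls_const)
  let ?E = "fps_map fls_const (cre_exp y)"
  define a where "a = cst (y / x) * zpow (-1)"
  define b where "b = cst (y / (qq * x)) * zpow (-1)"
  let ?A = "1 - fps_const a * fps_X" and ?B = "1 - fps_const b * fps_X"
  let ?h = "fps_map (vhom1 x) (fps_deriv (cre_log y))"
  have geo: "Abs_fps (\<lambda>n. a ^ Suc n) * ?A = fps_const a" "Abs_fps (\<lambda>n. b ^ Suc n) * ?B = fps_const b"
    by (rule geometric_fps)+
  have h: "?h = fps_map fls_const (fps_deriv (cre_log y)) - Abs_fps (\<lambda>n. a ^ Suc n) - Abs_fps (\<lambda>n. b ^ Suc n)"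
  proof (rule fps_ext)
    fix n
    let ?c = "of_nat (Suc n) * cre_coeff (Suc n)"
    have l: "fps_deriv (cre_log y) $ n = const_L (?c * y ^ Suc n) * var_L n"
      by (simp add: cre_log_def const_L.mult const_L.of_nat mult_ac del: of_nat_Suc power_Suc)
    have "?h $ n = cst (?c * y ^ Suc n) * (fls_const (var_L n) + cst (ann_coeff n / x ^ Suc n) * zpow (- int (Suc n)))"
      unfolding fps_map_nth l by (simp only: H.mult vhom_const[OF x2] vhom_var[OF x2])
    also have "\<dots> = fls_const (fps_deriv (cre_log y) $ n) + cst (?c * ann_coeff n * (y / x) ^ Suc n) * zpow (- int (Suc n))"
    proof -
      have "cst (?c * y ^ Suc n) * cst (ann_coeff n / x ^ Suc n) = cst (?c * ann_coeff n * (y / x) ^ Suc n)"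
        by (simp add: power_divide mult_ac del: of_nat_Suc power_Suc flip: cst.mult)
      moreover have "cst (?c * y ^ Suc n) * fls_const (var_L n) = fls_const (fps_deriv (cre_log y) $ n)"
        unfolding l cst_def fls_const_mult_const ..
      ultimately show ?thesis
        by (simp only: distrib_left mult.assoc[symmetric])
    qed
    also have "?c * ann_coeff n * (y / x) ^ Suc n = - ((y / x) ^ Suc n) - (y / (qq * x)) ^ Suc n"
      unfolding contraction_coeff
      by (simp add: algebra_simps power_divide power_mult_distrib power_inverse divide_inverse del: power_Suc)
    also have "cst \<dots> * zpow (- int (Suc n)) = - (a ^ Suc n) - b ^ Suc n"
      unfolding a_def b_def power_mult_distrib zpow_power
      by (simp add: cst.diff cst.uminus cst.power algebra_simps del: power_Suc of_nat_Suc)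
    finally show "?h $ n = (fps_map fls_const (fps_deriv (cre_log y)) - Abs_fps (\<lambda>n. a ^ Suc n) - Abs_fps (\<lambda>n. b ^ Suc n)) $ n"
      by (simp del: power_Suc)
  qed
  show ?thesis
    unfolding a_def[symmetric] b_def[symmetric]
  proof (rule fps_linear_ode_unique)
    show "fps_deriv (fps_map (vhom1 x) (cre_exp y)) = ?h * fps_map (vhom1 x) (cre_exp y)"
      by (simp only: H.fps_map_deriv[symmetric] H.fps_map_mult[symmetric] cre_exp_deriv)
    have "fps_deriv ?E = fps_map fls_const (fps_deriv (cre_log y)) * ?E"
      by (simp only: C.fps_map_deriv[symmetric] C.fps_map_mult[symmetric] cre_exp_deriv)
    then have "fps_deriv (?E * (?A * ?B)) =
      fps_map fls_const (fps_deriv (cre_log y)) * ?E * (?A * ?B) - ?E * (fps_const a * ?B + ?A * fps_const b)"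
      by (simp add: algebra_simps flip: fps_const_add)
    also have "\<dots> = ?h * (?E * (?A * ?B))"
    proof -
      have "(f - u - v) * (e * (r * s)) = f * e * (r * s) - e * ((u * r) * s + r * (v * s))"
        for e f r s u v :: "L0 fls fps"
        by (simp add: algebra_simps)
      then show ?thesis
        unfolding h by (simp only: geo)
    qed
    finally show "fps_deriv (?E * (?A * ?B)) = ?h * (?E * (?A * ?B))" .
  qed (simp add: cre_exp_0 x)
qed

text \<open>On the diagonal the creation variable becomes z and cancels the z^(-1) of the
  annihilation part, so both linear factors turn into scalars. They vanish at y = x and at y = qq x
  respectively.\<close>

lemma contraction:
  assumes x: "x \<noteq> 0"
  shows good_contraction: "good (fls_map (vhom1 x) (fps_to_fls (cre_exp y)))"
    and diag_contraction: "diag (fls_map (vhom1 x) (fps_to_fls (cre_exp y))) =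
       fps_to_fls (cre_exp y) * cst ((1 - y / x) * (1 - y / (qq * x)))"
proof -
  have x2: "x\<^sup>2 \<noteq> 0" using x by simp
  have f: "fps_to_fls (1 - fps_const (cst c * zpow (-1)) * fps_X) =
      1 + fls_const (- (cst c * zpow (-1))) * zpow 1" for c
    by (simp add: fls_times_fps_to_fls zpow_def[of 1] fls_X_conv_shift_1)
  have g: "good (1 + fls_const (- (cst c * zpow (-1))) * zpow 1)"
    "diag (1 + fls_const (- (cst c * zpow (-1))) * zpow 1) = cst (1 - c)" for c
  proof -
    have 1: "good (1 :: L0 fls fls)" "diag (1 :: L0 fls fls) = 1"
      using good_fls_const[of "1 :: L0 fls"] diag_fls_const[of "1 :: L0 fls"] by simp_all
    show "good (1 + fls_const (- (cst c * zpow (-1))) * zpow 1)"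
      by (intro good_add good_mult 1 good_fls_const good_zpow)
    have "diag (1 + fls_const (- (cst c * zpow (-1))) * zpow 1) = 1 + (- (cst c * zpow (-1))) * zpow 1"
      by (simp only: diag_add diag_mult good_add good_mult 1 good_fls_const good_zpow diag_fls_const diag_zpow)
    also have "\<dots> = cst (1 - c)"
      using zpow_add[of "-1" 1, where ?'a = L0] by (simp add: cst.diff mult.assoc)
    finally show "diag (1 + fls_const (- (cst c * zpow (-1))) * zpow 1) = cst (1 - c)" .
  qed
  have eq: "fls_map (vhom1 x) (fps_to_fls (cre_exp y)) = fls_map fls_const (fps_to_fls (cre_exp y)) *
     ((1 + fls_const (- (cst (y / x) * zpow (-1))) * zpow 1) *
      (1 + fls_const (- (cst (y / (qq * x)) * zpow (-1))) * zpow 1))"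
    by (simp only: fls_map_fps_to_fls[of "vhom1 x", OF vhom_0[OF x2]] contraction_fps[OF x]
        fls_times_fps_to_fls f fls_map_fps_to_fls[of fls_const, OF fls_const_0])
  show "good (fls_map (vhom1 x) (fps_to_fls (cre_exp y)))"
    unfolding eq by (intro good_mult good_fls_map_const g)
  show "diag (fls_map (vhom1 x) (fps_to_fls (cre_exp y))) =
       fps_to_fls (cre_exp y) * cst ((1 - y / x) * (1 - y / (qq * x)))"
    unfolding eq
    by (simp only: diag_mult good_mult good_fls_map_const g diag_fls_map_const cst.mult)
qed

definition cre_prod :: "F list \<Rightarrow> L0 fls" where
  "cre_prod xs = (\<Prod>x\<leftarrow>xs. fps_to_fls (cre_exp x))"

text \<open>\<open>nf [x\<^sub>1,\<dots>,x\<^sub>m] k\<close> is \<open>z\<^bsup>k\<^esup> :x(x\<^sub>1z)\<dots>x(x\<^sub>mz):\<close>.\<close>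

definition nf :: "F list \<Rightarrow> int \<Rightarrow> fld" where
  "nf xs k = vo (zpow k * fls_const (e_L (int (length xs))) * cre_prod xs)
     (\<lambda>s. \<Sum>x\<leftarrow>xs. ann_coeff s / x ^ Suc s) (int (length xs)) ((prod_list xs)\<^sup>2)"

text \<open>The contraction scalars with denominators cleared: the factor x^2 for each entry of
  \<open>ys\<close> is supplied by z^\<partial> at xz acting on e^(m\<alpha>), where m is the length
  of \<open>ys\<close>.\<close>

definition pairing :: "F \<Rightarrow> F list \<Rightarrow> F" where
  "pairing x ys = (\<Prod>y\<leftarrow>ys. (x - y) * (x - y / qq))"

lemma frenkel_jing_nf: "frenkel_jing = nf [1] 0"
  by (simp add: frenkel_jing_eq nf_def cre_prod_def mult_ac)

lemma one_fld_nf: "one_fld = nf [] 0"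
  by (rule ext) (simp add: one_fld_def nf_def cre_prod_def vo_def vhom_trivial e_L_0)

lemma contraction_list:
  assumes x: "x \<noteq> 0"
  shows "good (fls_map (vhom1 x) (cre_prod ys))"
    and "cst (x ^ (2 * length ys)) * diag (fls_map (vhom1 x) (cre_prod ys)) = cst (pairing x ys) * cre_prod ys"
proof -
  have x2: "x\<^sup>2 \<noteq> 0" using x by simp
  interpret M: ring_morphism "fls_map (vhom1 x)"
    by (intro ring_morphism_fls_map ring_morphism_vhom x2)
  have "good (fls_map (vhom1 x) (cre_prod ys)) \<and>
    cst (x ^ (2 * length ys)) * diag (fls_map (vhom1 x) (cre_prod ys)) = cst (pairing x ys) * cre_prod ys"
  proof (induction ys)
    case Nil
    show ?case
      using good_fls_const[of "1 :: L0 fls"] diag_fls_const[of "1 :: L0 fls"]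
      by (simp add: cre_prod_def pairing_def del: power_Suc)
  next
    case (Cons y ys)
    let ?C = "diag (fls_map (vhom1 x) (cre_prod ys))"
    have eq: "fls_map (vhom1 x) (cre_prod (y # ys)) =
        fls_map (vhom1 x) (fps_to_fls (cre_exp y)) * fls_map (vhom1 x) (cre_prod ys)"
      by (simp add: cre_prod_def M.mult del: power_Suc)
    have g: "good (fls_map (vhom1 x) (cre_prod (y # ys)))"
      unfolding eq using Cons by (intro good_mult good_contraction x) auto
    have d: "diag (fls_map (vhom1 x) (cre_prod (y # ys))) =
       fps_to_fls (cre_exp y) * cst ((1 - y / x) * (1 - y / (qq * x))) * ?C"
      unfolding eq using Cons
      by (subst diag_mult) (simp_all only: good_contraction[OF x] diag_contraction[OF x])
    have "x ^ (2 * length (y # ys)) * ((1 - y / x) * (1 - y / (qq * x))) =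
       x ^ (2 * length ys) * ((x - y) * (x - y / qq))"
    proof -
      have "x * (1 - y / x) = x - y" "x * (1 - y / (qq * x)) = x - y / qq"
        using x by (simp_all add: field_simps)
      moreover have "x ^ (2 * length (y # ys)) * ((1 - y / x) * (1 - y / (qq * x))) =
         x ^ (2 * length ys) * ((x * (1 - y / x)) * (x * (1 - y / (qq * x))))"
        by (simp add: power_add mult_ac)
      ultimately show ?thesis by simp
    qed
    then have c: "cst (x ^ (2 * length (y # ys))) * cst ((1 - y / x) * (1 - y / (qq * x))) =
       cst (x ^ (2 * length ys)) * cst ((x - y) * (x - y / qq))"
      by (simp only: cst.mult[symmetric])
    have "cst (x ^ (2 * length (y # ys))) * diag (fls_map (vhom1 x) (cre_prod (y # ys))) =
       fps_to_fls (cre_exp y) * (cst (x ^ (2 * length (y # ys))) * cst ((1 - y / x) * (1 - y / (qq * x)))) * ?C"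
      unfolding d by (simp only: mult_ac)
    also have "\<dots> = fps_to_fls (cre_exp y) * cst ((x - y) * (x - y / qq)) * (cst (x ^ (2 * length ys)) * ?C)"
      unfolding c by (simp only: mult_ac)
    also have "\<dots> = cst (pairing x (y # ys)) * cre_prod (y # ys)"
      using Cons by (simp only: pairing_def cre_prod_def list.map prod_list.Cons cst.mult mult_ac)
    finally show ?case using g by blast
  qed
  then show "good (fls_map (vhom1 x) (cre_prod ys))"
    "cst (x ^ (2 * length ys)) * diag (fls_map (vhom1 x) (cre_prod ys)) = cst (pairing x ys) * cre_prod ys"
    by blast+
qed

lemma scale_fld_vo: "scale_fld d (vo S b m c) = vo (cst d * S) b m c"
  by (rule ext) (simp add: scale_fld_def vo_def cst_def mult.assoc)

text \<open>The summand \<open>2 * int (length ys)\<close> in the exponent is (\<alpha>, m\<alpha>),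
  picked up when z^\<partial> of the left factor crosses e^(m\<alpha>).\<close>

lemma mult_nf:
  assumes x: "x \<noteq> 0" and ys: "0 \<notin> set ys"
  shows good_mult_nf: "good (fls_map (nf [x] a) (nf ys b v))"
    and mult_fld_nf: "mult_fld (nf [x] a) (nf ys b) =
       scale_fld (pairing x ys) (nf (x # ys) (a + b + 2 * int (length ys)))"
proof -
  have x2: "x\<^sup>2 \<noteq> 0" and y2: "(prod_list ys)\<^sup>2 \<noteq> 0"
    using x ys by (simp_all add: prod_list_zero_iff)
  let ?m = "int (length ys)"
  interpret M: ring_morphism "fls_map (vhom1 x)"
    by (intro ring_morphism_fls_map ring_morphism_vhom x2)
  let ?T = "zpow b * fls_const (e_L ?m) * cre_prod ys"
  have eq: "fls_map (vhom1 x) ?T = zpow b * fls_const (vhom1 x (e_L ?m)) * fls_map (vhom1 x) (cre_prod ys)"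
    by (simp only: M.mult fls_map_zpow[OF ring_morphism_vhom[OF x2]]
        fls_map_fls_const[of "vhom1 x", OF vhom_0[OF x2]])
  have g: "good (fls_map (vhom1 x) ?T)"
    unfolding eq by (intro good_mult good_zpow good_fls_const contraction_list x)
  have nf1: "nf [x] a = vo (zpow a * fls_const (e_L 1) * cre_prod [x]) (\<lambda>s. ann_coeff s / x ^ Suc s) 1 (x\<^sup>2)"
    by (simp add: nf_def)
  show "good (fls_map (nf [x] a) (nf ys b v))" for v
    unfolding nf1 nf_def[of ys] using g by (rule good_mult_vo[OF x2 y2])
  have e: "vhom1 x (e_L ?m) = cst (x ^ (2 * length ys)) * zpow (2 * ?m) * fls_const (e_L ?m)"
    using x2 by (simp add: vhom_e power_int_of_nat flip: power_mult)
  have d: "diag (fls_map (vhom1 x) ?T) = zpow b * zpow (2 * ?m) * fls_const (e_L ?m) * (cst (pairing x ys) * cre_prod ys)"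
    unfolding eq contraction_list(2)[OF x, symmetric] using x
    by (simp only: diag_mult good_mult good_zpow good_fls_const contraction_list(1)[OF x] diag_zpow
       diag_fls_const e) (simp only: mult_ac)
  have ec: "fls_const (e_L (int (length (x # ys)))) = fls_const (e_L 1) * fls_const (e_L ?m)"
    by (simp add: e_L_add[symmetric] add.commute)
  have zc: "zpow (a + b + 2 * ?m) = zpow a * zpow b * (zpow (2 * ?m) :: L0 fls)"
    by (simp only: zpow_add)
  have cc: "cre_prod (x # ys) = cre_prod [x] * cre_prod ys"
    by (simp add: cre_prod_def)
  have cp: "(prod_list (x # ys))\<^sup>2 = x\<^sup>2 * (prod_list ys)\<^sup>2"
    by (simp add: power_mult_distrib)
  show "mult_fld (nf [x] a) (nf ys b) =
       scale_fld (pairing x ys) (nf (x # ys) (a + b + 2 * ?m))"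
    unfolding nf1 nf_def[of ys] mult_vo(2)[OF x2 y2 g] nf_def[of "x # ys"] scale_fld_vo d zc ec cc cp
    by (simp only: list.map sum_list.Cons list.size of_nat_add of_nat_Suc of_nat_1 add.right_neutral mult_ac
        add.commute[of 1] add_Suc_right)
qed

section \<open>Dilations\<close>

definition dil :: "F \<Rightarrow> L0 fls \<Rightarrow> L0 fls" where
  "dil c f = Abs_fls (\<lambda>n. scale_L (c powi n) (f $$ n))"

lemma dilate_fld_eq: "dilate_fld c A v = dil c (A v)"
  by (simp add: dilate_fld_def dil_def)

lemma dil_nth: "dil c f $$ n = const_L (c powi n) * f $$ n"
proof -
  obtain N where "\<forall>n<N. f $$ n = 0" by (rule fls_nth_vanishes_belowE)
  then show ?thesis
    unfolding dil_def scale_L_def by (intro nth_Abs_fls_lower_bound[of N]) auto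
qed

lemma dil_add: "dil c (f + g) = dil c f + dil c g"
  by (rule fls_eqI) (simp add: dil_nth distrib_left)

lemma dil_cst_mult: "dil c (cst d * f) = cst d * dil c f"
  by (rule fls_eqI) (simp add: dil_nth cst_def mult_ac)

lemma ring_morphism_dil:
  assumes c: "c \<noteq> 0"
  shows "ring_morphism (dil c)"
proof
  show "dil c 1 = 1"
    by (rule fls_eqI) (simp add: dil_nth)
  show "dil c (f + g) = dil c f + dil c g" for f g
    by (rule dil_add)
  show "dil c (f * g) = dil c f * dil c g" for f g
  proof (rule fls_eqI)
    fix n
    obtain M where M: "\<forall>n<M. f $$ n = 0" by (rule fls_nth_vanishes_belowE)
    obtain N where N: "\<forall>n<N. g $$ n = 0" by (rule fls_nth_vanishes_belowE)
    have "dil c (f * g) $$ n = (\<Sum>i = M..n - N. const_L (c powi n) * (f $$ i * g $$ (n - i)))"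
      using M N by (simp add: dil_nth fls_times_nth_bounded[of M f N g] sum_distrib_left)
    also have "\<dots> = (\<Sum>i = M..n - N. dil c f $$ i * dil c g $$ (n - i))"
    proof (intro sum.cong refl)
      fix i
      have "c powi n = c powi i * c powi (n - i)"
        using c by (simp flip: power_int_add)
      then show "const_L (c powi n) * (f $$ i * g $$ (n - i)) = dil c f $$ i * dil c g $$ (n - i)"
        by (simp add: dil_nth const_L.mult mult_ac)
    qed
    also have "\<dots> = (dil c f * dil c g) $$ n"
      using M N by (intro fls_times_nth_bounded[symmetric]) (auto simp: dil_nth)
    finally show "dil c (f * g) $$ n = (dil c f * dil c g) $$ n" .
  qed
qed

lemma dil_zpow: "dil c (zpow k) = cst (c powi k) * zpow k"
  by (rule fls_eqI) (simp add: dil_nth zpow_nth cst_def)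

lemma dil_fls_const [simp]: "dil c (fls_const u) = fls_const u"
  by (rule fls_eqI) (simp add: dil_nth)

lemma dil_cre_exp: "dil c (fps_to_fls (cre_exp x)) = fps_to_fls (cre_exp (c * x))"
proof (rule fls_eqI)
  fix n
  show "dil c (fps_to_fls (cre_exp x)) $$ n = fps_to_fls (cre_exp (c * x)) $$ n"
  proof (cases "n < 0")
    case False
    then have "c powi n = c ^ nat n" by (simp add: power_int_def)
    then show ?thesis using False
      by (simp add: dil_nth cre_exp_def power_mult_distrib const_L.mult mult_ac)
  qed (simp add: dil_nth)
qed

lemma dil_vhom:
  assumes c: "c \<noteq> 0" and d: "d \<noteq> 0"
  shows "dil c (vhom b m d v) = vhom (\<lambda>s. b s / c ^ Suc s) m (d * c powi (2 * m)) v"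
proof -
  have d': "d * c powi (2 * m) \<noteq> 0" using c d by simp
  interpret dil: ring_morphism "dil c" by (rule ring_morphism_dil) fact
  show ?thesis
  proof (induction v rule: L0_induct)
    case (const e)
    then show ?case by (simp add: vhom_const[OF d] vhom_const[OF d']) (simp add: cst_def)
  next
    case (var s)
    have "c powi (- int (Suc s)) = 1 / c ^ Suc s"
      by (subst power_int_minus) (simp only: power_int_of_nat inverse_eq_divide)
    then show ?case
      by (simp add: vhom_var[OF d] vhom_var[OF d'] dil.add dil_cst_mult dil_zpow mult.assoc[symmetric]
          del: of_nat_Suc power_Suc flip: cst.mult)
  next
    case (e j)
    have "(d * c powi (2 * m)) powi j = d powi j * c powi (2 * m * j)"
      by (simp add: power_int_mult_distrib power_int_mult)
    then show ?case
      unfolding vhom_e[OF d] vhom_e[OF d'] by (simp add: dil.mult dil_zpow cst.mult mult_ac)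
         (simp add: cst_def mult_ac)
  next
    case (add u v)
    then show ?case
      by (simp only: ring_morphism.add[OF ring_morphism_vhom[OF d]]
          ring_morphism.add[OF ring_morphism_vhom[OF d']] dil.add)
  next
    case (mult u v)
    then show ?case
      by (simp only: ring_morphism.mult[OF ring_morphism_vhom[OF d]]
          ring_morphism.mult[OF ring_morphism_vhom[OF d']] dil.mult)
  qed
qed

lemma dilate_nf:
  assumes c: "c \<noteq> 0" and xs: "0 \<notin> set xs"
  shows "dilate_fld c (nf xs k) = scale_fld (c powi k) (nf (map ((*) c) xs) k)"
proof
  fix v
  interpret dil: ring_morphism "dil c" by (rule ring_morphism_dil) fact
  have d: "(prod_list xs)\<^sup>2 \<noteq> 0" using xs by (simp add: prod_list_zero_iff)
  have P: "dil c (cre_prod xs) = cre_prod (map ((*) c) xs)"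
    by (induction xs) (simp_all add: cre_prod_def dil.mult dil_cre_exp)
  have Q: "(prod_list (map ((*) c) xs))\<^sup>2 = (prod_list xs)\<^sup>2 * c powi (2 * int (length xs))"
  proof -
    have "prod_list (map ((*) c) xs) = prod_list xs * c ^ length xs"
      by (induction xs) simp_all
    moreover have "c powi (2 * int (length xs)) = c ^ (2 * length xs)"
      using power_int_of_nat[of c "2 * length xs"] by simp
    ultimately show ?thesis
      by (simp add: power_mult_distrib mult.commute flip: power_mult)
  qed
  have R: "(\<Sum>x\<leftarrow>map ((*) c) xs. ann_coeff s / x ^ Suc s) = (\<Sum>x\<leftarrow>xs. ann_coeff s / x ^ Suc s) / c ^ Suc s" for s
    by (induction xs) (simp_all add: add_divide_distrib power_mult_distrib mult_ac del: power_Suc)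
  show "dilate_fld c (nf xs k) v = scale_fld (c powi k) (nf (map ((*) c) xs) k) v"
    unfolding dilate_fld_eq nf_def scale_fld_vo R Q vo_def dil.mult dil_vhom[OF c d] dil_zpow P dil_fls_const length_map
    by (simp only: mult_ac)
qed

section \<open>Linearity\<close>

definition nfq :: "nat list \<Rightarrow> int \<Rightarrow> fld" where
  "nfq J k = nf (map ((^) qq) J) k"

text \<open>The domain on which products of fields are well behaved. Left factors are always
  combinations of single operators x(p^i z) with powers of z, hence the separate space
  \<open>nf1_space\<close> for them.\<close>

definition nf_space :: "fld set" where
  "nf_space = fld.span (range (\<lambda>(J, k). nfq J k))"

definition nf1_space :: "fld set" where
  "nf1_space = fld.span (range (\<lambda>(i, k). nfq [i] k))"

lemma nfq_in_nf_space [simp]: "nfq J k \<in> nf_space"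
  unfolding nf_space_def by (rule fld.span_base) auto

lemma nfq_in_nf1_space [simp]: "nfq [i] k \<in> nf1_space"
  unfolding nf1_space_def by (rule fld.span_base) auto

lemma nf1_space_subset: "nf1_space \<subseteq> nf_space"
  unfolding nf1_space_def nf_space_def by (rule fld.span_mono) auto

lemma subspace_nf_space: "fld.subspace nf_space" and subspace_nf1_space: "fld.subspace nf1_space"
  by (simp_all add: nf_space_def nf1_space_def)

lemma scale_fld_apply: "scale_fld c A v = cst c * A v"
  by (simp add: scale_fld_def cst_def)

text \<open>Elements of type \<open>fld\<close> are arbitrary functions, so linearity in the vector
  has to be recovered; it is what makes products additive in the right factor.\<close>

lemma nf_space_linear:
  assumes "A \<in> nf_space"
  shows "A (const_L c * u + v) = cst c * A u + A v"
  using assms unfolding nf_space_def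
proof (induction rule: fld.span_induct_alt)
  case base
  show ?case by (simp add: zero_fun_def)
next
  case (step d X B)
  obtain J k where X: "X = nfq J k" using step by auto
  have "(prod_list (map ((^) qq) J))\<^sup>2 \<noteq> 0"
    by (auto simp: prod_list_zero_iff)
  note m = ring_morphism_vhom[OF this]
  have "X (const_L c * u + v) = cst c * X u + X v"
    unfolding X nfq_def nf_def vo_def ring_morphism.add[OF m] ring_morphism.mult[OF m]
      vhom_const[OF \<open>(prod_list _)\<^sup>2 \<noteq> 0\<close>]
    by (simp add: algebra_simps)
  with step show ?case by (simp add: scale_fld_apply algebra_simps)
qed

lemma nf_space_0: "A \<in> nf_space \<Longrightarrow> A 0 = 0"
  using nf_space_linear[of A 0 0 0] nf_space_linear[of A 1 0 0] by simp

lemma fls_map_linear_left: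
  assumes "A 0 = 0" "B 0 = 0"
  shows "fls_map (scale_fld c A + B) f = fls_const (cst c) * fls_map A f + fls_map B f"
  by (rule fls_eqI) (use assms in \<open>simp add: scale_fld_apply\<close>)

lemma fls_map_linear_right:
  assumes "A \<in> nf_space"
  shows "fls_map A (cst c * f + g) = fls_const (cst c) * fls_map A f + fls_map A g"
proof (rule fls_eqI)
  fix n
  have "(cst c * f + g) $$ n = const_L c * f $$ n + g $$ n"
    by (simp add: cst_def)
  then show "fls_map A (cst c * f + g) $$ n = (fls_const (cst c) * fls_map A f + fls_map A g) $$ n"
    using nf_space_0[OF assms] by (simp only: fls_map_nth nf_space_linear[OF assms]) simp
qed

declare plus_fun_apply [simp del] zero_fun_apply [simp del] minus_apply [simp del]

lemma good_nf_space:
  assumes "A \<in> nf1_space" "B \<in> nf_space"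
  shows "good (fls_map A (B v))"
proof -
  \<comment> \<open>\<open>A 0 = 0\<close> is carried along since \<open>fls_map A\<close> has the
    expected coefficients only for such \<open>A\<close>.\<close>
  have "A 0 = 0 \<and> good (fls_map A (B v))"
    using assms(1) unfolding nf1_space_def
  proof (induction rule: fld.span_induct_alt)
    case base
    have "fls_map (0 :: fld) (B v) = fls_const 0"
      by (rule fls_eqI) (simp add: zero_fun_apply)
    then have "good (fls_map (0 :: fld) (B v))" by (simp only: good_fls_const)
    moreover have "(0 :: fld) 0 = 0" by (rule zero_fun_apply)
    ultimately show ?case by blast
  next
    case (step c X A)
    obtain i a where X: "X = nfq [i] a" using step by auto
    have "good (fls_map X (B v))"
      using assms(2) unfolding nf_space_def
    proof (induction rule: fld.span_induct_alt)
      case base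
      have "fls_map X ((0 :: fld) v) = fls_const 0"
        by (rule fls_eqI) (simp add: X nf_space_0 zero_fun_apply)
      then show ?case by (simp only: good_fls_const)
    next
      case (step d Y B)
      obtain J b where Y: "Y = nfq J b" using step by auto
      have "good (fls_map X (Y v))"
        unfolding X Y nfq_def list.map by (rule good_mult_nf) auto
      moreover have "fls_map X ((scale_fld d Y + B) v) = fls_const (cst d) * fls_map X (Y v) + fls_map X (B v)"
        using fls_map_linear_right[of X d "Y v" "B v"] by (simp add: X scale_fld_apply plus_fun_apply)
      ultimately show ?case
        using step by (simp add: good_add good_mult good_fls_const)
    qed
    moreover have "X 0 = 0" by (simp add: X nf_space_0)
    ultimately show ?case
      using step
      by (simp add: fls_map_linear_left good_add good_mult good_fls_const) (simp add: scale_fld_apply plus_fun_apply)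
  qed
  then show ?thesis by blast
qed

lemma mult_fld_diag: "A \<in> nf1_space \<Longrightarrow> mult_fld A B v = diag (fls_map A (B v))"
  using nf1_space_subset by (intro mult_fld_eq_diag nf_space_0) auto

lemma mult_fld_linear_left:
  assumes "A \<in> nf1_space" "A' \<in> nf1_space" "B \<in> nf_space"
  shows "mult_fld (scale_fld c A + A') B = scale_fld c (mult_fld A B) + mult_fld A' B"
proof
  fix v
  have [simp]: "A 0 = 0" "A' 0 = 0" using assms nf1_space_subset by (auto intro: nf_space_0)
  show "mult_fld (scale_fld c A + A') B v = (scale_fld c (mult_fld A B) + mult_fld A' B) v"
    using assms
    by (simp add: mult_fld_eq_diag scale_fld_apply plus_fun_apply fls_map_linear_left diag_add diag_mult good_mult
        good_fls_const diag_fls_const good_nf_space)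
qed

lemma mult_fld_linear_right:
  assumes "A \<in> nf1_space" "B \<in> nf_space" "B' \<in> nf_space"
  shows "mult_fld A (scale_fld c B + B') = scale_fld c (mult_fld A B) + mult_fld A B'"
proof
  fix v
  have A: "A \<in> nf_space" using assms nf1_space_subset by auto
  show "mult_fld A (scale_fld c B + B') v = (scale_fld c (mult_fld A B) + mult_fld A B') v"
    using assms
    by (simp add: mult_fld_diag scale_fld_apply plus_fun_apply fls_map_linear_right[OF A] diag_add diag_mult good_mult
        good_fls_const diag_fls_const good_nf_space)
qed

section \<open>Structure constants for exponents of qq\<close>

definition kappa :: "nat \<Rightarrow> nat list \<Rightarrow> F" where
  "kappa i J = pairing (qq ^ i) (map ((^) qq) J)"

lemma mult_nfq:
  "mult_fld (nfq [i] a) (nfq J b) = scale_fld (kappa i J) (nfq (i # J) (a + b + 2 * int (length J)))"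
  unfolding nfq_def kappa_def list.map by (subst mult_fld_nf) auto

lemma dilate_nfq:
  "dilate_fld (qq ^ n) (nfq J k) = scale_fld ((qq ^ n) powi k) (nfq (map ((+) n) J) k)"
  unfolding nfq_def by (subst dilate_nf) (auto simp: o_def power_add)

lemma kappa_Nil [simp]: "kappa i [] = 1"
  by (simp add: kappa_def pairing_def)

lemma kappa_Cons: "kappa i (j # J) = (qq ^ i - qq ^ j) * (qq ^ i - qq ^ j / qq) * kappa i J"
  by (simp add: kappa_def pairing_def)

text \<open>Each entry contributes a form homogeneous of degree 2 in the powers of qq, and the shift
  multiplies all of these powers by qq^n.\<close>

lemma kappa_shift: "kappa (i + n) (map ((+) n) J) = qq ^ (2 * n * length J) * kappa i J"
proof (induction J)
  case (Cons j J)
  have "(qq ^ (i + n) - qq ^ (n + j)) * (qq ^ (i + n) - qq ^ (n + j) / qq) =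
     qq ^ (2 * n) * ((qq ^ i - qq ^ j) * (qq ^ i - qq ^ j / qq))"
    by (simp add: power_add mult_2 mult_2_right field_simps)
  then show ?case
    using Cons by (simp add: kappa_Cons power_add mult_ac)
qed simp

lemma dilate_linear: "dilate_fld c (scale_fld d A + B) = scale_fld d (dilate_fld c A) + dilate_fld c B"
  by (rule ext) (simp add: dilate_fld_eq scale_fld_apply plus_fun_apply dil_add dil_cst_mult)

lemma mult_in_nf_space:
  assumes "A \<in> nf1_space" "B \<in> nf_space"
  shows "mult_fld A B \<in> nf_space"
proof -
  have 1: "mult_fld X B \<in> nf_space" if "X = nfq [i] a" for X i a
  proof -
    have "B \<in> nf_space \<and> mult_fld X B \<in> nf_space"
      using assms(2) unfolding nf_space_def
    proof (induction rule: fld.span_induct_alt)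
      case base
      have "mult_fld X 0 = 0"
        using mult_fld_linear_right[of X 0 0 0] fld.subspace_0[OF subspace_nf_space]
         mult_fld_linear_right[of X 0 0 1]
        by (simp add: that)
      then show ?case by (simp add: fld.span_zero)
    next
      case (step c Y B)
      then obtain J b where Y: "Y = nfq J b" by auto
      have "mult_fld X (scale_fld c Y + B) = scale_fld c (mult_fld X Y) + mult_fld X B"
        using step by (intro mult_fld_linear_right) (auto simp: that Y nf_space_def[symmetric])
      moreover have "mult_fld X Y \<in> nf_space"
        by (simp add: that Y mult_nfq fld.subspace_scale subspace_nf_space)
      ultimately show ?case
        using step by (auto simp: Y nf_space_def[symmetric] intro!: fld.subspace_add fld.subspace_scale subspace_nf_space)
    qed
    then show ?thesis by blast
  qed
  have "A \<in> nf1_space \<and> mult_fld A B \<in> nf_space"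
    using assms(1) unfolding nf1_space_def
  proof (induction rule: fld.span_induct_alt)
    case base
    have "0 \<in> nf1_space" by (rule fld.subspace_0[OF subspace_nf1_space])
    then have "mult_fld 0 B = 0"
      using mult_fld_linear_left[of 0 0 B 1] assms(2) by simp
    then show ?case by (simp add: fld.span_zero fld.subspace_0 subspace_nf_space)
  next
    case (step c X A)
    then obtain i a where X: "X = nfq [i] a" by auto
    have "mult_fld (scale_fld c X + A) B = scale_fld c (mult_fld X B) + mult_fld A B"
      using step assms by (intro mult_fld_linear_left) (auto simp: X nf1_space_def[symmetric])
    then show ?case
      using step 1[OF X]
      by (auto simp: X nf1_space_def[symmetric]
         intro!: fld.subspace_add fld.subspace_scale subspace_nf_space subspace_nf1_space)
  qed
  then show ?thesis by blast
qed

lemma dilate_in_nf_space: "A \<in> nf_space \<Longrightarrow> dilate_fld (qq ^ n) A \<in> nf_space"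
  unfolding nf_space_def
proof (induction rule: fld.span_induct_alt)
  case base
  have "dilate_fld (qq ^ n) 0 = 0"
    using dilate_linear[of "qq ^ n" 1 0 0] by simp
  then show ?case by (simp add: fld.span_zero)
next
  case (step c X A)
  then obtain J k where X: "X = nfq J k" by auto
  have "dilate_fld (qq ^ n) X \<in> nf_space"
    by (simp add: X dilate_nfq fld.subspace_scale subspace_nf_space)
  then show ?case
    using step by (auto simp: dilate_linear nf_space_def[symmetric]
         intro!: fld.subspace_add fld.subspace_scale subspace_nf_space)
qed

section \<open>Iterated \<open>q\<close>-differences\<close>

text \<open>\<open>Gop k f\<close> is \<open>(S - 1)(S - qq)\<dots>(S - qq\<^bsup>k-1\<^esup>) f\<close> at \<open>0\<close>, where \<open>S\<close> is the shift.\<close>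

primrec Gop :: "nat \<Rightarrow> (nat \<Rightarrow> fld) \<Rightarrow> fld" where
  "Gop 0 f = f 0"
| "Gop (Suc k) f = Gop k (\<lambda>i. f (Suc i) - scale_fld (qq ^ k) (f i))"

lemma Gop_add: "Gop k (\<lambda>i. f i + g i) = Gop k f + Gop k g"
proof (induction k arbitrary: f g)
  case (Suc k)
  have "Gop (Suc k) (\<lambda>i. f i + g i) =
      Gop k (\<lambda>i. (f (Suc i) - scale_fld (qq ^ k) (f i)) + (g (Suc i) - scale_fld (qq ^ k) (g i)))"
    by (simp add: fld.scale_right_distrib algebra_simps)
  then show ?case by (simp only: Suc Gop.simps)
qed simp

lemma Gop_scale: "Gop k (\<lambda>i. scale_fld c (f i)) = scale_fld c (Gop k f)"
proof (induction k arbitrary: f)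
  case (Suc k)
  have "Gop (Suc k) (\<lambda>i. scale_fld c (f i)) = Gop k (\<lambda>i. scale_fld c (f (Suc i) - scale_fld (qq ^ k) (f i)))"
    by (simp add: fld.scale_right_diff_distrib mult.commute)
  then show ?case by (simp only: Suc Gop.simps)
qed simp

lemma Gop_diff: "Gop k (\<lambda>i. f i - g i) = Gop k f - Gop k g"
  using Gop_add[of k "\<lambda>i. f i - g i" g] by (simp add: eq_diff_eq)

lemma Gop_zero: "Gop k (\<lambda>i. 0) = 0"
  by (induction k) simp_all

lemma Gop_swap: "Gop k (\<lambda>i. Gop l (\<lambda>j. f i j)) = Gop l (\<lambda>j. Gop k (\<lambda>i. f i j))"
proof (induction k arbitrary: f)
  case (Suc k)
  have "Gop (Suc k) (\<lambda>i. Gop l (f i)) = Gop k (\<lambda>i. Gop l (\<lambda>j. f (Suc i) j - scale_fld (qq ^ k) (f i j)))"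
    by (simp add: Gop_diff Gop_scale)
  then show ?case by (simp only: Suc Gop.simps)
qed simp

lemma Gop_in_subspace:
  assumes "fld.subspace V" "\<And>i. i \<le> k \<Longrightarrow> f i \<in> V"
  shows "Gop k f \<in> V"
  using assms(2)
proof (induction k arbitrary: f)
  case (Suc k)
  show ?case
    unfolding Gop.simps
    by (rule Suc.IH) (auto intro!: fld.subspace_diff fld.subspace_scale assms(1) Suc.prems)
qed simp

lemma Gop_linear_map:
  assumes V: "fld.subspace V" and L: "\<And>c A B. A \<in> V \<Longrightarrow> B \<in> V \<Longrightarrow> L (scale_fld c A + B) = scale_fld c (L A) + L B"
    and f: "\<And>i. f i \<in> V"
  shows "L (Gop k f) = Gop k (\<lambda>i. L (f i))"
  using f
proof (induction k arbitrary: f)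
  case (Suc k)
  have "L (A - scale_fld c B) = L A - scale_fld c (L B)" if "A \<in> V" "B \<in> V" for A B c
    using L[OF that(2,1), of "- c"] by simp
  moreover have "L (Gop k (\<lambda>i. f (Suc i) - scale_fld (qq ^ k) (f i))) =
     Gop k (\<lambda>i. L (f (Suc i) - scale_fld (qq ^ k) (f i)))"
    by (rule Suc.IH) (auto intro!: fld.subspace_diff fld.subspace_scale V Suc.prems)
  ultimately show ?case using Suc.prems by simp
qed simp

text \<open>Factoring out \<open>S - 1\<close> instead of \<open>S - qq\<^bsup>k\<^esup>\<close>.\<close>

lemma Gop_Suc':
  "Gop (Suc k) f = scale_fld (qq ^ k) (Gop k (\<lambda>i. scale_fld (inverse qq ^ i) (f (Suc i) - f i)))"
proof (induction k arbitrary: f)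
  case (Suc k)
  have "Gop (Suc (Suc k)) f = Gop (Suc k) (\<lambda>i. f (Suc i) - scale_fld (qq ^ Suc k) (f i))"
    by (rule Gop.simps)
  also have "\<dots> = scale_fld (qq ^ k) (Gop k (\<lambda>i. scale_fld (inverse qq ^ i)
     (f (Suc (Suc i)) - scale_fld (qq ^ Suc k) (f (Suc i)) - (f (Suc i) - scale_fld (qq ^ Suc k) (f i)))))"
    by (rule Suc)
  also have "\<dots> = scale_fld (qq ^ Suc k) (Gop (Suc k) (\<lambda>i. scale_fld (inverse qq ^ i) (f (Suc i) - f i)))"
    unfolding Gop.simps Gop_scale[symmetric]
  proof -
    have [simp]: "qq * (inverse qq * x) = x" for x
      by (simp flip: mult.assoc)
    show "Gop k (\<lambda>i. scale_fld (qq ^ k) (scale_fld (inverse qq ^ i)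
       (f (Suc (Suc i)) - scale_fld (qq ^ Suc k) (f (Suc i)) - (f (Suc i) - scale_fld (qq ^ Suc k) (f i))))) =
      Gop k (\<lambda>i. scale_fld (qq ^ Suc k) (scale_fld (inverse qq ^ Suc i) (f (Suc (Suc i)) - f (Suc i)) -
         scale_fld (qq ^ k) (scale_fld (inverse qq ^ i) (f (Suc i) - f i))))"
    by (intro arg_cong[where f = "Gop k"] ext)
      (simp add: fld.scale_right_diff_distrib algebra_simps)
  qed
  finally show ?case .
qed simp

text \<open>Gaussian binomial coefficients in base qq, given by Pascal's rule.\<close>

fun gbin :: "nat \<Rightarrow> nat \<Rightarrow> F" where
  "gbin M 0 = 1"
| "gbin 0 (Suc k) = 0"
| "gbin (Suc M) (Suc k) = gbin M k + qq ^ Suc k * gbin M (Suc k)"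

lemma gbin_eq_0: "M < k \<Longrightarrow> gbin M k = 0"
  by (induction M k rule: gbin.induct) auto

text \<open>A term of the q-Leibniz rule: order \<open>k\<close> in the first index, order
  \<open>l\<close> in the second index displaced by \<open>k\<close>. The displacement is the
  argument z qq^k that the right factor has in x(z)_(-k-1) b(z).\<close>

definition Top :: "nat \<Rightarrow> nat \<Rightarrow> (nat \<Rightarrow> nat \<Rightarrow> fld) \<Rightarrow> fld" where
  "Top k l h = Gop k (\<lambda>i. Gop l (\<lambda>j. h i (j + k)))"

text \<open>With S and S' the shifts of the two indices, S S' - qq^(k+l) = (S - qq^k) S' + qq^k (S'
  - qq^l). Applied to the terms with k + l = M, this reproduces the recursion of
  \<open>gbin\<close>.\<close>

lemma Top_leibniz: "(\<Sum>k\<le>M. scale_fld (gbin M k) (Top k (M - k) h)) = Gop M (\<lambda>s. h s s)"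
proof (induction M arbitrary: h)
  case 0
  show ?case by (simp add: Top_def)
next
  case (Suc M)
  let ?h = "\<lambda>i j. h (Suc i) (Suc j) - scale_fld (qq ^ M) (h i j)"
  have step: "Top k l ?h = Top (Suc k) l h + scale_fld (qq ^ k) (Top k (Suc l) h)" if "k + l = M" for k l
  proof -
    have "Top (Suc k) l h + scale_fld (qq ^ k) (Top k (Suc l) h) =
       Gop k (\<lambda>i. Gop l (\<lambda>j. (h (Suc i) (j + Suc k) - scale_fld (qq ^ k) (h i (j + Suc k))) +
          scale_fld (qq ^ k) (h i (Suc j + k) - scale_fld (qq ^ l) (h i (j + k)))))"
      by (simp only: Top_def Gop.simps Gop_add Gop_diff Gop_scale)
    also have "\<dots> = Top k l ?h"
      unfolding Top_def
      by (intro arg_cong[where f = "Gop _"] ext)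
         (simp add: fld.scale_right_diff_distrib flip: power_add that)
    finally show ?thesis ..
  qed
  have "Gop (Suc M) (\<lambda>s. h s s) = (\<Sum>k\<le>M. scale_fld (gbin M k) (Top k (M - k) ?h))"
    unfolding Suc by simp
  also have "\<dots> = (\<Sum>k\<le>M. scale_fld (gbin M k) (Top (Suc k) (M - k) h) +
        scale_fld (qq ^ k * gbin M k) (Top k (Suc M - k) h))"
    by (intro sum.cong refl) (simp add: step fld.scale_right_distrib Suc_diff_le mult.commute)
  also have "\<dots> = (\<Sum>k\<le>M. scale_fld (gbin M k) (Top (Suc k) (M - k) h)) +
        (\<Sum>k\<le>Suc M. scale_fld (qq ^ k * gbin M k) (Top k (Suc M - k) h))"
    by (simp add: sum.distrib gbin_eq_0)
  also have "\<dots> = Top 0 (Suc M) h + (\<Sum>k\<le>M. scale_fld (gbin M k) (Top (Suc k) (M - k) h) +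
       scale_fld (qq ^ Suc k * gbin M (Suc k)) (Top (Suc k) (M - k) h))"
    by (subst sum.atMost_Suc_shift) (simp add: sum.distrib)
  also have "\<dots> = (\<Sum>k\<le>Suc M. scale_fld (gbin (Suc M) k) (Top k (Suc M - k) h))"
    by (subst sum.atMost_Suc_shift) (simp add: fld.scale_left_distrib)
  finally show ?case ..
qed

text \<open>Factoring S - 1 out of the first index leaves a family \<open>?h\<close> whose diagonal
  involves \<open>h\<close> only at (s+1, s+1) and (s, s+1), where it is zero. The Leibniz rule for
  \<open>?h\<close> is thus a relation among terms of positive order on the left.\<close>

lemma Top_leibniz':
  assumes "\<And>s. h s s = 0" "\<And>s. h s (Suc s) = 0"
  shows "(\<Sum>k\<le>M. scale_fld (gbin M k * inverse qq ^ k) (Top (Suc k) (M - k) h)) = 0"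
proof -
  let ?h = "\<lambda>i j. scale_fld (inverse qq ^ i) (h (Suc i) (Suc j) - h i (Suc j))"
  have "Top (Suc k) l h = scale_fld (qq ^ k) (Top k l ?h)" for k l
    unfolding Top_def Gop_Suc' by (simp add: Gop_diff Gop_scale)
  then have "scale_fld (gbin M k * inverse qq ^ k) (Top (Suc k) (M - k) h) =
      scale_fld (gbin M k) (Top k (M - k) ?h)" for k
    by (simp add: mult.assoc flip: power_mult_distrib)
  then show ?thesis
    using Top_leibniz[of M ?h] by (simp add: assms Gop_zero)
qed

section \<open>The operators \<open>x(z)\<^sub>l\<close>\<close>

lemma shift_nfq: "fls_shift 1 (nfq J k v) = nfq J (k - 1) v"
  using zpow_add[of "- 1" k, where ?'a = L0]
  by (simp add: nfq_def nf_def vo_def mult.assoc zpow_mult[symmetric, of "-1", simplified] flip: zpow_mult)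

lemma q_deriv_linear: "q_deriv (scale_fld c A + B) = scale_fld c (q_deriv A) + q_deriv B"
proof
  fix v
  have s: "fls_shift 1 (cst c * f) = cst c * fls_shift 1 f" for f :: "L0 fls"
    by (rule fls_eqI) (simp add: cst_def)
  show "q_deriv (scale_fld c A + B) v = (scale_fld c (q_deriv A) + q_deriv B) v"
    unfolding q_deriv_def dilate_linear scale_fld_apply plus_fun_apply fls_shift_minus fls_shift_plus s
    by (simp only: algebra_simps)
qed

lemma q_deriv_nfq:
  "q_deriv (nfq [i] k) = scale_fld (1 / (qq - 1)) (scale_fld (qq powi k) (nfq [Suc i] (k - 1)) - nfq [i] (k - 1))"
proof
  fix v
  have s: "fls_shift 1 (cst c * f) = cst c * fls_shift 1 f" for c and f :: "L0 fls"
    by (rule fls_eqI) (simp add: cst_def)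
  show "q_deriv (nfq [i] k) v =
    scale_fld (1 / (qq - 1)) (scale_fld (qq powi k) (nfq [Suc i] (k - 1)) - nfq [i] (k - 1)) v"
    using dilate_nfq[of 1 "[i]" k]
    by (simp add: q_deriv_def scale_fld_apply minus_apply s shift_nfq)
qed

primrec dw :: "nat \<Rightarrow> F" where
  "dw 0 = 1"
| "dw (Suc n) = dw n / ((qq - 1) * qq ^ n)"

lemma qq_minus_1: "qq - 1 \<noteq> 0"
  using qq_power_eq_1_iff[of 1] by simp

lemma dw_nonzero: "dw n \<noteq> 0"
  using qq_minus_1 by (induction n) auto

text \<open>Dilating z^(-n) by qq yields qq^(-n); extracting it from the difference leaves S - qq^n,
  the next factor of \<open>Gop\<close>, and accounts for the denominators of
  \<open>dw\<close>.\<close>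

lemma q_deriv_frenkel_jing:
  "(q_deriv ^^ n) frenkel_jing = scale_fld (dw n) (Gop n (\<lambda>i. nfq [i] (- int n)))"
proof (induction n)
  case 0
  show ?case by (simp add: frenkel_jing_nf nfq_def)
next
  case (Suc n)
  let ?f = "\<lambda>i. nfq [i] (- int (Suc n))"
  have scale: "q_deriv (scale_fld c A) = scale_fld c (q_deriv A)" for c A
    using q_deriv_linear[of c A 0] q_deriv_linear[of 1 0 0] by simp
  have "(q_deriv ^^ Suc n) frenkel_jing = scale_fld (dw n) (Gop n (\<lambda>i. q_deriv (nfq [i] (- int n))))"
    unfolding funpow.simps o_apply Suc scale
    by (subst Gop_linear_map[where V = UNIV and L = q_deriv]) (simp_all add: q_deriv_linear)
  also have "\<dots> = scale_fld (dw n) (Gop n (\<lambda>i. scale_fld (1 / ((qq - 1) * qq ^ n)) (?f (Suc i) - scale_fld (qq ^ n) (?f i))))"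
  proof -
    have "- int n - 1 = - int (Suc n)" "1 / (qq - 1) * qq powi (- int n) = 1 / ((qq - 1) * qq ^ n)"
      by (simp_all add: power_int_minus field_simps)
    moreover have "1 / (qq - 1) = 1 / ((qq - 1) * qq ^ n) * qq ^ n"
      by simp
    ultimately show ?thesis
      unfolding q_deriv_nfq fld.scale_right_diff_distrib fld.scale_scale by (simp only:)
  qed
  also have "\<dots> = scale_fld (dw (Suc n)) (Gop (Suc n) ?f)"
    by (simp add: Gop_scale)
  finally show ?case .
qed

lemma qqfact_nonzero: "qqfact n \<noteq> 0"
  using qq_minus_1 by (auto simp: qqfact_def qqnum_def qq_power_eq_1_iff)

definition wt :: "nat \<Rightarrow> F" where
  "wt n = dw n / qqfact n"

lemma wt_nonzero: "wt n \<noteq> 0"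
  by (simp add: wt_def dw_nonzero qqfact_nonzero)

definition xp :: "nat \<Rightarrow> fld \<Rightarrow> fld" where
  "xp n = x_prod (- 1 - int n)"

definition xfld :: "nat \<Rightarrow> fld" where
  "xfld n = Gop n (\<lambda>i. nfq [i] (- int n))"

lemma xfld_in [simp]: "xfld n \<in> nf1_space"
  unfolding xfld_def by (intro Gop_in_subspace subspace_nf1_space nfq_in_nf1_space)

lemma xp_eq:
  assumes "B \<in> nf_space"
  shows "xp n B = scale_fld (wt n) (mult_fld (xfld n) (dilate_fld (qq ^ n) B))"
proof -
  have "mult_fld (scale_fld c (xfld n)) C = scale_fld c (mult_fld (xfld n) C)" if "C \<in> nf_space" for c C
    using mult_fld_linear_left[of "xfld n" 0 C c] mult_fld_linear_left[of 0 0 C 1] that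
    by (simp add: fld.subspace_0 subspace_nf1_space)
  then show ?thesis
    using dilate_in_nf_space[OF assms, of n]
    by (simp add: xp_def x_prod_def q_deriv_frenkel_jing wt_def xfld_def field_simps)
qed

lemma xp_in_nf_space:
  assumes "B \<in> nf_space"
  shows "xp n B \<in> nf_space"
  unfolding xp_eq[OF assms]
  by (intro fld.subspace_scale subspace_nf_space mult_in_nf_space dilate_in_nf_space assms xfld_in)

lemma xp_linear:
  assumes "A \<in> nf_space" "B \<in> nf_space"
  shows "xp n (scale_fld c A + B) = scale_fld c (xp n A) + xp n B"
proof -
  have "scale_fld c A + B \<in> nf_space"
    using assms by (intro fld.subspace_add fld.subspace_scale subspace_nf_space)
  then show ?thesis
    using assms
    by (simp add: xp_eq dilate_linear mult_fld_linear_right dilate_in_nf_space fld.scale_right_distrib mult.commute)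
qed

lemma xp_zero [simp]: "xp n 0 = 0"
  using xp_linear[of 0 0 n 1] fld.subspace_0[OF subspace_nf_space] by simp

lemma xp_scale: "A \<in> nf_space \<Longrightarrow> xp n (scale_fld c A) = scale_fld c (xp n A)"
  using xp_linear[of A 0 n c] fld.subspace_0[OF subspace_nf_space] by simp

lemma xp_nfq:
  "xp n (nfq J k) = scale_fld (wt n * (qq ^ n) powi k)
     (Gop n (\<lambda>i. scale_fld (kappa i (map ((+) n) J)) (nfq (i # map ((+) n) J) (k - int n + 2 * int (length J)))))"
proof -
  let ?J = "map ((+) n) J"
  have r: "mult_fld A (scale_fld c (nfq ?J k)) = scale_fld c (mult_fld A (nfq ?J k))" if "A \<in> nf1_space" for A c
    using mult_fld_linear_right[of A "nfq ?J k" 0 c] mult_fld_linear_right[of A 0 0 1] that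
    by (simp add: fld.subspace_0 subspace_nf_space)
  have "mult_fld (xfld n) (nfq ?J k) = Gop n (\<lambda>i. mult_fld (nfq [i] (- int n)) (nfq ?J k))"
    unfolding xfld_def
    by (rule Gop_linear_map[where V = nf1_space and L = "\<lambda>A. mult_fld A (nfq ?J k)", OF subspace_nf1_space])
       (auto intro: mult_fld_linear_left)
  then show ?thesis
    by (simp add: xp_eq dilate_nfq r mult_nfq algebra_simps)
qed

section \<open>Relations between two successive operators\<close>

lemma xp_Gop:
  assumes "\<And>i. f i \<in> nf_space"
  shows "xp n (Gop k f) = Gop k (\<lambda>i. xp n (f i))"
  using subspace_nf_space xp_linear assms by (rule Gop_linear_map)

text \<open>The outer operator dilates by qq^k the power z^(-l) left by the inner derivative; hence
  the division by \<open>qq ^ (k * l)\<close>.\<close>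

definition pair_wt :: "nat \<Rightarrow> nat \<Rightarrow> F" where
  "pair_wt k l = wt k * wt l / qq ^ (k * l)"

lemma pair_wt_nonzero: "pair_wt k l \<noteq> 0"
  by (simp add: pair_wt_def wt_nonzero)

text \<open>Here \<open>i\<close> and \<open>j\<close> are the final exponents of the two new
  factors, \<open>j\<close> already including the outer dilation, and the old exponents are shifted
  by M. In the application M = k + l, so one family serves all terms of a Leibniz sum.\<close>

definition pair_nf :: "nat \<Rightarrow> nat list \<Rightarrow> int \<Rightarrow> nat \<Rightarrow> nat \<Rightarrow> fld" where
  "pair_nf M J b i j = scale_fld ((qq ^ M) powi b * kappa j (map ((+) M) J) * kappa i (j # map ((+) M) J))
     (nfq (i # j # map ((+) M) J) (b - int M + 4 * int (length J) + 2))"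

lemma pair_nf_zero: "pair_nf M J b s s = 0" "pair_nf M J b s (Suc s) = 0"
  by (simp_all add: pair_nf_def kappa_Cons)

lemma xp_xp_nfq: "xp k (xp l (nfq J b)) = scale_fld (pair_wt k l) (Top k l (pair_nf (k + l) J b))"
proof -
  let ?m = "int (length J)" and ?J = "map ((+) (k + l)) J"
  let ?b = "b - int l + 2 * ?m"
  have mm: "map ((+) k) (map ((+) l) J) = ?J"
    by (simp add: add.assoc)
  have inner: "xp k (scale_fld (kappa j (map ((+) l) J)) (nfq (j # map ((+) l) J) ?b)) =
     Gop k (\<lambda>i. scale_fld (wt k / qq ^ (k * l) / (qq ^ l) powi b) (pair_nf (k + l) J b i (j + k)))" for j
  proof -
    have p: "(qq ^ k) powi ?b = (qq ^ k) powi b / qq ^ (k * l) * qq ^ (2 * k * length J)"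
    proof -
      have "(qq ^ k) powi ?b = (qq ^ k) powi b / (qq ^ k) powi int l * (qq ^ k) powi (int (2 * length J))"
        by (simp add: power_int_add power_int_diff)
      then show ?thesis
        unfolding power_int_of_nat by (simp add: mult_ac flip: power_mult)
    qed
    \<comment> \<open>Homogeneity of \<open>kappa\<close> absorbs the factor
      \<open>qq ^ (2 * k * length J)\<close> that \<open>p\<close> produces.\<close>
    have s: "kappa (j + k) ?J = qq ^ (2 * k * length J) * kappa j (map ((+) l) J)"
      using kappa_shift[of j k "map ((+) l) J"] unfolding mm by simp
    have "xp k (scale_fld (kappa j (map ((+) l) J)) (nfq (j # map ((+) l) J) ?b)) =
       scale_fld (kappa j (map ((+) l) J)) (xp k (nfq (j # map ((+) l) J) ?b))"
      by (simp add: xp_scale)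
    also have "\<dots> = Gop k (\<lambda>i. scale_fld (kappa j (map ((+) l) J) * (wt k * (qq ^ k) powi ?b) *
         kappa i ((j + k) # ?J)) (nfq (i # (j + k) # ?J) (?b - int k + 2 * (?m + 1))))"
      unfolding xp_nfq by (simp add: Gop_scale[symmetric] mm add.commute add.assoc mult.assoc del: map_map)
    also have "\<dots> = Gop k (\<lambda>i. scale_fld (wt k / qq ^ (k * l) / (qq ^ l) powi b) (pair_nf (k + l) J b i (j + k)))"
    proof (rule arg_cong[where f = "Gop k"], rule ext)
      fix i
      have e: "?b - int k + 2 * (?m + 1) = b - int (k + l) + 4 * ?m + 2"
        by simp
      have pb: "(qq ^ (k + l)) powi b = (qq ^ k) powi b * (qq ^ l) powi b"
        by (simp add: power_add power_int_mult_distrib)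
      show "scale_fld (kappa j (map ((+) l) J) * (wt k * (qq ^ k) powi ?b) * kappa i ((j + k) # ?J))
          (nfq (i # (j + k) # ?J) (?b - int k + 2 * (?m + 1))) =
        scale_fld (wt k / qq ^ (k * l) / (qq ^ l) powi b) (pair_nf (k + l) J b i (j + k))"
        unfolding e pair_nf_def p s pb fld.scale_scale by (simp add: field_simps)
    qed
    finally show ?thesis .
  qed
  have "xp k (xp l (nfq J b)) = scale_fld (wt l * (qq ^ l) powi b)
      (xp k (Gop l (\<lambda>j. scale_fld (kappa j (map ((+) l) J)) (nfq (j # map ((+) l) J) ?b))))"
    unfolding xp_nfq[of l]
    by (intro xp_scale Gop_in_subspace subspace_nf_space fld.subspace_scale nfq_in_nf_space)
  also have "\<dots> = scale_fld (wt l * (qq ^ l) powi b)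
      (Gop l (\<lambda>j. Gop k (\<lambda>i. scale_fld (wt k / qq ^ (k * l) / (qq ^ l) powi b) (pair_nf (k + l) J b i (j + k)))))"
    by (subst xp_Gop) (simp_all add: inner fld.subspace_scale subspace_nf_space)
  also have "\<dots> = scale_fld (pair_wt k l) (Gop l (\<lambda>j. Gop k (\<lambda>i. pair_nf (k + l) J b i (j + k))))"
    unfolding Gop_scale by (simp add: pair_wt_def field_simps)
  also have "\<dots> = scale_fld (pair_wt k l) (Top k l (pair_nf (k + l) J b))"
    unfolding Top_def by (subst Gop_swap) (rule refl)
  finally show ?thesis .
qed

lemma xp_relation_span:
  assumes c: "c \<in> nf_space"
    and rel: "\<And>J b. (\<Sum>k\<in>K. scale_fld (a k) (xp (s k) (xp (t k) (nfq J b)))) = 0"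
  shows "(\<Sum>k\<in>K. scale_fld (a k) (xp (s k) (xp (t k) c))) = 0"
proof -
  have "c \<in> nf_space \<and> (\<Sum>k\<in>K. scale_fld (a k) (xp (s k) (xp (t k) c))) = 0"
    using c unfolding nf_space_def
  proof (induction rule: fld.span_induct_alt)
    case base
    show ?case by (simp add: fld.span_zero)
  next
    case (step d X B)
    then obtain J b where X: "X = nfq J b" by auto
    have B: "B \<in> nf_space" using step by (simp add: nf_space_def)
    have "scale_fld (a k) (xp (s k) (xp (t k) (scale_fld d X + B))) =
        scale_fld d (scale_fld (a k) (xp (s k) (xp (t k) X))) + scale_fld (a k) (xp (s k) (xp (t k) B))" for k
      using B by (simp add: X xp_linear xp_in_nf_space fld.scale_right_distrib mult.commute)
    then have "(\<Sum>k\<in>K. scale_fld (a k) (xp (s k) (xp (t k) (scale_fld d X + B)))) =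
        scale_fld d (\<Sum>k\<in>K. scale_fld (a k) (xp (s k) (xp (t k) X))) + (\<Sum>k\<in>K. scale_fld (a k) (xp (s k) (xp (t k) B)))"
      by (simp only: sum.distrib fld.scale_sum_right)
    then have "(\<Sum>k\<in>K. scale_fld (a k) (xp (s k) (xp (t k) (scale_fld d X + B)))) = 0"
      using step by (simp add: X rel)
    moreover have "scale_fld d X + B \<in> nf_space"
      using B by (simp add: X fld.subspace_add fld.subspace_scale subspace_nf_space)
    ultimately show ?case by (simp add: nf_space_def)
  qed
  then show ?thesis by blast
qed

lemma in_span_of_relation:
  fixes M :: nat
  assumes "(\<Sum>k\<le>M. scale_fld (a k) (V k)) = 0" "a 0 \<noteq> 0"
  shows "V 0 \<in> fld.span (V ` {1..M})"
proof -
  have "(\<Sum>k\<le>M. scale_fld (a k) (V k)) = scale_fld (a 0) (V 0) + (\<Sum>k = 1..M. scale_fld (a k) (V k))"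
  proof -
    have "{..M} = insert 0 {1..M}" by auto
    then show ?thesis by simp
  qed
  then have "scale_fld (a 0) (V 0) = - (\<Sum>k = 1..M. scale_fld (a k) (V k))"
    using assms(1) by (simp add: eq_neg_iff_add_eq_0)
  then have "scale_fld (a 0) (V 0) \<in> fld.span (V ` {1..M})"
    by (simp only:) (intro fld.span_neg fld.span_sum fld.span_scale, rule fld.span_base, rule imageI)
  then have "scale_fld (inverse (a 0)) (scale_fld (a 0) (V 0)) \<in> fld.span (V ` {1..M})"
    by (rule fld.span_scale)
  then show ?thesis using assms(2) by simp
qed

text \<open>By the zero at j = i the Leibniz sum for total order M is zero; its term k = 0 is this
  product, with invertible coefficient because \<open>gbin M 0 = 1\<close>.\<close>

lemma xp_0_straighten:
  assumes c: "c \<in> nf_space"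
  shows "xp 0 (xp M c) \<in> fld.span ((\<lambda>k. xp k (xp (M - k) c)) ` {1..M})"
proof -
  have "(\<Sum>k\<le>M. scale_fld (gbin M k / pair_wt k (M - k)) (xp k (xp (M - k) (nfq J b)))) =
      (\<Sum>k\<le>M. scale_fld (gbin M k) (Top k (M - k) (pair_nf M J b)))" for J b
    by (intro sum.cong refl) (simp add: xp_xp_nfq pair_wt_nonzero)
  then have "(\<Sum>k\<le>M. scale_fld (gbin M k / pair_wt k (M - k)) (xp k (xp (M - k) c))) = 0"
    by (intro xp_relation_span[OF c]) (simp add: Top_leibniz pair_nf_zero Gop_zero)
  from in_span_of_relation[OF this] show ?thesis by (simp add: pair_wt_nonzero)
qed

text \<open>Now both zeros j = i and j = i + 1 enter. The total order is \<open>Suc M\<close>, and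
  the relation begins with order 1 on the left.\<close>

lemma xp_1_straighten:
  assumes c: "c \<in> nf_space"
  shows "xp 1 (xp M c) \<in> fld.span ((\<lambda>k. xp (Suc k) (xp (M - k) c)) ` {1..M})"
proof -
  let ?a = "\<lambda>k. gbin M k * inverse qq ^ k / pair_wt (Suc k) (M - k)"
  have "(\<Sum>k\<le>M. scale_fld (?a k) (xp (Suc k) (xp (M - k) (nfq J b)))) =
      (\<Sum>k\<le>M. scale_fld (gbin M k * inverse qq ^ k) (Top (Suc k) (M - k) (pair_nf (Suc M) J b)))" for J b
    by (intro sum.cong refl) (simp add: xp_xp_nfq pair_wt_nonzero)
  then have "(\<Sum>k\<le>M. scale_fld (?a k) (xp (Suc k) (xp (M - k) c))) = 0"
    by (intro xp_relation_span[OF c]) (simp add: Top_leibniz' pair_nf_zero)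
  from in_span_of_relation[OF this] show ?thesis by (simp add: pair_wt_nonzero)
qed

section \<open>Straightening\<close>

text \<open>The head of the list is the outermost operator, so the list runs from l_m down to l_1,
  each l replaced by the order -l - 1.\<close>

definition mon :: "nat list \<Rightarrow> fld" where
  "mon ns = foldr xp ns one_fld"

lemma mon_Nil: "mon [] = one_fld" and mon_Cons: "mon (n # ns) = xp n (mon ns)"
  by (simp_all add: mon_def)

lemma mon_in_nf_space: "mon ns \<in> nf_space"
proof (induction ns)
  case Nil
  have eq: "one_fld = nfq [] 0" by (simp add: one_fld_nf nfq_def)
  show ?case unfolding mon_Nil eq by (rule nfq_in_nf_space)
qed (simp add: mon_Cons xp_in_nf_space)

lemma xp_span:
  assumes "A \<in> fld.span X" "X \<subseteq> nf_space"
  shows "xp n A \<in> fld.span (xp n ` X)"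
proof -
  have "A \<in> nf_space \<and> xp n A \<in> fld.span (xp n ` X)"
    using assms(1)
  proof (induction rule: fld.span_induct_alt)
    case base
    show ?case by (simp add: fld.span_zero fld.subspace_0 subspace_nf_space)
  next
    case (step c x y)
    then have "x \<in> nf_space" using assms(2) by auto
    then show ?case
      using step
      by (auto simp: xp_linear intro: fld.span_add[OF fld.span_scale[OF fld.span_base]]
          fld.subspace_add[OF subspace_nf_space fld.subspace_scale[OF subspace_nf_space]])
  qed
  then show ?thesis by blast
qed

lemma foldr_xp_span:
  assumes "A \<in> fld.span X" "X \<subseteq> nf_space"
  shows "foldr xp ns A \<in> fld.span (foldr xp ns ` X)"
proof (induction ns)
  case Nil
  show ?case using assms by (simp add: id_def)
next
  case (Cons n ns)
  have "foldr xp ns ` X \<subseteq> nf_space"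
  proof -
    have "foldr xp ns x \<in> nf_space" if "x \<in> nf_space" for x
      by (induction ns) (simp_all add: that xp_in_nf_space)
    then show ?thesis using assms(2) by auto
  qed
  then have "xp n (foldr xp ns A) \<in> fld.span (xp n ` foldr xp ns ` X)"
    using Cons by (intro xp_span)
  then show ?case by (simp add: image_image)
qed

text \<open>\<open>butlast\<close> exempts the order belonging to l_1; order at least 2 means l <=
  -3.\<close>

definition admissible :: "nat list \<Rightarrow> bool" where
  "admissible ns \<longleftrightarrow> (\<forall>n\<in>set (butlast ns). 2 \<le> n)"

text \<open>Termination measure for straightening: each order is weighted by the number of factors
  to its right. Moving k units of order one place to the left raises the weight by k, while length
  and total order, which bound it, stay fixed.\<close>

primrec pos_weight :: "nat list \<Rightarrow> nat" where
  "pos_weight [] = 0"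
| "pos_weight (n # ns) = n * length ns + pos_weight ns"

lemma pos_weight_le: "pos_weight ns \<le> sum_list ns * length ns"
proof (induction ns)
  case (Cons n ns)
  have "sum_list ns * length ns \<le> sum_list ns * Suc (length ns)" by simp
  then show ?case using Cons by (simp add: add_mult_distrib)
qed simp

lemma pos_weight_append:
  "length xs = length ys \<Longrightarrow> pos_weight (pre @ xs) + pos_weight ys = pos_weight (pre @ ys) + pos_weight xs"
  by (induction pre) auto

lemma mon_straighten_step:
  assumes "a < 2"
  shows "mon (pre @ a # b # post) \<in>
    fld.span ((\<lambda>k. mon (pre @ (a + k) # (b - k) # post)) ` {1..b})"
proof -
  let ?X = "(\<lambda>k. xp (a + k) (xp (b - k) (mon post))) ` {1..b}"
  have "a = 0 \<or> a = 1" using assms by auto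
  then have "xp a (xp b (mon post)) \<in> fld.span ?X"
    using xp_0_straighten[OF mon_in_nf_space, of b post] xp_1_straighten[OF mon_in_nf_space, of b post]
    by auto
  moreover have "?X \<subseteq> nf_space"
    by (auto intro!: xp_in_nf_space mon_in_nf_space)
  ultimately have "foldr xp pre (xp a (xp b (mon post))) \<in> fld.span (foldr xp pre ` ?X)"
    by (rule foldr_xp_span)
  then show ?thesis
    by (simp add: mon_def image_image)
qed

lemma mon_straighten: "mon ns \<in> fld.span (mon ` Collect admissible)"
proof (induction "sum_list ns * length ns - pos_weight ns" arbitrary: ns rule: less_induct)
  case less
  show ?case
  proof (cases "admissible ns")
    case True
    then show ?thesis by (auto intro: fld.span_base)
  next
    case False
    then obtain a where a: "a \<in> set (butlast ns)" "a < 2"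
      by (auto simp: admissible_def not_le)
    then obtain pre post' where "butlast ns = pre @ a # post'"
      by (meson split_list)
    moreover have "ns = butlast ns @ [last ns]"
      using a by (cases ns) auto
    ultimately obtain b post where ns: "ns = pre @ a # b # post"
      by (metis append.assoc append_Cons append_Nil neq_Nil_conv)
    have "mon (pre @ (a + k) # (b - k) # post) \<in> fld.span (mon ` Collect admissible)" if k: "k \<in> {1..b}" for k
    proof (rule less.hyps)
      let ?ns = "pre @ (a + k) # (b - k) # post"
      have s: "sum_list ?ns = sum_list ns" "length ?ns = length ns"
        using k by (simp_all add: ns)
      have "pos_weight ((a + k) # (b - k) # post) = pos_weight (a # b # post) + k"
      proof -
        obtain d where "b = d + k" using k by (metis atLeastAtMost_iff le_add_diff_inverse2)
        then show ?thesis by (simp add: algebra_simps)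
      qed
      then have "pos_weight ?ns = pos_weight ns + k"
        using pos_weight_append[of "(a + k) # (b - k) # post" "a # b # post" pre]
        unfolding ns by (simp del: pos_weight.simps)
      then have "pos_weight ns < pos_weight ?ns" using k by simp
      then show "sum_list ?ns * length ?ns - pos_weight ?ns < sum_list ns * length ns - pos_weight ns"
        using pos_weight_le[of ?ns] unfolding s by linarith
    qed
    then have "(\<lambda>k. mon (pre @ (a + k) # (b - k) # post)) ` {1..b} \<subseteq> fld.span (mon ` Collect admissible)"
      by auto
    from fld.span_minimal[OF this fld.subspace_span] show ?thesis
      using mon_straighten_step[OF a(2), of pre b post] unfolding ns by auto
  qed
qed

section \<open>Translation to the sets of the theorem, and spanning\<close>

lemma x_monomial_mon:
  assumes "\<forall>j\<in>{1..m}. l j \<le> -1"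
  shows "x_monomial l m = mon (map (\<lambda>j. nat (- 1 - l j)) (rev [1..<Suc m]))"
  using assms
proof (induction m)
  case (Suc m)
  then have "- 1 - int (nat (- 1 - l (Suc m))) = l (Suc m)" by simp
  then show ?case using Suc by (simp add: mon_Cons xp_def)
qed (simp add: mon_Nil)

lemma x_monomial_cong:
  "(\<And>j. j \<in> {1..m} \<Longrightarrow> l j = l' j) \<Longrightarrow> x_monomial l m = x_monomial l' m"
  by (induction m) simp_all

lemma mon_x_monomial: "mon ns = x_monomial (\<lambda>j. - 1 - int (ns ! (length ns - j))) (length ns)"
proof (induction ns)
  case (Cons n ns)
  have "x_monomial (\<lambda>j. - 1 - int (ns ! (length ns - j))) (length ns) =
    x_monomial (\<lambda>j. - 1 - int ((n # ns) ! (Suc (length ns) - j))) (length ns)"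
    by (rule x_monomial_cong) (simp add: Suc_diff_le)
  then show ?case using Cons by (simp add: mon_Cons xp_def)
qed (simp add: mon_Nil)

lemma W0q_eq: "W0q = fld.span (range mon)"
proof -
  have "{x_monomial l m | l m. \<forall>j\<in>{1..m}. l j \<le> -1} = range mon"
  proof safe
    fix l :: "nat \<Rightarrow> int" and m assume "\<forall>j\<in>{1..m}. l j \<le> (-1::int)"
    then show "x_monomial l m \<in> range mon" by (simp only: x_monomial_mon) blast
  next
    fix ns
    show "\<exists>l m. mon ns = x_monomial l m \<and> (\<forall>j\<in>{1..m}. l j \<le> -1)"
      by (intro exI conjI, rule mon_x_monomial) simp
  qed
  then show ?thesis by (simp add: W0q_def)
qed

lemma B_W0q_eq: "B_W0q = mon ` Collect admissible"
proof (intro subset_antisym subsetI)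
  fix A assume "A \<in> B_W0q"
  then obtain l m where A: "A = x_monomial l m" and l: "1 \<le> m \<longrightarrow> l 1 \<le> -1" "\<forall>r\<in>{2..m}. l r \<le> -3"
    unfolding B_W0q_def by blast
  have "l j \<le> -1" if "j \<in> {1..m}" for j
  proof (cases "j = 1")
    case False
    then have "l j \<le> -3" using l(2) that by auto
    then show ?thesis by simp
  qed (use l that in auto)
  moreover have "admissible (map (\<lambda>j. nat (- 1 - l j)) (rev [1..<Suc m]))"
  proof (cases m)
    case (Suc k)
    have "rev [1..<Suc m] = rev [2..<Suc m] @ [1]"
      using Suc by (subst upt_conv_Cons) (simp_all add: numeral_2_eq_2)
    then show ?thesis using l(2) by (force simp: admissible_def butlast_append)
  qed (simp add: admissible_def)
  ultimately show "A \<in> mon ` Collect admissible"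
    by (simp add: A x_monomial_mon del: upt_Suc)
next
  fix A assume "A \<in> mon ` Collect admissible"
  then obtain ns where A: "A = mon ns" and "admissible ns" by auto
  let ?l = "\<lambda>j. - 1 - int (ns ! (length ns - j))"
  have "?l r \<le> -3" if "r \<in> {2..length ns}" for r
  proof -
    have "length ns - r < length (butlast ns)" using that by auto
    then have "ns ! (length ns - r) \<in> set (butlast ns)"
      by (metis nth_butlast nth_mem)
    then show ?thesis using \<open>admissible ns\<close> by (auto simp: admissible_def)
  qed
  then show "A \<in> B_W0q"
    unfolding B_W0q_def A mem_Collect_eq by (intro exI[of _ ?l] exI[of _ "length ns"] conjI mon_x_monomial) auto
qed

theorem span_B_W0q: "fld.span B_W0q = W0q"
  unfolding B_W0q_eq W0q_eq
proof (rule subset_antisym)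
  show "fld.span (mon ` Collect admissible) \<subseteq> fld.span (range mon)"
    by (rule fld.span_mono) auto
  show "fld.span (range mon) \<subseteq> fld.span (mon ` Collect admissible)"
    by (rule fld.span_minimal) (auto simp: mon_straighten)
qed

section \<open>Linear independence of normally ordered products\<close>

definition poly_eval :: "L0 \<Rightarrow> F poly" where
  "poly_eval = L0_eval (\<lambda>c. [:c:]) (\<lambda>s. if s = 0 then [:0, 1:] else 0) (\<lambda>_. 1)"

lemma ring_morphism_poly_const: "ring_morphism (\<lambda>c :: F. [:c:])"
  by unfold_locales (simp_all add: one_pCons)

interpretation poly_eval: ring_morphism poly_eval
  unfolding poly_eval_def by (rule ring_morphism_L0_eval[OF ring_morphism_poly_const]) simp_all

lemma poly_eval_const: "poly_eval (const_L c) = [:c:]"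
  unfolding poly_eval_def by (rule L0_eval_const[OF ring_morphism_poly_const]) simp_all

lemma poly_eval_var: "poly_eval (var_L s) = (if s = 0 then [:0, 1:] else 0)"
  unfolding poly_eval_def by (rule L0_eval_var[OF ring_morphism_poly_const]) simp_all

lemma poly_eval_e: "poly_eval (e_L j) = 1"
  unfolding poly_eval_def by (rule L0_eval_e[OF ring_morphism_poly_const]) simp_all

lemma poly_eval_cre_exp_deriv:
  "fps_deriv (fps_map poly_eval (cre_exp x)) = fps_const [:0, cre_coeff 1 * x:] * fps_map poly_eval (cre_exp x)"
proof -
  have "fps_map poly_eval (fps_deriv (cre_log x)) = fps_const [:0, cre_coeff 1 * x:]"
    by (rule fps_ext)
       (simp add: cre_log_def poly_eval.mult poly_eval.of_nat poly_eval_const poly_eval_var)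
  then show ?thesis
    by (simp only: poly_eval.fps_map_deriv[symmetric] poly_eval.fps_map_mult[symmetric] cre_exp_deriv)
      (simp only: poly_eval.fps_map_mult)
qed

text \<open>The evaluated product solves f' = c f with f(0) = 1 and c independent of the series
  variable, so it is an exponential. Keeping the factorial on the left avoids division in
  \<open>F poly\<close>.\<close>

lemma poly_eval_cre_prod:
  "fact r * poly_eval (cre_prod xs $$ int r) = [:0, cre_coeff 1 * sum_list xs:] ^ r"
  "r' < 0 \<Longrightarrow> cre_prod xs $$ r' = 0"
proof -
  define E where "E = (\<Prod>x\<leftarrow>xs. cre_exp x)"
  have c: "cre_prod xs = fps_to_fls E"
    unfolding E_def by (induction xs) (simp_all add: cre_prod_def fls_times_fps_to_fls)
  then show "r' < 0 \<Longrightarrow> cre_prod xs $$ r' = 0" by simp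
  have "fps_deriv (fps_map poly_eval E) = fps_const [:0, cre_coeff 1 * sum_list xs:] * fps_map poly_eval E \<and>
      fps_map poly_eval E $ 0 = 1"
    unfolding E_def
  proof (induction xs)
    case Nil
    have "fps_map poly_eval 1 = 1" by (rule fps_ext) simp
    then show ?case by simp
  next
    case (Cons x xs)
    have "fps_const [:0, cre_coeff 1 * x:] + fps_const [:0, cre_coeff 1 * sum_list xs:] =
       fps_const [:0, cre_coeff 1 * sum_list (x # xs):]"
      by (simp add: distrib_left)
    moreover have "fps_deriv (fps_map poly_eval (\<Prod>x\<leftarrow>x # xs. cre_exp x)) =
      (fps_const [:0, cre_coeff 1 * x:] + fps_const [:0, cre_coeff 1 * sum_list xs:]) *
       fps_map poly_eval (\<Prod>x\<leftarrow>x # xs. cre_exp x)"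
      using Cons by (simp add: poly_eval.fps_map_mult poly_eval_cre_exp_deriv algebra_simps
          del: fps_const_add)
    ultimately show ?case
      using Cons by (simp add: poly_eval.mult cre_exp_0)
  qed
  then have d: "fps_deriv (fps_map poly_eval E) = fps_const [:0, cre_coeff 1 * sum_list xs:] * fps_map poly_eval E"
    and i: "fps_map poly_eval E $ 0 = 1" by auto
  have "fact r * fps_map poly_eval E $ r = [:0, cre_coeff 1 * sum_list xs:] ^ r"
  proof (induction r)
    case 0
    then show ?case using i by simp
  next
    case (Suc r)
    have "of_nat (Suc r) * fps_map poly_eval E $ Suc r = [:0, cre_coeff 1 * sum_list xs:] * fps_map poly_eval E $ r"
      using arg_cong[OF d, of "\<lambda>f. f $ r"] by (simp del: of_nat_Suc fps_map_nth mult_pCons_left)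
    then have "fact (Suc r) * fps_map poly_eval E $ Suc r =
       [:0, cre_coeff 1 * sum_list xs:] * (fact r * fps_map poly_eval E $ r)"
      by (simp add: mult_ac del: of_nat_Suc fps_map_nth mult_pCons_left mult_pCons_right)
    then show ?case unfolding Suc by (simp only: power_Suc)
  qed
  then show "fact r * poly_eval (cre_prod xs $$ int r) = [:0, cre_coeff 1 * sum_list xs:] ^ r"
    by (simp add: c)
qed

section \<open>Coefficient functionals separating the normally ordered products\<close>

lemma fact_poly_coeff: "coeff (fact r * p :: F poly) n = fact r * coeff p n"
proof -
  have "(fact r :: F poly) = [:fact r:]" by (metis of_nat_fact of_nat_poly)
  then show ?thesis by simp
qed

text \<open>This reads off the coefficient of a(-1)^n z^(n+k). In z^k' exp(c P a(-1) z) the degree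
  in a(-1) is the z-degree minus k', so the functional detects k' = k; the normalisation then leaves
  the pure power P^n.\<close>

definition coeff_functional :: "int \<Rightarrow> nat \<Rightarrow> fld \<Rightarrow> F" where
  "coeff_functional k n A = fact n * coeff (poly_eval (A 1 $$ (int n + k))) n / cre_coeff 1 ^ n"

lemma coeff_functional_linear: "coeff_functional k n (scale_fld c A + B) = c * coeff_functional k n A + coeff_functional k n B"
  by (simp add: coeff_functional_def plus_fun_apply scale_fld_apply cst_def poly_eval.add poly_eval.mult poly_eval_const
      algebra_simps add_divide_distrib)

lemma coeff_functional_zero [simp]: "coeff_functional k n 0 = 0"
  by (simp add: coeff_functional_def zero_fun_apply)

lemma coeff_functional_sum: "coeff_functional k n (\<Sum>a\<in>T. scale_fld (r a) (f a)) = (\<Sum>a\<in>T. r a * coeff_functional k n (f a))"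
  by (induction T rule: infinite_finite_induct) (simp_all add: coeff_functional_linear)

lemma cre_coeff_1_nonzero: "cre_coeff 1 \<noteq> 0"
  using qnum_nonzero[of 1] by (simp add: cre_coeff_def)

definition psum :: "nat list \<Rightarrow> F" where
  "psum J = (\<Sum>j\<leftarrow>J. qq ^ j)"

lemma coeff_functional_nfq: "coeff_functional k n (nfq J k') = (if k' = k then psum J ^ n else 0)"
proof -
  let ?xs = "map ((^) qq) J"
  have "(prod_list ?xs)\<^sup>2 \<noteq> 0"
    by (auto simp: prod_list_zero_iff)
  then have "nfq J k' 1 = zpow k' * (fls_const (e_L (int (length J))) * cre_prod ?xs)"
    by (simp add: nfq_def nf_def vo_def mult.assoc)
  then have "nfq J k' 1 $$ (int n + k) = e_L (int (length J)) * cre_prod ?xs $$ (int n + k - k')"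
    by (simp add: zpow_mult)
  then have e: "poly_eval (nfq J k' 1 $$ (int n + k)) = poly_eval (cre_prod ?xs $$ (int n + k - k'))"
    by (simp add: poly_eval.mult poly_eval_e)
  have p: "sum_list ?xs = psum J"
    by (simp add: psum_def)
  show ?thesis
  proof (cases "int n + k - k' < 0")
    case True
    then show ?thesis by (simp add: coeff_functional_def e poly_eval_cre_prod(2))
  next
    case False
    then obtain r where r: "int n + k - k' = int r"
      by (metis int_nat_eq not_less)
    have "[:0, c:] ^ r = monom (c ^ r) r" for c :: F
      using monom_power[of c 1 r] by (simp add: monom_Suc monom_0)
    then have f: "fact r * coeff (poly_eval (cre_prod ?xs $$ int r)) n =
        coeff (monom ((cre_coeff 1 * psum J) ^ r) r) n"
      using arg_cong[OF poly_eval_cre_prod(1)[of r ?xs], of "\<lambda>f. coeff f n"]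
      unfolding p by (simp add: fact_poly_coeff)
    have g: "coeff_functional k n (nfq J k') = fact n * coeff (poly_eval (cre_prod ?xs $$ int r)) n / cre_coeff 1 ^ n"
      by (simp add: coeff_functional_def e r)
    show ?thesis
    proof (cases "k' = k")
      case True
      then have "r = n" using r by simp
      then show ?thesis
        unfolding g using True f cre_coeff_1_nonzero by (simp add: power_mult_distrib)
    next
      case False
      then have "r \<noteq> n" using r by auto
      then show ?thesis
        unfolding g using False f by simp
    qed
  qed
qed

text \<open>As a polynomial in q^(1/2), \<open>psum J\<close> has at degree 4i the multiplicity of i
  in J, so it determines the multiset and hence the sorted list.\<close>

lemma psum_inject:
  assumes "sorted J" "sorted J'" "psum J = psum J'"
  shows "J = J'"
proof -
  define P where "P J = (\<Sum>j\<leftarrow>J. monom (1 :: complex) (4 * j))" for J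
  have "qq ^ j = Fraction_Field.Fract (monom 1 (4 * j)) 1" for j
    unfolding qq_eq power_mult[symmetric] by (rule q_half_power)
  then have f: "psum J = Fraction_Field.Fract (P J) 1" for J
    by (induction J) (simp_all add: psum_def P_def Zero_fract_def)
  have "coeff (P J) (4 * i) = of_nat (count (mset J) i)" for J i
    by (induction J) (simp_all add: P_def)
  moreover have "P J = P J'"
    using assms(3) by (simp add: f eq_fract)
  ultimately have "of_nat (count (mset J) i) = (of_nat (count (mset J') i) :: complex)" for i
    by metis
  then have "mset J = mset J'"
    by (intro multiset_eqI) simp
  then show ?thesis
    using assms(1,2) by (metis properties_for_sort sorted_sort_id)
qed

lemma nfq_not_in_span:
  assumes J0: "sorted J0"
  shows "nfq J0 k0 \<notin> fld.span {nfq J k | J k. sorted J \<and> (J, k) \<noteq> (J0, k0)}"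
proof
  assume "nfq J0 k0 \<in> fld.span {nfq J k | J k. sorted J \<and> (J, k) \<noteq> (J0, k0)}"
  then obtain T r where T: "finite T" "T \<subseteq> {nfq J k | J k. sorted J \<and> (J, k) \<noteq> (J0, k0)}"
    and eq: "nfq J0 k0 = (\<Sum>a\<in>T. scale_fld (r a) a)"
    unfolding fld.span_explicit by auto
  have "\<forall>a\<in>T. \<exists>Jk. a = nfq (fst Jk) (snd Jk) \<and> sorted (fst Jk) \<and> Jk \<noteq> (J0, k0)"
    using T(2) by fastforce
  then obtain Jk where Jk: "\<And>a. a \<in> T \<Longrightarrow> a = nfq (fst (Jk a)) (snd (Jk a)) \<and> sorted (fst (Jk a)) \<and> Jk a \<noteq> (J0, k0)"
    by metis
  define S where "S = {a \<in> T. snd (Jk a) = k0}"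
  \<comment> \<open>The Vandermonde argument without a determinant: weighting the functionals by the
    coefficients of \<open>Q\<close> turns the powers of \<open>psum\<close> into values of
    \<open>Q\<close>, whose roots are the \<open>psum\<close> of the competing terms with the same
    power of z.\<close>
  define Q where "Q = (\<Prod>a\<in>S. [:- psum (fst (Jk a)), 1:])"
  have S: "finite S" using T by (simp add: S_def)
  define \<Psi> where "\<Psi> A = (\<Sum>n\<le>degree Q. coeff Q n * coeff_functional k0 n A)" for A
  have \<Psi>: "\<Psi> (nfq J k) = (if k = k0 then poly Q (psum J) else 0)" for J k
    by (simp add: \<Psi>_def coeff_functional_nfq poly_altdef)
  have "\<Psi> (nfq J0 k0) = (\<Sum>a\<in>T. r a * \<Psi> a)"
    unfolding eq \<Psi>_def coeff_functional_sum sum_distrib_left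
    by (subst sum.swap) (simp add: mult_ac)
  also have "\<dots> = 0"
  proof (intro sum.neutral ballI)
    fix a assume a: "a \<in> T"
    have "\<Psi> a = \<Psi> (nfq (fst (Jk a)) (snd (Jk a)))"
      using Jk[OF a] by simp
    also have "\<dots> = 0"
      unfolding \<Psi> using a S by (auto simp: Q_def poly_prod S_def)
    finally show "r a * \<Psi> a = 0" by simp
  qed
  finally have "poly Q (psum J0) = 0"
    by (simp add: \<Psi>)
  then obtain a where a: "a \<in> S" "psum J0 = psum (fst (Jk a))"
    using S by (auto simp: Q_def poly_prod)
  then have "Jk a = (J0, k0)"
    using psum_inject[OF J0, of "fst (Jk a)"] Jk[of a] by (auto simp: S_def prod_eq_iff)
  then show False using Jk[of a] a by (simp add: S_def)
qed

section \<open>Leading terms\<close>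

primrec lead :: "nat list \<Rightarrow> nat list" where
  "lead [] = []"
| "lead (n # ns) = 0 # map ((+) n) (lead ns)"

primrec zdeg :: "nat list \<Rightarrow> int" where
  "zdeg [] = 0"
| "zdeg (n # ns) = zdeg ns - int n + 2 * int (length ns)"

lemma length_lead [simp]: "length (lead ns) = length ns"
  by (induction ns) auto

lemma sorted_shift: "sorted J \<Longrightarrow> sorted (map ((+) n) J)" for n :: nat
  by (induction J) auto

lemma sorted_lead: "sorted (lead ns)"
  by (induction ns) (auto simp: sorted_shift)

text \<open>Consecutive differences in \<open>lead\<close> give every order except the innermost
  one, which only shifts an empty list. That last order is recovered from
  \<open>zdeg\<close>.\<close>

lemma lead_inject: "lead ns = lead ns' \<Longrightarrow> zdeg ns = zdeg ns' \<Longrightarrow> ns = ns'"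
proof (induction ns arbitrary: ns')
  case Nil
  then show ?case by (cases ns') auto
next
  case (Cons n ns)
  obtain n' ms where ns': "ns' = n' # ms"
    using Cons.prems by (cases ns') auto
  have m: "map ((+) n) (lead ns) = map ((+) n') (lead ms)"
    using Cons.prems by (simp add: ns')
  have len: "length ns = length ms"
    using arg_cong[OF m, of length] by simp
  show ?case
  proof (cases ns)
    case Nil
    then show ?thesis using Cons.prems len by (simp add: ns')
  next
    case (Cons a as)
    then obtain b bs where "ms = b # bs" using len by (cases ms) auto
    then have "n = n'" using m Cons by simp
    moreover from this have "lead ns = lead ms"
      using m by (metis add_left_imp_eq inj_map_eq_map injI)
    ultimately show ?thesis
      using Cons.IH[of ms] Cons.prems len by (simp add: ns')
  qed
qed

text \<open>A factor of \<open>kappa 0\<close> vanishes just for the exponents 0 and 1.\<close>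

lemma kappa_nonzero: "\<forall>j\<in>set J. 2 \<le> j \<Longrightarrow> kappa 0 J \<noteq> 0"
proof (induction J)
  case (Cons j J)
  then have "qq ^ j \<noteq> 1" "qq ^ j / qq \<noteq> 1"
    using qq_power_eq_1_iff[of j] qq_power_eq_iff[of j 1] by auto
  then show ?case using Cons by (auto simp: kappa_Cons)
qed simp

text \<open>The constant term of (S - 1)(S - qq)...(S - qq^(n-1)) is a power of qq up to
  sign.\<close>

lemma Gop_lead: "\<exists>a. a \<noteq> 0 \<and> Gop n f - scale_fld a (f 0) \<in> fld.span (f ` {1..n})"
proof (induction n arbitrary: f)
  case 0
  show ?case by (rule exI[of _ 1]) (simp add: fld.span_zero)
next
  case (Suc n)
  let ?g = "\<lambda>i. f (Suc i) - scale_fld (qq ^ n) (f i)"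
  let ?U = "fld.span (f ` {1..Suc n})"
  obtain a where a: "a \<noteq> 0" "Gop n ?g - scale_fld a (?g 0) \<in> fld.span (?g ` {1..n})"
    using Suc.IH by blast
  have f: "f i \<in> ?U" if "i \<in> {1..Suc n}" for i
    using that by (intro fld.span_base imageI)
  have "?g ` {1..n} \<subseteq> ?U"
    by (intro image_subsetI fld.span_diff fld.span_scale f) auto
  then have "Gop n ?g - scale_fld a (?g 0) \<in> ?U"
    using a(2) fld.span_minimal[OF _ fld.subspace_span] by blast
  then have "Gop n ?g - scale_fld a (?g 0) + scale_fld a (f 1) \<in> ?U"
    by (intro fld.span_add fld.span_scale f) auto
  moreover have "Gop n ?g - scale_fld a (?g 0) + scale_fld a (f 1) = Gop (Suc n) f - scale_fld (- (a * qq ^ n)) (f 0)"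
    by (simp add: fld.scale_right_diff_distrib)
  ultimately have "Gop (Suc n) f - scale_fld (- (a * qq ^ n)) (f 0) \<in> ?U"
    by (simp only:)
  moreover have "- (a * qq ^ n) \<noteq> 0"
    using a(1) by simp
  ultimately show ?case by blast
qed

text \<open>The sum of exponents serves as the order on terms: every choice of exponents other than
  the smallest ones raises it, while the number of factors and the power of z are the same for all
  terms of a monomial.\<close>

definition higher :: "nat list \<Rightarrow> fld set" where
  "higher ns = fld.span {nfq J (zdeg ns) | J. length J = length ns \<and> sorted J \<and> sum_list (lead ns) < sum_list J}"

lemma sum_list_shift: "sum_list (map ((+) n) J) = n * length J + sum_list J" for n :: nat
  by (induction J) auto

lemma mon_lead:
  assumes "admissible ns"
  shows "\<exists>a. a \<noteq> 0 \<and> mon ns - scale_fld a (nfq (lead ns) (zdeg ns)) \<in> higher ns"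
  using assms
proof (induction ns)
  case Nil
  have "mon [] = nfq [] 0" by (simp add: mon_Nil one_fld_nf nfq_def)
  then show ?case by (intro exI[of _ 1]) (simp add: higher_def fld.span_zero)
next
  case (Cons n ns)
  have adm: "admissible ns" and n: "ns \<noteq> [] \<Longrightarrow> 2 \<le> n"
    using Cons.prems by (cases ns; auto simp: admissible_def)+
  obtain a where a: "a \<noteq> 0" "mon ns - scale_fld a (nfq (lead ns) (zdeg ns)) \<in> higher ns"
    using Cons.IH[OF adm] by blast
  define L where "L = nfq (lead ns) (zdeg ns)"
  define R where "R = mon ns - scale_fld a L"
  let ?S = "map ((+) n)"
  have H: "fld.subspace (higher (n # ns))" by (simp add: higher_def)
  \<comment> \<open>The new list is sorted because \<open>i\<close> is at most \<open>n\<close> and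
    every shifted entry is at least \<open>n\<close>.\<close>
  have tm: "nfq (i # ?S J) (zdeg (n # ns)) \<in> higher (n # ns)"
    if "i \<le> n" "length J = length ns" "sorted J" "sum_list (lead ns) < i + sum_list J" for i J
    unfolding higher_def
    by (rule fld.span_base) (use that in \<open>auto simp: sum_list_shift sorted_shift\<close>)
  have xpJ: "xp n (nfq J (zdeg ns)) = scale_fld (wt n * (qq ^ n) powi zdeg ns)
     (Gop n (\<lambda>i. scale_fld (kappa i (?S J)) (nfq (i # ?S J) (zdeg (n # ns)))))"
    if "length J = length ns" for J
    using that by (simp add: xp_nfq)
  have "xp n R \<in> higher (n # ns)"
  proof -
    let ?X = "{nfq J (zdeg ns) | J. length J = length ns \<and> sorted J \<and> sum_list (lead ns) < sum_list J}"
    have "xp n R \<in> fld.span (xp n ` ?X)"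
      using a(2) by (intro xp_span) (auto simp: R_def L_def higher_def)
    moreover have "xp n ` ?X \<subseteq> higher (n # ns)"
      by (auto simp: xpJ simp del: zdeg.simps intro!: fld.subspace_scale[OF H] Gop_in_subspace[OF H] tm)
    ultimately show ?thesis
      using fld.span_minimal[OF _ H] by blast
  qed
  moreover have "\<exists>b. b \<noteq> 0 \<and> xp n L - scale_fld b (nfq (lead (n # ns)) (zdeg (n # ns))) \<in> higher (n # ns)"
  proof -
    let ?f = "\<lambda>i. scale_fld (kappa i (?S (lead ns))) (nfq (i # ?S (lead ns)) (zdeg (n # ns)))"
    let ?w = "wt n * (qq ^ n) powi zdeg ns"
    obtain c where c: "c \<noteq> 0" "Gop n ?f - scale_fld c (?f 0) \<in> fld.span (?f ` {1..n})"
      using Gop_lead[of n ?f] by blast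
    have "?f ` {1..n} \<subseteq> higher (n # ns)"
      by (auto simp del: zdeg.simps intro!: fld.subspace_scale[OF H] tm sorted_lead)
    then have "Gop n ?f - scale_fld c (?f 0) \<in> higher (n # ns)"
      using c(2) fld.span_minimal[OF _ H] by blast
    then have "scale_fld ?w (Gop n ?f - scale_fld c (?f 0)) \<in> higher (n # ns)"
      by (rule fld.subspace_scale[OF H])
    moreover have "scale_fld ?w (Gop n ?f - scale_fld c (?f 0)) =
        xp n L - scale_fld (?w * (c * kappa 0 (?S (lead ns)))) (nfq (lead (n # ns)) (zdeg (n # ns)))"
      by (simp add: L_def xpJ fld.scale_right_diff_distrib mult.assoc del: zdeg.simps)
    \<comment> \<open>Admissibility is used here: if \<open>ns\<close> is nonempty then
      \<open>n\<close> is at least 2, hence so are all shifted entries; otherwise the list is empty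
      and \<open>kappa\<close> is 1.\<close>
    moreover have "kappa 0 (?S (lead ns)) \<noteq> 0"
      by (rule kappa_nonzero) (use n in \<open>cases ns; auto\<close>)
    ultimately show ?thesis
      using c(1) wt_nonzero by (intro exI[of _ "?w * (c * kappa 0 (?S (lead ns)))"]) (simp del: zdeg.simps lead.simps)
  qed
  then obtain b where b: "b \<noteq> 0" "xp n L - scale_fld b (nfq (lead (n # ns)) (zdeg (n # ns))) \<in> higher (n # ns)"
    by blast
  have "L \<in> nf_space" by (simp add: L_def)
  then have "R \<in> nf_space"
    unfolding R_def by (intro fld.subspace_diff fld.subspace_scale subspace_nf_space mon_in_nf_space)
  have "mon ns = scale_fld a L + R" by (simp add: R_def)
  then have "mon (n # ns) = scale_fld a (xp n L) + xp n R"
    using \<open>L \<in> nf_space\<close> \<open>R \<in> nf_space\<close> by (simp add: mon_Cons xp_linear)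
  then have "mon (n # ns) - scale_fld (a * b) (nfq (lead (n # ns)) (zdeg (n # ns))) =
     scale_fld a (xp n L - scale_fld b (nfq (lead (n # ns)) (zdeg (n # ns)))) + xp n R"
    by (simp add: fld.scale_right_diff_distrib del: zdeg.simps lead.simps)
  moreover have "\<dots> \<in> higher (n # ns)"
    using b \<open>xp n R \<in> higher (n # ns)\<close> by (intro fld.subspace_add fld.subspace_scale H)
  ultimately show ?case
    using a(1) b(1) by (intro exI[of _ "a * b"]) (simp del: zdeg.simps lead.simps)
qed

text \<open>Triangularity: among the monomials with nonzero coefficient take \<open>w\<close> with
  the least exponent sum of the leading term. This leading term occurs in no other monomial and in
  no higher part, so a relation would put it in the span of different normally ordered
  products.\<close>

theorem independent_B_W0q: "fld.independent B_W0q"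
  unfolding B_W0q_eq fld.independent_explicit_module
proof (intro allI impI)
  fix T u v0
  assume T: "finite T" "T \<subseteq> mon ` Collect admissible" and eq: "(\<Sum>v\<in>T. scale_fld (u v) v) = 0" and "v0 \<in> T"
  have "\<forall>v\<in>T. \<exists>ns. v = mon ns \<and> admissible ns"
    using T(2) by auto
  then obtain ns where ns: "\<And>v. v \<in> T \<Longrightarrow> v = mon (ns v) \<and> admissible (ns v)"
    by metis
  show "u v0 = 0"
  proof (rule ccontr)
    assume "u v0 \<noteq> 0"
    define T' where "T' = {v \<in> T. u v \<noteq> 0}"
    have "finite T'" "T' \<noteq> {}"
      using T \<open>v0 \<in> T\<close> \<open>u v0 \<noteq> 0\<close> by (auto simp: T'_def)
    then obtain w where w: "w \<in> T'" "\<And>v. v \<in> T' \<Longrightarrow> sum_list (lead (ns w)) \<le> sum_list (lead (ns v))"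
      using arg_min_least[of T' _ "\<lambda>v. sum_list (lead (ns v))"] arg_min_if_finite(1)[of T' "\<lambda>v. sum_list (lead (ns v))"]
      by metis
    let ?J = "lead (ns w)" and ?k = "zdeg (ns w)"
    define U where "U = fld.span {nfq J k | J k. sorted J \<and> (J, k) \<noteq> (?J, ?k)}"
    have U: "fld.subspace U" by (simp add: U_def)
    have hU: "higher (ns v) \<subseteq> U" if "v \<in> T'" for v
      unfolding higher_def U_def
    proof (rule fld.span_mono, safe)
      fix J assume "sorted J" "sum_list (lead (ns v)) < sum_list J"
      then have "J \<noteq> ?J" using w(2)[OF that] by auto
      with \<open>sorted J\<close> show "\<exists>J' k. nfq J (zdeg (ns v)) = nfq J' k \<and> sorted J' \<and> (J', k) \<noteq> (?J, ?k)"
        by blast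
    qed
    have other: "v \<in> U" if v: "v \<in> T'" "v \<noteq> w" for v
    proof -
      have nsv: "v = mon (ns v)" "w = mon (ns w)" "admissible (ns v)"
        using ns v w(1) by (auto simp: T'_def)
      then have "(lead (ns v), zdeg (ns v)) \<noteq> (?J, ?k)"
        using lead_inject[of "ns v" "ns w"] v(2) by auto
      then have "nfq (lead (ns v)) (zdeg (ns v)) \<in> U"
        unfolding U_def using sorted_lead by (intro fld.span_base) blast
      moreover obtain a where "mon (ns v) - scale_fld a (nfq (lead (ns v)) (zdeg (ns v))) \<in> higher (ns v)"
        using mon_lead[OF nsv(3)] by blast
      ultimately have "mon (ns v) - scale_fld a (nfq (lead (ns v)) (zdeg (ns v))) +
          scale_fld a (nfq (lead (ns v)) (zdeg (ns v))) \<in> U"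
        using hU[OF v(1)] by (intro fld.subspace_add[OF U] fld.subspace_scale[OF U]) auto
      then show ?thesis using nsv(1) by simp
    qed
    have "(\<Sum>v\<in>T'. scale_fld (u v) v) = 0"
      unfolding eq[symmetric] using T(1) by (intro sum.mono_neutral_left) (auto simp: T'_def)
    then have "scale_fld (u w) w = - (\<Sum>v\<in>T' - {w}. scale_fld (u v) v)"
      using sum.remove[OF \<open>finite T'\<close> w(1), of "\<lambda>v. scale_fld (u v) v"] by (simp add: eq_neg_iff_add_eq_0)
    moreover have "- (\<Sum>v\<in>T' - {w}. scale_fld (u v) v) \<in> U"
      by (intro fld.subspace_neg[OF U] fld.subspace_sum[OF U] fld.subspace_scale[OF U] other) auto
    ultimately have "scale_fld (inverse (u w)) (scale_fld (u w) w) \<in> U"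
      by (simp only: fld.subspace_scale[OF U])
    then have "w \<in> U" using w(1) by (simp add: T'_def)
    obtain a where a: "a \<noteq> 0" "mon (ns w) - scale_fld a (nfq ?J ?k) \<in> higher (ns w)"
      using mon_lead[of "ns w"] ns w(1) by (auto simp: T'_def)
    have "w - (mon (ns w) - scale_fld a (nfq ?J ?k)) \<in> U"
      using a(2) hU[OF w(1)] by (intro fld.subspace_diff[OF U \<open>w \<in> U\<close>]) auto
    moreover have "w - (mon (ns w) - scale_fld a (nfq ?J ?k)) = scale_fld a (nfq ?J ?k)"
      using ns[of w] w(1) by (simp add: T'_def)
    ultimately have "scale_fld (inverse a) (scale_fld a (nfq ?J ?k)) \<in> U"
      by (simp only: fld.subspace_scale[OF U])
    then have "nfq ?J ?k \<in> U" using a(1) by simp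
    then show False
      unfolding U_def using nfq_not_in_span[OF sorted_lead] by blast
  qed
qed

theorem theorem4p8:
  shows "fld.independent B_W0q \<and> fld.span B_W0q = W0q"
  using independent_B_W0q span_B_W0q by blast

end
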